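(* Let $0<p,q<\infty$ and $\omega\in\widehat{\mathcal{D}}$. Then $AL^q_p(\omega)=AT^q_p(\omega)$ with equivalence of quasinorms.
   Context: $\mathbb{D}$ is the open unit disc, $\mathbb{T}=\partial\mathbb{D}$, $\mathcal{H}(\mathbb{D})$ is the space of analytic functions in $\mathbb{D}$, and $dA=\frac{dx\,dy}{\pi}$. A weight is a function $\omega:\mathbb{D}\to[0,\infty)$ integrable over $\mathbb{D}$; it is radial if $\omega(z)=\omega(|z|)$ for all $z\in\mathbb{D}$. Throughout, it is assumed that $\widehat{\omega}(z)=\int_{|z|}^1\omega(s)\,ds>0$ for all $z\in\mathbb{D}$. A radial weight $\omega$ belongs to $\widehat{\mathcal{D}}$ if there exists $C=C(\omega)>0$ such that $\widehat{\omega}(r)\le C\,\widehat{\omega}\left(\frac{1+r}{2}\right)$ as $r\to1^-$ (i.e. for all $r<1$ sufficiently close to $1$). For $\xi\in\overline{\mathbb{D}}$, $\Gamma(\xi)=\{z\in\mathbb{D}:|\arg z-\arg\xi|<|\xi|-|z|\}$ (difference of arguments modulo $2\pi$). For $0<p,q<\infty$, $L^q_p(\omega)$ and $T^q_p(\omega)$ consist of the complex-valued measurable functions $f$ on $\mathbb{D}$ such that, respectively, $$\|f\|_{L^q_p(\omega)}=\left(\frac1{2\pi}\int_0^{2\pi}\left(\int_0^1|f(re^{i\theta})|^p\omega(r)r\,dr\right)^{q/p}d\theta\right)^{1/q}<\infty,$$ $$\|f\|_{T^q_p(\omega)}=\left(\int_{\mathbb{T}}\left(\int_{\Gamma(\xi)}|f(z)|^p\omega(z)\frac{dA(z)}{1-|z|}\right)^{q/p}|d\xi|\right)^{1/q}<\infty.$$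 Set $AL^q_p(\omega)=L^q_p(\omega)\cap\mathcal{H}(\mathbb{D})$ and $AT^q_p(\omega)=T^q_p(\omega)\cap\mathcal{H}(\mathbb{D})$, with the inherited quasinorms. *)

theory Defs
  imports "HOL-Analysis.Analysis"
begin

abbreviation unit_disc :: "complex set" where
  "unit_disc \<equiv> ball 0 1"

definition area_measure :: "complex measure" where
  "area_measure = scale_measure (ennreal (1 / pi)) lebesgue"

text \<open>
  Real powers on the extended nonnegative reals, needed because the inner integrals of the mixed
  norms may be infinite. Only positive exponents are used below, hence \<open>\<infinity>\<close> to the power \<open>a\<close>
  is \<open>\<infinity>\<close>.
\<close>
definition ennreal_powr :: "ennreal \<Rightarrow> real \<Rightarrow> ennreal" where
  "ennreal_powr x a = (if x = \<infinity> then \<infinity> else ennreal (enn2real x powr a))"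

text \<open>
  Values in \<^typ>\<open>ennreal\<close>: integrability of a radial weight with respect to area does not exclude
  that the integral diverges at \<open>z = 0\<close> (for example \<open>s powr - 3/2\<close> near the origin).
\<close>
definition weight_hat :: "(complex \<Rightarrow> real) \<Rightarrow> complex \<Rightarrow> ennreal" where
  "weight_hat \<omega> z = (\<integral>\<^sup>+ s \<in> {norm z..<1}. ennreal (\<omega> (of_real s)) \<partial>lebesgue)"

definition weight :: "(complex \<Rightarrow> real) \<Rightarrow> bool" where
  "weight \<omega> \<longleftrightarrow> (\<forall>z\<in>unit_disc. 0 \<le> \<omega> z) \<and> set_integrable lebesgue unit_disc \<omega>"

definition radial_weight :: "(complex \<Rightarrow> real) \<Rightarrow> bool" where
  "radial_weight \<omega> \<longleftrightarrow> weight \<omega> \<and> (\<forall>z\<in>unit_disc. \<omega> z = \<omega> (of_real (norm z)))"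

text \<open>
  The class of doubling radial weights; the standing assumption that \<^const>\<open>weight_hat\<close> is
  strictly positive on the disc is included here.
\<close>
definition D_hat :: "(complex \<Rightarrow> real) set" where
  "D_hat = {\<omega>. radial_weight \<omega> \<and> (\<forall>z\<in>unit_disc. 0 < weight_hat \<omega> z) \<and>
     (\<exists>C::real. C > 0 \<and>
        (\<forall>\<^sub>F r in at_left (1::real).
           weight_hat \<omega> (of_real r) \<le> ennreal C * weight_hat \<omega> (of_real ((1 + r) / 2))))}"

text \<open>
  The integer \<open>k\<close> expresses that the difference of the arguments is taken modulo \<open>2\<pi>\<close>.
  The convention \<open>Arg 0 = 0\<close> only affects membership of the single point \<open>z = 0\<close> (for \<open>\<xi> \<noteq> 0\<close>;
  the region is empty for \<open>\<xi> = 0\<close>).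
\<close>
definition Gamma_region :: "complex \<Rightarrow> complex set" where
  "Gamma_region \<xi> =
     {z \<in> unit_disc. \<exists>k::int. \<bar>Arg z - Arg \<xi> + 2 * pi * of_int k\<bar> < norm \<xi> - norm z}"

definition L_norm :: "real \<Rightarrow> real \<Rightarrow> (complex \<Rightarrow> real) \<Rightarrow> (complex \<Rightarrow> complex) \<Rightarrow> ennreal" where
  "L_norm p q \<omega> f =
     ennreal_powr
       (ennreal (1 / (2 * pi)) *
        (\<integral>\<^sup>+ \<theta> \<in> {0..2 * pi}.
           ennreal_powr
             (\<integral>\<^sup>+ r \<in> {0..<1}.
                ennreal (norm (f (of_real r * cis \<theta>)) powr p * \<omega> (of_real r) * r) \<partial>lebesgue)
             (q / p) \<partial>lebesgue))
       (1 / q)"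

text \<open>Arc length on the unit circle is parametrised by \<open>\<xi> = cis \<theta>\<close>, without normalisation.\<close>
definition T_norm :: "real \<Rightarrow> real \<Rightarrow> (complex \<Rightarrow> real) \<Rightarrow> (complex \<Rightarrow> complex) \<Rightarrow> ennreal" where
  "T_norm p q \<omega> f =
     ennreal_powr
       (\<integral>\<^sup>+ \<theta> \<in> {0..2 * pi}.
          ennreal_powr
            (\<integral>\<^sup>+ z \<in> Gamma_region (cis \<theta>).
               ennreal (norm (f z) powr p * \<omega> z / (1 - norm z)) \<partial>area_measure)
            (q / p) \<partial>lebesgue)
       (1 / q)"

text \<open>
  Functions on the disc are total functions whose values outside the disc are irrelevant:
  none of the conditions below depends on them.
\<close>
definition L_space :: "real \<Rightarrow> real \<Rightarrow> (complex \<Rightarrow> real) \<Rightarrow> (complex \<Rightarrow> complex) set" where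
  "L_space p q \<omega> = {f. f \<in> borel_measurable (lebesgue_on unit_disc) \<and> L_norm p q \<omega> f < \<infinity>}"

definition T_space :: "real \<Rightarrow> real \<Rightarrow> (complex \<Rightarrow> real) \<Rightarrow> (complex \<Rightarrow> complex) set" where
  "T_space p q \<omega> = {f. f \<in> borel_measurable (lebesgue_on unit_disc) \<and> T_norm p q \<omega> f < \<infinity>}"

definition AL_space :: "real \<Rightarrow> real \<Rightarrow> (complex \<Rightarrow> real) \<Rightarrow> (complex \<Rightarrow> complex) set" where
  "AL_space p q \<omega> = L_space p q \<omega> \<inter> {f. f holomorphic_on unit_disc}"

definition AT_space :: "real \<Rightarrow> real \<Rightarrow> (complex \<Rightarrow> real) \<Rightarrow> (complex \<Rightarrow> complex) set" where
  "AT_space p q \<omega> = T_space p q \<omega> \<inter> {f. f holomorphic_on unit_disc}"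

end

(*
  Write a = q/p and g(r,t) = |f(r e^{it})|^p, and let nu be the measure omega(r) r dr. In polar
  coordinates the inner integral of the T-norm is, up to the factor 2/pi, the nu-integral of the
  averages of g(r,.) over arcs of half-length 1 - r, so one has to compare it in L^a with the
  nu-integral of g(r,.) itself. Both are at most the nu-integral of N_r, the supremum of |f|^p over
  the nontangential region cut off at radius r. Since N_r increases with r, the doubling of the tails
  of nu allows replacing N_r by N_{2r-1}, and the Poisson inequality for the subharmonic function
  |f|^{sp}, s small, bounds N_{2r-1}^s by the Hardy-Littlewood maximal function of v_r^s for either
  family v_r. A Fefferman-Stein type inequality for the maximal function, in L^{a/s} with values in
  L^{1/s}(nu), then gives both estimates; it follows from the weighted scalar maximal inequality,
  by duality if a >= 1 and by Hoelder's inequality with the weight (int v_r dnu)^{a-1} if a < 1.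
*)
theory Submission
  imports Defs "HOL-Complex_Analysis.Complex_Analysis" "HOL-Real_Asymp.Real_Asymp"
begin

subsection \<open>Real powers of extended nonnegative reals\<close>

text \<open>Membership in \<open>D_hat\<close> controls only tail integrals of the weight. The
  weight may vanish on whole annuli, so integrals over neighbouring circles or discs cannot be
  compared with each other; only functions monotone in the radius can be moved inwards. This is why
  both families pass through a supremum. The move is needed because a Poisson integral over the
  circle of radius r sees a point of radius \<rho> at scale 1 - \<rho> only if r - \<rho> is
  comparable with 1 - \<rho>, and \<rho> <= 2r - 1 gives r - \<rho> >= (1 - \<rho>)/2.

  The power s repairs the failure of the maximal inequality in L^1: both 1/s and a/s exceed 1. The
  value min(1, a)/4 is dictated by the case a < 1. The dominating family v has to satisfy that v_r^s
  controls the integrals of |f|^(sp) over arcs of half-length at least 1 - r; the dominated one has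
  to lie below N_r. Exchanging the roles therefore gives both inequalities from one lemma. The
  factor r in nu is not cosmetic: the weight need not be integrable in r near the origin.\<close>

lemma ennreal_powr_top [simp]: "ennreal_powr \<infinity> a = \<infinity>" "ennreal_powr top a = top"
  by (simp_all add: ennreal_powr_def)

lemma ennreal_powr_ennreal: "0 \<le> x \<Longrightarrow> ennreal_powr (ennreal x) a = ennreal (x powr a)"
  by (simp add: ennreal_powr_def)

lemma ennreal_powr_0 [simp]: "ennreal_powr 0 a = 0"
  by (simp add: ennreal_powr_def)

lemma ennreal_powr_1 [simp]: "ennreal_powr 1 a = 1" "ennreal_powr x 1 = x"
  by (cases x; simp add: ennreal_powr_def)+

lemma ennreal_powr_mono:
  assumes "x \<le> y" "0 \<le> a"
  shows "ennreal_powr x a \<le> ennreal_powr y a"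
proof (cases y)
  case (real v)
  then obtain u where "x = ennreal u" "0 \<le> u" using assms(1) by (cases x) (auto simp: top_unique)
  then show ?thesis using real assms by (auto simp: ennreal_powr_ennreal intro!: ennreal_leI powr_mono2)
qed auto

lemma ennreal_powr_powr:
  "ennreal_powr (ennreal_powr x a) b = ennreal_powr x (a * b)"
  by (cases x) (auto simp: ennreal_powr_ennreal powr_powr)

lemma ennreal_powr_mult:
  assumes "0 < a"
  shows "ennreal_powr (x * y) a = ennreal_powr x a * ennreal_powr y a"
proof (cases "x = 0 \<or> y = 0")
  case False
  show ?thesis
  proof (cases x)
    case x: (real u)
    show ?thesis
    proof (cases y)
      case y: (real v)
      show ?thesis using x y by (simp add: ennreal_powr_ennreal ennreal_mult[symmetric] powr_mult)
    next
      case top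
      have "u > 0" using x False by (cases "u = 0") auto
      then show ?thesis using x top by (simp add: ennreal_powr_ennreal ennreal_mult_top)
    qed
  next
    case top
    have "ennreal_powr y a \<noteq> 0"
      using False assms by (cases y) (auto simp: ennreal_powr_ennreal)
    then show ?thesis using top False by (simp add: ennreal_top_mult)
  qed
qed auto

lemma ennreal_powr_cmult:
  assumes "0 < a" "0 \<le> c"
  shows "ennreal_powr (ennreal c * x) a = ennreal (c powr a) * ennreal_powr x a"
  using assms by (simp add: ennreal_powr_mult ennreal_powr_ennreal)

lemma ennreal_powr_add:
  assumes "0 \<le> a" "0 \<le> b"
  shows "ennreal_powr x (a + b) = ennreal_powr x a * ennreal_powr x b"
proof (cases x)
  case (real u)
  then show ?thesis using assms
    by (simp add: ennreal_powr_ennreal powr_add ennreal_mult[symmetric])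
qed (simp add: ennreal_mult_top)

lemma ennreal_powr_inverse:
  assumes "0 < a"
  shows "ennreal_powr (ennreal_powr x a) (1 / a) = x" "ennreal_powr (ennreal_powr x (1 / a)) a = x"
  using assms by (simp_all add: ennreal_powr_powr)

text \<open>Bounding \<open>x + y\<close> by twice the maximum works for every positive exponent,
  above and below 1 alike.\<close>

lemma ennreal_powr_sum_le:
  assumes "0 < a"
  shows "ennreal_powr (x + y) a \<le> ennreal (2 powr a) * (ennreal_powr x a + ennreal_powr y a)"
proof -
  have "x + y \<le> ennreal 2 * max x y"
  proof -
    have "x + y \<le> max x y + max x y" by (intro add_mono) auto
    also have "\<dots> = 2 * max x y" by (simp add: mult_2)
    finally show ?thesis by simp
  qed
  then have "ennreal_powr (x + y) a \<le> ennreal_powr (ennreal 2 * max x y) a"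
    using assms by (intro ennreal_powr_mono) auto
  also have "\<dots> = ennreal (2 powr a) * ennreal_powr (max x y) a"
    using assms by (subst ennreal_powr_cmult) auto
  also have "ennreal_powr (max x y) a \<le> ennreal_powr x a + ennreal_powr y a"
    by (auto simp: max_def)
  finally show ?thesis by (simp add: mult_left_mono)
qed

lemma measurable_ennreal_powr [measurable (raw)]:
  assumes [measurable]: "f \<in> borel_measurable M"
  shows "(\<lambda>x. ennreal_powr (f x) a) \<in> borel_measurable M"
  unfolding ennreal_powr_def by measurable

text \<open>Weighted arithmetic-geometric mean with the weights \<open>a\<close> and
  \<open>1 - a\<close> rounded up to 1. Extremal values need no argument: a zero factor kills the
  left-hand side even against \<open>top\<close>, and otherwise an infinite one makes the right-hand
  side infinite.\<close>

lemma ennreal_powr_Young: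
  assumes "0 < a" "a < 1"
  shows "ennreal_powr x a * ennreal_powr y (1 - a) \<le> x + y"
proof (cases "x = 0 \<or> y = 0 \<or> x = top \<or> y = top")
  case False
  then obtain u v where *: "x = ennreal u" "y = ennreal v" "0 < u" "0 < v"
    by (cases x; cases y) (auto simp: less_le)
  have "u powr a * v powr (1 - a) \<le> a * u + (1 - a) * v"
    using Youngs_inequality_0[of a "1 - a" u v] assms * by auto
  also have "\<dots> \<le> u + v" using assms * by (intro add_mono mult_left_le_one_le) auto
  finally show ?thesis using *
    by (simp add: ennreal_powr_ennreal ennreal_mult[symmetric] ennreal_plus[symmetric] del: ennreal_plus)
qed auto

lemma ennreal_powr_eq_0_iff: "ennreal_powr x a = 0 \<longleftrightarrow> x = 0"
  by (cases x) (auto simp: ennreal_powr_ennreal)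

lemma ennreal_powr_less_top_iff: "ennreal_powr x a < \<infinity> \<longleftrightarrow> x < \<infinity>"
  by (cases x) (auto simp: ennreal_powr_ennreal)

subsection \<open>The weighted Hardy--Littlewood maximal inequality on the line\<close>

text \<open>The supremum runs over dyadic radii only, so that joint measurability in a parameter is immediate.\<close>
definition hl_max :: "(real \<Rightarrow> ennreal) \<Rightarrow> real \<Rightarrow> ennreal" where
  "hl_max f \<theta> = (SUP k::int. ennreal (1 / (2 * 2 powi k)) *
     (\<integral>\<^sup>+t\<in>{t. \<bar>t - \<theta>\<bar> \<le> 2 powi k}. f t \<partial>lborel))"

lemma integral_dyadic_le_hl_max:
  "(\<integral>\<^sup>+t\<in>{t. \<bar>t - \<theta>\<bar> \<le> 2 powi k}. f t \<partial>lborel) \<le> ennreal (2 * 2 powi k) * hl_max f \<theta>"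
  (is "?I \<le> _")
proof -
  have "?I = ennreal (2 * 2 powi k) * (ennreal (1 / (2 * 2 powi k)) * ?I)"
    by (simp add: mult.assoc[symmetric] ennreal_mult[symmetric])
  also have "\<dots> \<le> ennreal (2 * 2 powi k) * hl_max f \<theta>"
    unfolding hl_max_def by (intro mult_left_mono SUP_upper) auto
  finally show ?thesis .
qed

lemma dyadic_radius:
  fixes x :: real
  assumes "0 < x" obtains k :: int where "x \<le> 2 powi k" "2 powi k \<le> 2 * x"
proof
  let ?k = "\<lceil>log 2 x\<rceil>"
  have eq: "(2::real) powi ?k = 2 powr real_of_int ?k" by (simp add: powr_real_of_int')
  have "x = 2 powr (log 2 x)" using assms by simp
  also have "\<dots> \<le> 2 powr real_of_int ?k" by (intro powr_mono) auto
  finally show "x \<le> 2 powi ?k" using eq by simp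
  have "2 powr real_of_int ?k \<le> 2 powr (log 2 x + 1)" by (intro powr_mono) linarith+
  also have "\<dots> = 2 * x" using assms by (simp add: powr_add)
  finally show "2 powi ?k \<le> 2 * x" using eq by simp
qed

text \<open>Rounding the radius up to a power of two at most doubles it, hence \<open>4 * x\<close>
  in place of the length \<open>2 * x\<close>.\<close>

lemma integral_le_hl_max:
  assumes "0 < x"
  shows "(\<integral>\<^sup>+t\<in>{t. \<bar>t - \<theta>\<bar> \<le> x}. f t \<partial>lborel) \<le> ennreal (4 * x) * hl_max f \<theta>"
proof -
  obtain k :: int where k: "x \<le> 2 powi k" "2 powi k \<le> 2 * x" using dyadic_radius[OF assms] .
  have "(\<integral>\<^sup>+t\<in>{t. \<bar>t - \<theta>\<bar> \<le> x}. f t \<partial>lborel)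
     \<le> (\<integral>\<^sup>+t\<in>{t. \<bar>t - \<theta>\<bar> \<le> 2 powi k}. f t \<partial>lborel)"
    using k by (intro nn_integral_mono mult_left_mono) (auto split: split_indicator)
  also have "\<dots> \<le> ennreal (2 * 2 powi k) * hl_max f \<theta>" by (rule integral_dyadic_le_hl_max)
  also have "\<dots> \<le> ennreal (4 * x) * hl_max f \<theta>"
    using k by (intro mult_right_mono ennreal_leI) auto
  finally show ?thesis .
qed

lemma measurable_hl_max [measurable (raw)]:
  assumes F: "(\<lambda>(r, t). F r t) \<in> borel_measurable (N \<Otimes>\<^sub>M borel)"
    and g[measurable]: "g \<in> N \<rightarrow>\<^sub>M borel"
  shows "(\<lambda>r. hl_max (F r) (g r)) \<in> borel_measurable N"
proof -
  have [measurable]: "(\<lambda>(r, t). F r t) \<in> borel_measurable (N \<Otimes>\<^sub>M lborel)"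
    using F by (simp cong: measurable_cong_sets sets_pair_measure_cong)
  show ?thesis unfolding hl_max_def by measurable
qed

lemma hl_max_mono: "(\<And>t. f t \<le> g t) \<Longrightarrow> hl_max f \<theta> \<le> hl_max g \<theta>"
  unfolding hl_max_def
  by (intro SUP_mono) (auto intro!: mult_left_mono mult_right_mono nn_integral_mono exI)

lemma integral_const_near:
  assumes "0 \<le> x"
  shows "(\<integral>\<^sup>+t\<in>{t. \<bar>t - \<theta>\<bar> \<le> x}. c \<partial>lborel) = ennreal (2 * x) * c"
proof -
  have "{t. \<bar>t - \<theta>\<bar> \<le> x} = {\<theta> - x..\<theta> + x}" by auto
  then show ?thesis using assms by (subst nn_integral_cmult) (auto simp: mult.commute)
qed

text \<open>For cutting a function at half the level: an additive constant passes through every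
  average unchanged.\<close>

lemma hl_max_add_const:
  assumes [measurable]: "f \<in> borel_measurable borel"
  shows "hl_max (\<lambda>t. f t + c) \<theta> \<le> hl_max f \<theta> + c"
  unfolding hl_max_def
proof (rule SUP_least)
  fix k :: int
  have "(\<integral>\<^sup>+t\<in>{t. \<bar>t - \<theta>\<bar> \<le> 2 powi k}. (f t + c) \<partial>lborel) =
     (\<integral>\<^sup>+t\<in>{t. \<bar>t - \<theta>\<bar> \<le> 2 powi k}. f t \<partial>lborel) + ennreal (2 * 2 powi k) * c"
    by (simp add: distrib_right nn_integral_add integral_const_near)
  then have "ennreal (1 / (2 * 2 powi k)) * (\<integral>\<^sup>+t\<in>{t. \<bar>t - \<theta>\<bar> \<le> 2 powi k}. (f t + c) \<partial>lborel)
    = ennreal (1 / (2 * 2 powi k)) * (\<integral>\<^sup>+t\<in>{t. \<bar>t - \<theta>\<bar> \<le> 2 powi k}. f t \<partial>lborel) + c"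
    by (simp add: distrib_left mult.assoc[symmetric] ennreal_mult[symmetric])
  also have "\<dots> \<le> (SUP k::int. ennreal (1 / (2 * 2 powi k)) *
     (\<integral>\<^sup>+t\<in>{t. \<bar>t - \<theta>\<bar> \<le> 2 powi k}. f t \<partial>lborel)) + c"
    by (intro add_mono SUP_upper2[where i=k]) auto
  finally show "ennreal (1 / (2 * 2 powi k)) * (\<integral>\<^sup>+t\<in>{t. \<bar>t - \<theta>\<bar> \<le> 2 powi k}. (f t + c) \<partial>lborel)
    \<le> (SUP k::int. ennreal (1 / (2 * 2 powi k)) *
     (\<integral>\<^sup>+t\<in>{t. \<bar>t - \<theta>\<bar> \<le> 2 powi k}. f t \<partial>lborel)) + c" .
qed

lemma hl_max_const_le: "hl_max (\<lambda>t. c) \<theta> \<le> c"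
  using hl_max_add_const[of "\<lambda>_. 0" c \<theta>] by (simp add: hl_max_def)

text \<open>For y in the interval of radius R = \<open>2 powi k\<close>, the fivefold interval lies
  within distance 6R of y, hence inside the dyadic interval of radius 8R around y, so the integral
  of h over it is at most 16R times the maximal function of h at y. The mass of f on the small
  interval is at least 2Rl, and 16R / 2R is the factor 8. This is how the maximal operator moves to
  the weight.\<close>

lemma hl_max_ball_transfer:
  assumes [measurable]: "f \<in> borel_measurable borel" "h \<in> borel_measurable borel"
    and l: "0 < l" and big: "ennreal (2 * 2 powi k * l) \<le> (\<integral>\<^sup>+t\<in>{t. \<bar>t - \<theta>\<bar> \<le> 2 powi k}. f t \<partial>lborel)"
  shows "ennreal l * (\<integral>\<^sup>+t\<in>(ball \<theta> (5 * 2 powi k)). h t \<partial>lborel)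
    \<le> 8 * (\<integral>\<^sup>+t\<in>(cball \<theta> (2 powi k)). f t * hl_max h t \<partial>lborel)"
proof -
  let ?r = "2 powi k :: real"
  have r: "0 < ?r" by simp
  define H where "H = (\<integral>\<^sup>+t\<in>(ball \<theta> (5 * ?r)). h t \<partial>lborel)"
  have H: "ennreal (1 / (16 * ?r)) * H \<le> hl_max h y" if "\<bar>y - \<theta>\<bar> \<le> ?r" for y
  proof -
    have e: "(2::real) powi (k + 3) = 8 * ?r" by (simp add: power_int_add)
    have "H \<le> (\<integral>\<^sup>+t\<in>{t. \<bar>t - y\<bar> \<le> 2 powi (k + 3)}. h t \<partial>lborel)"
      unfolding H_def e using that r
      by (intro nn_integral_mono mult_left_mono) (auto simp: dist_real_def split: split_indicator)
    also have "\<dots> \<le> ennreal (16 * ?r) * hl_max h y"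
      using integral_dyadic_le_hl_max[of h y "k + 3"] by (simp add: e)
    finally have "ennreal (1 / (16 * ?r)) * H \<le> ennreal (1 / (16 * ?r)) * (ennreal (16 * ?r) * hl_max h y)"
      by (intro mult_left_mono) auto
    also have "\<dots> = hl_max h y" by (simp add: mult.assoc[symmetric] ennreal_mult[symmetric])
    finally show ?thesis .
  qed
  have "ennreal l * H = 8 * (ennreal (1 / (16 * ?r)) * H * ennreal (2 * ?r * l))"
  proof -
    have "8 * (ennreal (1 / (16 * ?r)) * H * ennreal (2 * ?r * l))
       = (ennreal 8 * ennreal (1 / (16 * ?r)) * ennreal (2 * ?r * l)) * H"
      by (simp add: mult_ac)
    also have "ennreal 8 * ennreal (1 / (16 * ?r)) * ennreal (2 * ?r * l) = ennreal l"
      using l by (simp add: ennreal_mult[symmetric] del: ennreal_numeral)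
    finally show ?thesis by simp
  qed
  also have "\<dots> \<le> 8 * (ennreal (1 / (16 * ?r)) * H * (\<integral>\<^sup>+t\<in>{t. \<bar>t - \<theta>\<bar> \<le> ?r}. f t \<partial>lborel))"
    by (intro mult_left_mono big) auto
  also have "ennreal (1 / (16 * ?r)) * H * (\<integral>\<^sup>+t\<in>{t. \<bar>t - \<theta>\<bar> \<le> ?r}. f t \<partial>lborel)
    = (\<integral>\<^sup>+t. (ennreal (1 / (16 * ?r)) * H) * (f t * indicator {t. \<bar>t - \<theta>\<bar> \<le> ?r} t) \<partial>lborel)"
    by (subst nn_integral_cmult) auto
  also have "\<dots> \<le> (\<integral>\<^sup>+t\<in>(cball \<theta> ?r). f t * hl_max h t \<partial>lborel)"
    using H by (intro nn_integral_mono) (auto simp: dist_real_def abs_minus_commute mult.commute mult_left_mono split: split_indicator)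
  finally show ?thesis unfolding H_def by (simp add: mult_left_mono)
qed

text \<open>Vitali's covering lemma, which needs the bound \<open>2 powi K\<close> on the radii,
  selects disjoint witnessing intervals whose fivefold enlargements cover S. By disjointness,
  summing \<open>hl_max_ball_transfer\<close> over them costs nothing on the right. Sums over the
  selected centres are \<open>count_space\<close> integrals, so that they commute with the Lebesgue
  integral.\<close>

lemma hl_max_weak_bounded:
  assumes [measurable]: "f \<in> borel_measurable borel" "h \<in> borel_measurable borel" and l: "0 < l"
    and S: "\<And>\<theta>. \<theta> \<in> S \<Longrightarrow> \<exists>k\<le>K. ennreal (2 * 2 powi k * l) \<le> (\<integral>\<^sup>+t\<in>{t. \<bar>t - \<theta>\<bar> \<le> 2 powi k}. f t \<partial>lborel)"
  shows "ennreal l * (\<integral>\<^sup>+t\<in>S. h t \<partial>lborel) \<le> 8 * (\<integral>\<^sup>+t. f t * hl_max h t \<partial>lborel)"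
proof -
  obtain k where k: "\<And>\<theta>. \<theta> \<in> S \<Longrightarrow> k \<theta> \<le> K"
     "\<And>\<theta>. \<theta> \<in> S \<Longrightarrow> ennreal (2 * 2 powi k \<theta> * l) \<le> (\<integral>\<^sup>+t\<in>{t. \<bar>t - \<theta>\<bar> \<le> 2 powi k \<theta>}. f t \<partial>lborel)"
    using bchoice[of S "\<lambda>\<theta> k. k \<le> K \<and> ennreal (2 * 2 powi k * l) \<le> (\<integral>\<^sup>+t\<in>{t. \<bar>t - \<theta>\<bar> \<le> 2 powi k}. f t \<partial>lborel)"] S
    by blast
  let ?r = "\<lambda>\<theta>. 2 powi k \<theta> :: real"
  have r: "0 < ?r i \<and> ?r i \<le> 2 powi K" if "i \<in> S" for i
    using k(1)[OF that] by (auto intro: power_int_increasing)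
  obtain C where C: "countable C" "C \<subseteq> S"
     "pairwise (\<lambda>i j. disjnt (cball i (?r i)) (cball j (?r j))) C"
     "\<And>i. i \<in> S \<Longrightarrow> \<exists>j. j \<in> C \<and> \<not> disjnt (cball i (?r i)) (cball j (?r j)) \<and>
                        cball i (?r i) \<subseteq> ball j (5 * ?r j)"
    using Vitali_covering_lemma_cballs_balls[of S ?r "2 powi K" "\<lambda>x. x"] r by blast
  have cover: "(indicator S t :: ennreal) \<le> (\<integral>\<^sup>+j. indicator (ball j (5 * ?r j)) t \<partial>count_space C)" for t
  proof (cases "t \<in> S")
    case True
    then obtain j where j: "j \<in> C" "t \<in> ball j (5 * ?r j)" using C(4)[OF True] r[OF True]
      by (metis centre_in_cball less_imp_le subsetD)
    have "1 = (\<integral>\<^sup>+i. indicator {j} i \<partial>count_space C)" using j(1) by simp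
    also have "\<dots> \<le> (\<integral>\<^sup>+j. indicator (ball j (5 * ?r j)) t \<partial>count_space C)"
      using j(2) by (intro nn_integral_mono) (auto split: split_indicator)
    finally show ?thesis using True by simp
  qed auto
  have packing: "(\<integral>\<^sup>+j. indicator (cball j (?r j)) t \<partial>count_space C) \<le> (1::ennreal)" for t
  proof (cases "\<exists>j\<in>C. t \<in> cball j (?r j)")
    case True
    then obtain j where j: "j \<in> C" "t \<in> cball j (?r j)" by auto
    have "i = j" if "i \<in> C" "t \<in> cball i (?r i)" for i
      using C(3) j that unfolding pairwise_def disjnt_def by blast
    then have "(\<integral>\<^sup>+j. indicator (cball j (?r j)) t \<partial>count_space C) \<le> (\<integral>\<^sup>+i. indicator {j} i \<partial>count_space C)"
      by (intro nn_integral_mono) (metis indicator_simps order_refl singletonI zero_le space_count_space)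
    then show ?thesis using j(1) by simp
  next
    case False
    then have "(\<integral>\<^sup>+j. indicator (cball j (?r j)) t \<partial>count_space C) = (\<integral>\<^sup>+j. 0 \<partial>count_space C)"
      by (intro nn_integral_cong) (auto split: split_indicator)
    then show ?thesis by simp
  qed
  have [measurable]: "ball x e \<in> sets borel" "cball x e \<in> sets borel" for x e :: real by simp_all
  have "(\<integral>\<^sup>+t\<in>S. h t \<partial>lborel) \<le>
     (\<integral>\<^sup>+t. (\<integral>\<^sup>+j. h t * indicator (ball j (5 * ?r j)) t \<partial>count_space C) \<partial>lborel)"
    using cover by (intro nn_integral_mono) (subst nn_integral_cmult, auto intro: mult_left_mono)
  also have "\<dots> = (\<integral>\<^sup>+j. (\<integral>\<^sup>+t\<in>(ball j (5 * ?r j)). h t \<partial>lborel) \<partial>count_space C)"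
    by (intro nn_integral_count_space_nn_integral C(1)) measurable
  finally have "ennreal l * (\<integral>\<^sup>+t\<in>S. h t \<partial>lborel) \<le>
     ennreal l * (\<integral>\<^sup>+j. (\<integral>\<^sup>+t\<in>(ball j (5 * ?r j)). h t \<partial>lborel) \<partial>count_space C)"
    by (intro mult_left_mono) auto
  also have "\<dots> = (\<integral>\<^sup>+j. ennreal l * (\<integral>\<^sup>+t\<in>(ball j (5 * ?r j)). h t \<partial>lborel) \<partial>count_space C)"
    by (subst nn_integral_cmult) auto
  also have "\<dots> \<le> (\<integral>\<^sup>+j. 8 * (\<integral>\<^sup>+t\<in>(cball j (?r j)). f t * hl_max h t \<partial>lborel) \<partial>count_space C)"
    using C(2) k(2) l by (intro nn_integral_mono hl_max_ball_transfer) auto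
  also have "\<dots> = 8 * (\<integral>\<^sup>+j. (\<integral>\<^sup>+t\<in>(cball j (?r j)). f t * hl_max h t \<partial>lborel) \<partial>count_space C)"
    by (subst nn_integral_cmult) auto
  also have "(\<integral>\<^sup>+j. (\<integral>\<^sup>+t\<in>(cball j (?r j)). f t * hl_max h t \<partial>lborel) \<partial>count_space C)
    = (\<integral>\<^sup>+t. (\<integral>\<^sup>+j. f t * hl_max h t * indicator (cball j (?r j)) t \<partial>count_space C) \<partial>lborel)"
    by (intro nn_integral_count_space_nn_integral[symmetric] C(1)) measurable
  also have "\<dots> \<le> (\<integral>\<^sup>+t. f t * hl_max h t \<partial>lborel)"
  proof (rule nn_integral_mono)
    fix t
    have "(\<integral>\<^sup>+j. f t * hl_max h t * indicator (cball j (?r j)) t \<partial>count_space C)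
      = f t * hl_max h t * (\<integral>\<^sup>+j. indicator (cball j (?r j)) t \<partial>count_space C)"
      by (subst nn_integral_cmult) auto
    also have "\<dots> \<le> f t * hl_max h t * 1" by (intro mult_left_mono packing) auto
    finally show "(\<integral>\<^sup>+j. f t * hl_max h t * indicator (cball j (?r j)) t \<partial>count_space C) \<le> f t * hl_max h t"
      by simp
  qed
  finally show ?thesis by (simp add: mult_left_mono)
qed

text \<open>The weighted weak type (1,1) inequality of Fefferman and Stein. Since the covering
  argument needs bounded radii, the superlevel set is exhausted by the sets \<open>S n\<close> of
  points with a witness of radius at most 2^n.\<close>

lemma hl_max_weak:
  assumes [measurable]: "f \<in> borel_measurable borel" "h \<in> borel_measurable borel" and l: "0 < l"
  shows "ennreal l * (\<integral>\<^sup>+t\<in>{\<theta>. ennreal l < hl_max f \<theta>}. h t \<partial>lborel)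
    \<le> 8 * (\<integral>\<^sup>+t. f t * hl_max h t \<partial>lborel)"
proof -
  define I where "I k \<theta> = (\<integral>\<^sup>+t\<in>{t. \<bar>t - \<theta>\<bar> \<le> 2 powi k}. f t \<partial>lborel)" for k :: int and \<theta>
  define S where "S n = {\<theta>. \<exists>k\<le>int n. ennreal l < ennreal (1 / (2 * 2 powi k)) * I k \<theta>}" for n
  have [measurable]: "I k \<in> borel_measurable borel" for k unfolding I_def by measurable
  have [measurable]: "S n \<in> sets borel" for n unfolding S_def by measurable
  have inc: "incseq S" unfolding incseq_def
  proof (intro allI impI subsetI)
    fix m n :: nat and x assume "m \<le> n" "x \<in> S m"
    then obtain k where "k \<le> int m" "ennreal l < ennreal (1 / (2 * 2 powi k)) * I k x" unfolding S_def by blast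
    moreover have "k \<le> int n" using \<open>k \<le> int m\<close> \<open>m \<le> n\<close> by simp
    ultimately show "x \<in> S n" unfolding S_def by blast
  qed
  have U: "{\<theta>. ennreal l < hl_max f \<theta>} = (\<Union>n. S n)"
  proof -
    have "(\<exists>k. P k) \<longleftrightarrow> (\<exists>n. \<exists>k\<le>int n. P k)" for P :: "int \<Rightarrow> bool" by (metis nat_0_le nle_le zle_int order_refl)
    from this[of "\<lambda>k. ennreal l < ennreal (1 / (2 * 2 powi k)) * I k \<theta>" for \<theta>]
    show ?thesis unfolding hl_max_def S_def I_def less_SUP_iff by blast
  qed
  have ind: "(indicator (\<Union>n. S n) t :: ennreal) = (SUP n. indicator (S n) t)" for t
  proof (rule antisym)
    show "(indicator (\<Union>n. S n) t :: ennreal) \<le> (SUP n. indicator (S n) t)"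
    proof (cases "t \<in> (\<Union>n. S n)")
      case True
      then obtain n where "t \<in> S n" by auto
      then show ?thesis by (intro SUP_upper2[of n]) (auto split: split_indicator)
    qed auto
    show "(SUP n. indicator (S n) t) \<le> (indicator (\<Union>n. S n) t :: ennreal)"
      by (intro SUP_least) (auto split: split_indicator)
  qed
  have bnd: "ennreal l * (\<integral>\<^sup>+t\<in>(S n). h t \<partial>lborel) \<le> 8 * (\<integral>\<^sup>+t. f t * hl_max h t \<partial>lborel)" for n
  proof (rule hl_max_weak_bounded[where K = "int n"])
    fix \<theta> assume "\<theta> \<in> S n"
    then obtain k where k: "k \<le> int n" "ennreal l < ennreal (1 / (2 * 2 powi k)) * I k \<theta>" unfolding S_def by auto
    have "ennreal (2 * 2 powi k * l) = ennreal (2 * 2 powi k) * ennreal l"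
      using l by (simp add: ennreal_mult)
    also have "\<dots> \<le> ennreal (2 * 2 powi k) * (ennreal (1 / (2 * 2 powi k)) * I k \<theta>)"
      using k(2) by (intro mult_left_mono) auto
    also have "\<dots> = I k \<theta>" by (simp add: mult.assoc[symmetric] ennreal_mult[symmetric])
    finally show "\<exists>k\<le>int n. ennreal (2 * 2 powi k * l) \<le> (\<integral>\<^sup>+t\<in>{t. \<bar>t - \<theta>\<bar> \<le> 2 powi k}. f t \<partial>lborel)"
      using k(1) unfolding I_def by blast
  qed (use l in auto)
  have "(\<integral>\<^sup>+t\<in>{\<theta>. ennreal l < hl_max f \<theta>}. h t \<partial>lborel) = (\<integral>\<^sup>+t. (SUP n. h t * indicator (S n) t) \<partial>lborel)"
    unfolding U ind by (simp add: SUP_mult_left_ennreal)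
  also have "\<dots> = (SUP n. (\<integral>\<^sup>+t\<in>(S n). h t \<partial>lborel))"
    using inc by (intro nn_integral_monotone_convergence_SUP)
      (auto simp: incseq_def le_fun_def intro!: mult_left_mono split: split_indicator)
  finally show ?thesis using bnd by (simp add: SUP_mult_left_ennreal SUP_least)
qed

text \<open>The layer cake formula x^P = integral of P l^(P-1) over 0 < l < x, with the level
  written as l = exp(-\<tau>). Every level is then positive, as the weak type inequality requires,
  and \<tau> runs over the whole line, which suits Fubini's theorem.\<close>

lemma powr_layer_cake:
  assumes P: "0 < P"
  shows "ennreal_powr x P = (\<integral>\<^sup>+\<tau>\<in>{\<tau>. ennreal (exp (- \<tau>)) < x}. ennreal (P * exp (- P * \<tau>)) \<partial>lborel)"
proof -
  have FTC: "(\<integral>\<^sup>+\<tau>\<in>{b..}. ennreal (P * exp (- P * \<tau>)) \<partial>lborel) = ennreal (exp (- P * b))" for b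
  proof -
    have "((\<lambda>\<tau>. - exp (- P * \<tau>)) \<longlongrightarrow> 0) at_top"
      using P by real_asymp
    then have "(\<integral>\<^sup>+\<tau>\<in>{b..}. ennreal (P * exp (- P * \<tau>)) \<partial>lborel) = ennreal (0 - (- exp (- P * b)))"
      using P by (intro nn_integral_FTC_atLeast) (auto intro!: derivative_eq_intros)
    then show ?thesis by simp
  qed
  show ?thesis
  proof (cases x)
    case (real u)
    show ?thesis
    proof (cases "u = 0")
      case True then show ?thesis using real by simp
    next
      case False
      then have u: "u > 0" using real by simp
      have "{\<tau>. ennreal (exp (- \<tau>)) < x} = {- ln u <..}"
      proof -
        have "exp (- \<tau>) < u \<longleftrightarrow> - ln u < \<tau>" for \<tau>
        proof -
          have "exp (- \<tau>) < exp (ln u) \<longleftrightarrow> - \<tau> < ln u" by (rule exp_less_cancel_iff)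
          then show ?thesis using u by auto
        qed
        then show ?thesis using real by (auto simp: ennreal_less_iff)
      qed
      then have "(\<integral>\<^sup>+\<tau>\<in>{\<tau>. ennreal (exp (- \<tau>)) < x}. ennreal (P * exp (- P * \<tau>)) \<partial>lborel)
        = (\<integral>\<^sup>+\<tau>\<in>{- ln u..}. ennreal (P * exp (- P * \<tau>)) \<partial>lborel)"
        using AE_lborel_singleton[of "- ln u"]
        by (intro nn_integral_cong_AE) (auto elim!: eventually_mono split: split_indicator)
      also have "\<dots> = ennreal (u powr P)" using u by (subst FTC) (simp add: powr_def)
      finally show ?thesis using real by (simp add: ennreal_powr_ennreal)
    qed
  next
    case top
    \<comment> \<open>For x = \<open>top\<close> all \<tau> count, and the tail from b = -n/P
      already has mass exp(n) >= n.\<close>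
    have "ennreal (real n) \<le> (\<integral>\<^sup>+\<tau>\<in>{\<tau>. ennreal (exp (- \<tau>)) < x}. ennreal (P * exp (- P * \<tau>)) \<partial>lborel)" for n
    proof -
      have "real n \<le> exp (real n)" using exp_ge_add_one_self[of "real n"] by linarith
      then have "ennreal (real n) \<le> ennreal (exp (- P * (- real n / P)))" using P by (intro ennreal_leI) simp
      also have "\<dots> = (\<integral>\<^sup>+\<tau>\<in>{- real n / P..}. ennreal (P * exp (- P * \<tau>)) \<partial>lborel)"
        by (rule FTC[symmetric])
      also have "\<dots> \<le> (\<integral>\<^sup>+\<tau>\<in>{\<tau>. ennreal (exp (- \<tau>)) < x}. ennreal (P * exp (- P * \<tau>)) \<partial>lborel)"
        using top by (intro nn_integral_mono) (auto split: split_indicator)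
      finally show ?thesis .
    qed
    then have "(\<integral>\<^sup>+\<tau>\<in>{\<tau>. ennreal (exp (- \<tau>)) < x}. ennreal (P * exp (- P * \<tau>)) \<partial>lborel) = top"
      by (metis ennreal_of_nat_eq_real_of_nat ennreal_Ex_less_of_nat not_le top.not_eq_extremum)
    then show ?thesis using top by simp
  qed
qed

text \<open>Marcinkiewicz interpolation between the weak inequality and the trivial bound in
  L^infinity. At level l only the part of f where 2f > l matters, since the rest has maximal
  function at most l/2. The weak inequality at level l/2 gives the factor 16/l, and integrating it
  against the layer cake density gives (2f)^(P-1)/(P-1), whence the constant.\<close>

theorem hl_max_strong:
  assumes [measurable]: "f \<in> borel_measurable borel" "h \<in> borel_measurable borel" and P: "1 < P"
  shows "(\<integral>\<^sup>+t. ennreal_powr (hl_max f t) P * h t \<partial>lborel)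
    \<le> ennreal (16 * P * 2 powr (P - 1) / (P - 1)) * (\<integral>\<^sup>+t. ennreal_powr (f t) P * hl_max h t \<partial>lborel)"
proof -
  have lev: "(\<integral>\<^sup>+t\<in>{t. ennreal (exp (- \<tau>)) < hl_max f t}. h t \<partial>lborel)
    \<le> ennreal (16 * exp \<tau>) * (\<integral>\<^sup>+t. f t * indicator {t. ennreal (exp (- \<tau>)) < 2 * f t} t * hl_max h t \<partial>lborel)"
    (is "?L \<le> _ * ?R") for \<tau>
  proof -
    define l where "l = exp (- \<tau>)"
    have l: "0 < l" by (simp add: l_def)
    define g where "g t = f t * indicator {t. ennreal l < 2 * f t} t" for t
    have [measurable]: "g \<in> borel_measurable borel" unfolding g_def by measurable
    have "hl_max f t \<le> hl_max g t + ennreal (l / 2)" for t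
    proof -
      have "f s \<le> g s + ennreal (l / 2)" for s
      proof (cases "ennreal l < 2 * f s")
        case False
        then have "2 * f s \<le> 2 * ennreal (l / 2)"
          using l by (simp add: ennreal_mult[symmetric] flip: ennreal_numeral)
        then have "f s \<le> ennreal (l / 2)"
          by (subst (asm) ennreal_mult_le_mult_iff) auto
        then show ?thesis by (simp add: add_increasing)
      qed (simp add: g_def)
      then have "hl_max f t \<le> hl_max (\<lambda>t. g t + ennreal (l / 2)) t" by (intro hl_max_mono)
      also have "\<dots> \<le> hl_max g t + ennreal (l / 2)" by (intro hl_max_add_const) measurable
      finally show ?thesis .
    qed
    note gb = this
    have sub: "ennreal (l / 2) < hl_max g t" if "ennreal l < hl_max f t" for t
    proof (rule ccontr)
      assume "\<not> ?thesis"
      then have "hl_max g t + ennreal (l / 2) \<le> ennreal (l / 2) + ennreal (l / 2)" by (intro add_mono) auto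
      also have "\<dots> = ennreal l" using l by (simp flip: ennreal_plus)
      finally show False using that gb[of t] by auto
    qed
    have "ennreal (l / 2) * ?L \<le> ennreal (l / 2) * (\<integral>\<^sup>+t\<in>{t. ennreal (l / 2) < hl_max g t}. h t \<partial>lborel)"
      using sub unfolding l_def[symmetric]
      by (intro mult_left_mono nn_integral_mono) (auto split: split_indicator)
    also have "\<dots> \<le> 8 * (\<integral>\<^sup>+t. g t * hl_max h t \<partial>lborel)"
      using l by (intro hl_max_weak) auto
    finally have "ennreal (2 / l) * (ennreal (l / 2) * ?L) \<le> ennreal (2 / l) * (8 * ?R)"
      unfolding g_def l_def by (intro mult_left_mono) auto
    moreover have "ennreal (2 / l) * (ennreal (l / 2) * ?L) = ?L"
      using l by (simp add: mult.assoc[symmetric] ennreal_mult[symmetric])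
    moreover have "ennreal (2 / l) * (8 * ?R) = ennreal (16 * exp \<tau>) * ?R"
    proof -
      have "ennreal (2 / l) * (8 * ?R) = (ennreal (2 / l) * ennreal 8) * ?R" by (simp add: mult_ac)
      also have "ennreal (2 / l) * ennreal 8 = ennreal (16 * exp \<tau>)"
        by (subst ennreal_mult[symmetric]) (auto simp: l_def exp_minus field_simps)
      finally show ?thesis .
    qed
    ultimately show ?thesis by simp
  qed
  have "(\<integral>\<^sup>+t. ennreal_powr (hl_max f t) P * h t \<partial>lborel) =
    (\<integral>\<^sup>+t. (\<integral>\<^sup>+\<tau>. ennreal (P * exp (- P * \<tau>)) * indicator {\<tau>. ennreal (exp (- \<tau>)) < hl_max f t} \<tau> * h t \<partial>lborel) \<partial>lborel)"
    using P by (subst powr_layer_cake) (auto simp: nn_integral_multc)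
  also have "\<dots> = (\<integral>\<^sup>+\<tau>. (\<integral>\<^sup>+t. ennreal (P * exp (- P * \<tau>)) * indicator {\<tau>. ennreal (exp (- \<tau>)) < hl_max f t} \<tau> * h t \<partial>lborel) \<partial>lborel)"
    by (intro lborel_pair.Fubini') measurable
  also have "\<dots> = (\<integral>\<^sup>+\<tau>. ennreal (P * exp (- P * \<tau>)) * (\<integral>\<^sup>+t\<in>{t. ennreal (exp (- \<tau>)) < hl_max f t}. h t \<partial>lborel) \<partial>lborel)"
    by (subst nn_integral_cmult[symmetric]) (auto intro!: nn_integral_cong simp: mult_ac split: split_indicator)
  also have "\<dots> \<le> (\<integral>\<^sup>+\<tau>. ennreal (P * exp (- P * \<tau>)) * (ennreal (16 * exp \<tau>) * (\<integral>\<^sup>+t. f t * indicator {t. ennreal (exp (- \<tau>)) < 2 * f t} t * hl_max h t \<partial>lborel)) \<partial>lborel)"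
    by (intro nn_integral_mono mult_left_mono lev) auto
  \<comment> \<open>The factor 16 exp(\<tau>) lowers the exponent of the density from P to P - 1; it
    is normalised as the layer cake density of P - 1, so that after Fubini the integral in \<tau> is
    the power P - 1 of 2f.\<close>
  also have "\<dots> = (\<integral>\<^sup>+\<tau>. (\<integral>\<^sup>+t. ennreal (16 * P / (P - 1)) * f t * hl_max h t * (ennreal ((P - 1) * exp (- (P - 1) * \<tau>)) * indicator {\<tau>. ennreal (exp (- \<tau>)) < 2 * f t} \<tau>) \<partial>lborel) \<partial>lborel)"
  proof (rule nn_integral_cong)
    fix \<tau> :: real
    have "P * exp (- P * \<tau>) * (16 * exp \<tau>) = 16 * P / (P - 1) * ((P - 1) * exp (- (P - 1) * \<tau>))"
      using P by (simp add: field_simps exp_add[symmetric] exp_minus exp_diff)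
    then have eq: "ennreal (P * exp (- P * \<tau>)) * ennreal (16 * exp \<tau>) = ennreal (16 * P / (P - 1)) * ennreal ((P - 1) * exp (- (P - 1) * \<tau>))"
      using P by (subst (1 2) ennreal_mult[symmetric]) auto
    show "ennreal (P * exp (- P * \<tau>)) * (ennreal (16 * exp \<tau>) * (\<integral>\<^sup>+t. f t * indicator {t. ennreal (exp (- \<tau>)) < 2 * f t} t * hl_max h t \<partial>lborel))
      = (\<integral>\<^sup>+t. ennreal (16 * P / (P - 1)) * f t * hl_max h t * (ennreal ((P - 1) * exp (- (P - 1) * \<tau>)) * indicator {\<tau>. ennreal (exp (- \<tau>)) < 2 * f t} \<tau>) \<partial>lborel)"
      unfolding mult.assoc[symmetric] eq
      by (subst nn_integral_cmult[symmetric]) (auto intro!: nn_integral_cong simp: mult_ac split: split_indicator)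
  qed
  also have "\<dots> = (\<integral>\<^sup>+t. (\<integral>\<^sup>+\<tau>. ennreal (16 * P / (P - 1)) * f t * hl_max h t * (ennreal ((P - 1) * exp (- (P - 1) * \<tau>)) * indicator {\<tau>. ennreal (exp (- \<tau>)) < 2 * f t} \<tau>) \<partial>lborel) \<partial>lborel)"
    by (intro lborel_pair.Fubini') measurable
  also have "\<dots> = (\<integral>\<^sup>+t. ennreal (16 * P / (P - 1)) * f t * hl_max h t * ennreal_powr (2 * f t) (P - 1) \<partial>lborel)"
    using P by (subst nn_integral_cmult) (auto simp: powr_layer_cake)
  also have "\<dots> = (\<integral>\<^sup>+t. ennreal (16 * P * 2 powr (P - 1) / (P - 1)) * (ennreal_powr (f t) P * hl_max h t) \<partial>lborel)"
  proof (rule nn_integral_cong)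
    fix t
    have "ennreal_powr (2 * f t) (P - 1) = ennreal (2 powr (P - 1)) * ennreal_powr (f t) (P - 1)"
      using P ennreal_powr_cmult[of "P - 1" 2 "f t"] by simp
    moreover have "ennreal_powr (f t) P = f t * ennreal_powr (f t) (P - 1)"
      using P ennreal_powr_add[of 1 "P - 1" "f t"] by simp
    moreover have "ennreal (16 * P * 2 powr (P - 1) / (P - 1)) = ennreal (16 * P / (P - 1)) * ennreal (2 powr (P - 1))"
      using P by (subst ennreal_mult[symmetric]) auto
    ultimately show "ennreal (16 * P / (P - 1)) * f t * hl_max h t * ennreal_powr (2 * f t) (P - 1)
      = ennreal (16 * P * 2 powr (P - 1) / (P - 1)) * (ennreal_powr (f t) P * hl_max h t)"
      by (simp add: mult_ac)
  qed
  also have "\<dots> = ennreal (16 * P * 2 powr (P - 1) / (P - 1)) * (\<integral>\<^sup>+t. ennreal_powr (f t) P * hl_max h t \<partial>lborel)"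
    by (intro nn_integral_cmult) measurable
  finally show ?thesis .
qed

subsection \<open>A vector-valued maximal inequality\<close>

text \<open>Cauchy-Schwarz on each dyadic interval, after which each of the two averages is bounded
  by its own supremum. The pointwise bound is asked for only almost everywhere, because the
  factorisation it serves breaks down where the weight is infinite.\<close>

lemma hl_max_Cauchy_Schwarz:
  assumes [measurable]: "f \<in> borel_measurable borel" "g \<in> borel_measurable borel"
    and "AE t in lborel. F t \<le> f t * g t"
  shows "(hl_max F \<theta>)\<^sup>2 \<le> hl_max (\<lambda>t. (f t)\<^sup>2) \<theta> * hl_max (\<lambda>t. (g t)\<^sup>2) \<theta>"
proof -
  define I where "I f k = ennreal (1 / (2 * 2 powi k)) * (\<integral>\<^sup>+t\<in>{t. \<bar>t - \<theta>\<bar> \<le> 2 powi k}. f t \<partial>lborel)"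
    for f k
  have le: "(I F k)\<^sup>2 \<le> hl_max (\<lambda>t. (f t)\<^sup>2) \<theta> * hl_max (\<lambda>t. (g t)\<^sup>2) \<theta>" for k
  proof -
    let ?i = "indicator {t. \<bar>t - \<theta>\<bar> \<le> 2 powi k} :: real \<Rightarrow> ennreal"
    let ?c = "ennreal (1 / (2 * 2 powi k))"
    have "(\<integral>\<^sup>+t. F t * ?i t \<partial>lborel) \<le> (\<integral>\<^sup>+t. (f t * ?i t) * (g t * ?i t) \<partial>lborel)"
      using assms(3) by (intro nn_integral_mono_AE) (auto split: split_indicator elim!: eventually_mono)
    then have "(I F k)\<^sup>2 \<le> (?c * (\<integral>\<^sup>+t. (f t * ?i t) * (g t * ?i t) \<partial>lborel))\<^sup>2"
      unfolding I_def by (intro power_mono mult_left_mono) auto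
    also have "\<dots> = ?c\<^sup>2 * (\<integral>\<^sup>+t. (f t * ?i t) * (g t * ?i t) \<partial>lborel)\<^sup>2"
      by (simp add: power_mult_distrib)
    also have "\<dots> \<le> ?c\<^sup>2 * ((\<integral>\<^sup>+t. (f t * ?i t)\<^sup>2 \<partial>lborel) * (\<integral>\<^sup>+t. (g t * ?i t)\<^sup>2 \<partial>lborel))"
      by (intro mult_left_mono Cauchy_Schwarz_nn_integral) auto
    also have "\<dots> = I (\<lambda>t. (f t)\<^sup>2) k * I (\<lambda>t. (g t)\<^sup>2) k"
    proof -
      have "(\<integral>\<^sup>+t. (f t * ?i t)\<^sup>2 \<partial>lborel) = (\<integral>\<^sup>+t. (f t)\<^sup>2 * ?i t \<partial>lborel)" for f :: "real \<Rightarrow> ennreal"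
        by (intro nn_integral_cong) (auto split: split_indicator)
      then show ?thesis unfolding I_def by (simp add: power2_eq_square mult_ac)
    qed
    also have "\<dots> \<le> hl_max (\<lambda>t. (f t)\<^sup>2) \<theta> * hl_max (\<lambda>t. (g t)\<^sup>2) \<theta>"
      unfolding I_def hl_max_def by (intro mult_mono SUP_upper) auto
    finally show ?thesis .
  qed
  \<comment> \<open>Rewriting the square as a square root on the other side leaves
    \<open>hl_max F\<close> bare, so its supremum can be bounded term by term.\<close>
  have rt: "x \<le> ennreal_powr y (1/2) \<longleftrightarrow> x\<^sup>2 \<le> y" for x y
  proof -
    have "x\<^sup>2 = ennreal_powr x 2"
      using ennreal_powr_add[of 1 1 x] by (simp add: power2_eq_square)
    then show ?thesis using ennreal_powr_mono[of x "ennreal_powr y (1/2)" 2] ennreal_powr_mono[of "x\<^sup>2" y "1/2"]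
      by (auto simp: ennreal_powr_powr)
  qed
  have "hl_max F \<theta> \<le> ennreal_powr (hl_max (\<lambda>t. (f t)\<^sup>2) \<theta> * hl_max (\<lambda>t. (g t)\<^sup>2) \<theta>) (1/2)"
    unfolding hl_max_def[of F] I_def[symmetric]
  proof (rule SUP_least)
    fix k show "I F k \<le> ennreal_powr (hl_max (\<lambda>t. (f t)\<^sup>2) \<theta> * hl_max (\<lambda>t. (g t)\<^sup>2) \<theta>) (1/2)"
      unfolding rt by (rule le)
  qed
  then show ?thesis by (simp add: rt)
qed

section \<open>Families indexed by a sigma-finite measure space, and removal of truncations\<close>

lemma measurable_nn_integral_swapped [measurable (raw)]:
  assumes "sigma_finite_measure N" and "(\<lambda>(r, t). u r t) \<in> borel_measurable (N \<Otimes>\<^sub>M borel)"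
  shows "(\<lambda>t. \<integral>\<^sup>+r. u r t \<partial>N) \<in> borel_measurable borel"
proof -
  interpret sigma_finite_measure N by fact
  have [measurable]: "(\<lambda>(r, t). u r t) \<in> borel_measurable (N \<Otimes>\<^sub>M borel)" by fact
  have "(\<lambda>(t, r). u r t) \<in> borel_measurable (borel \<Otimes>\<^sub>M N)" by measurable
  then show ?thesis by (intro borel_measurable_nn_integral)
qed

lemma nn_integral_swap_lborel:
  assumes "sigma_finite_measure N" and "(\<lambda>(r, t). u r t) \<in> borel_measurable (N \<Otimes>\<^sub>M borel)"
  shows "(\<integral>\<^sup>+t. (\<integral>\<^sup>+r. u r t \<partial>N) \<partial>lborel) = (\<integral>\<^sup>+r. (\<integral>\<^sup>+t. u r t \<partial>lborel) \<partial>N)"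
proof -
  interpret N: sigma_finite_measure N by fact
  interpret pair_sigma_finite N lborel by unfold_locales
  have "(\<lambda>(r, t). u r t) \<in> borel_measurable (N \<Otimes>\<^sub>M lborel)"
    using assms(2) by (simp cong: measurable_cong_sets sets_pair_measure_cong)
  then show ?thesis by (rule Fubini')
qed

lemma SUP_ennreal_powr_min:
  assumes "0 < a"
  shows "(SUP n. ennreal_powr (min x (of_nat n)) a) = ennreal_powr x a"
proof (cases x)
  case (real v)
  obtain n :: nat where n: "v \<le> real n" using real_arch_simple by blast
  show ?thesis
  proof (rule antisym)
    show "(SUP n. ennreal_powr (min x (of_nat n)) a) \<le> ennreal_powr x a"
      using assms by (intro SUP_least ennreal_powr_mono) auto
    have "x \<le> of_nat n" using real n by (simp add: ennreal_of_nat_eq_real_of_nat ennreal_leI)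
    then show "ennreal_powr x a \<le> (SUP n. ennreal_powr (min x (of_nat n)) a)"
      by (intro SUP_upper2[of n]) auto
  qed
next
  case top
  have "x < (SUP n. ennreal_powr (min top (of_nat n)) a)" if fin: "x < top" for x
  proof -
    have "ennreal_powr x (1 / a) < top" using fin ennreal_powr_less_top_iff[of x "1/a"] by simp
    then obtain n :: nat where "ennreal_powr x (1 / a) < of_nat n"
      using ennreal_Ex_less_of_nat by (metis infinity_ennreal_def)
    then have "\<not> ennreal_powr (of_nat n) a \<le> x"
      using ennreal_powr_mono[of "ennreal_powr (of_nat n) a" x "1 / a"] assms
      by (auto simp: ennreal_powr_inverse)
    then show ?thesis by (auto simp: less_SUP_iff not_le intro!: exI[of _ n])
  qed
  then show ?thesis using top by (metis ennreal_powr_top(2) less_irrefl top.not_eq_extremum)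
qed

lemma hl_max_strong_unweighted:
  assumes [measurable]: "f \<in> borel_measurable borel" and P: "1 < P"
  shows "(\<integral>\<^sup>+t. ennreal_powr (hl_max f t) P \<partial>lborel)
    \<le> ennreal (16 * P * 2 powr (P - 1) / (P - 1)) * (\<integral>\<^sup>+t. ennreal_powr (f t) P \<partial>lborel)"
proof -
  have "(\<integral>\<^sup>+t. ennreal_powr (hl_max f t) P * 1 \<partial>lborel)
    \<le> ennreal (16 * P * 2 powr (P - 1) / (P - 1)) * (\<integral>\<^sup>+t. ennreal_powr (f t) P * hl_max (\<lambda>_. 1) t \<partial>lborel)"
    using P by (intro hl_max_strong) auto
  also have "\<dots> \<le> ennreal (16 * P * 2 powr (P - 1) / (P - 1)) * (\<integral>\<^sup>+t. ennreal_powr (f t) P * 1 \<partial>lborel)"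
    by (intro mult_left_mono nn_integral_mono hl_max_const_le) auto
  finally show ?thesis by simp
qed

abbreviation mixed_integral :: "real \<Rightarrow> 'r measure \<Rightarrow> ('r \<Rightarrow> real \<Rightarrow> ennreal) \<Rightarrow> real set \<Rightarrow> ennreal" where
  "mixed_integral a N u I \<equiv> (\<integral>\<^sup>+\<theta>\<in>I. ennreal_powr (\<integral>\<^sup>+r. u r \<theta> \<partial>N) a \<partial>lborel)"

text \<open>
  Tested against \<open>h = X\<^sub>n powr (a - 1)\<close>, with \<open>X\<^sub>n\<close> a truncation of the left-hand side: by the weighted
  maximal inequality \<open>h\<close> is replaced by its maximal function, and Young's inequality absorbs
  \<open>\<integral> X\<^sub>n powr a\<close>, which is finite because of the truncation. \<open>C1\<close> and \<open>C2\<close> are the constants of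
  \<open>hl_max_strong\<close> for the exponents \<open>1/s\<close> and \<open>a/(a-1)\<close>.
\<close>
lemma vector_hl_max_ge1:
  fixes u :: "'r \<Rightarrow> real \<Rightarrow> ennreal"
  assumes N: "sigma_finite_measure N"
    and u[measurable]: "(\<lambda>(r, t). u r t) \<in> borel_measurable (N \<Otimes>\<^sub>M borel)"
    and J[measurable]: "J \<in> sets borel" and I[measurable]: "I \<in> sets borel" and fin: "emeasure lborel I < \<infinity>"
    and a: "1 \<le> a" and s: "0 < s" "s < 1"
    and C1: "C1 = 16 * (1/s) * 2 powr (1/s - 1) / (1/s - 1)"
    and C2: "1 < a \<Longrightarrow> C2 = 16 * (a/(a-1)) * 2 powr (a/(a-1) - 1) / (a/(a-1) - 1)"
  shows "(\<integral>\<^sup>+\<theta>\<in>I. ennreal_powr (\<integral>\<^sup>+r. ennreal_powr (hl_max (\<lambda>t. ennreal_powr (u r t) s * indicator J t) \<theta>) (1/s) \<partial>N) a \<partial>lborel)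
    \<le> ennreal (2 * C1 * (1 + (2 * C1 * C2) powr (a - 1))) * (mixed_integral a N u J)"
proof -
  interpret N: sigma_finite_measure N by fact
  define U where "U t = (\<integral>\<^sup>+r. u r t \<partial>N)" for t
  have U[measurable]: "U \<in> borel_measurable borel" unfolding U_def by (intro measurable_nn_integral_swapped N u)
  define F where "F r t = ennreal_powr (u r t) s * indicator J t" for r t
  have F[measurable]: "(\<lambda>(r, t). F r t) \<in> borel_measurable (N \<Otimes>\<^sub>M borel)" unfolding F_def by measurable
  define X where "X \<theta> = (\<integral>\<^sup>+r. ennreal_powr (hl_max (F r) \<theta>) (1/s) \<partial>N)" for \<theta>
  have MF[measurable]: "(\<lambda>(r, \<theta>). ennreal_powr (hl_max (F r) \<theta>) (1/s)) \<in> borel_measurable (N \<Otimes>\<^sub>M borel)"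
    by measurable
  have X[measurable]: "X \<in> borel_measurable borel" unfolding X_def by (intro measurable_nn_integral_swapped N MF)
  have C1pos: "0 < C1" using s unfolding C1 by (intro divide_pos_pos mult_pos_pos) (auto simp: field_simps)
  \<comment> \<open>For fixed r this is the scalar weighted inequality with exponent 1/s, because
    \<open>F r t\<close> to the power 1/s is \<open>u r t\<close> on J; Fubini then sums it over
    \<open>N\<close>.\<close>
  have test: "(\<integral>\<^sup>+\<theta>. X \<theta> * h \<theta> \<partial>lborel) \<le> ennreal C1 * (\<integral>\<^sup>+t. U t * indicator J t * hl_max h t \<partial>lborel)"
    if [measurable]: "h \<in> borel_measurable borel" for h
  proof -
    have "(\<integral>\<^sup>+\<theta>. X \<theta> * h \<theta> \<partial>lborel) = (\<integral>\<^sup>+\<theta>. (\<integral>\<^sup>+r. ennreal_powr (hl_max (F r) \<theta>) (1/s) * h \<theta> \<partial>N) \<partial>lborel)"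
      unfolding X_def by (intro nn_integral_cong nn_integral_multc[symmetric]) measurable
    also have "\<dots> = (\<integral>\<^sup>+r. (\<integral>\<^sup>+\<theta>. ennreal_powr (hl_max (F r) \<theta>) (1/s) * h \<theta> \<partial>lborel) \<partial>N)"
      by (intro nn_integral_swap_lborel N) measurable
    also have "\<dots> \<le> (\<integral>\<^sup>+r. ennreal C1 * (\<integral>\<^sup>+t. ennreal_powr (F r t) (1/s) * hl_max h t \<partial>lborel) \<partial>N)"
      unfolding C1 using s by (intro nn_integral_mono hl_max_strong) (auto simp: field_simps)
    also have "\<dots> = (\<integral>\<^sup>+r. ennreal C1 * (\<integral>\<^sup>+t. u r t * indicator J t * hl_max h t \<partial>lborel) \<partial>N)"
      unfolding F_def using s
      by (intro nn_integral_cong arg_cong2[where f="(*)"] refl) (auto simp: ennreal_powr_inverse split: split_indicator)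
    also have "\<dots> = ennreal C1 * (\<integral>\<^sup>+r. (\<integral>\<^sup>+t. u r t * indicator J t * hl_max h t \<partial>lborel) \<partial>N)"
    proof (intro nn_integral_cmult)
      have "(\<lambda>(r, t). u r t * indicator J t * hl_max h t) \<in> borel_measurable (N \<Otimes>\<^sub>M lborel)"
        by (simp cong: measurable_cong_sets sets_pair_measure_cong)
      then show "(\<lambda>r. \<integral>\<^sup>+t. u r t * indicator J t * hl_max h t \<partial>lborel) \<in> borel_measurable N"
        by (rule lborel.borel_measurable_nn_integral)
    qed
    also have "(\<integral>\<^sup>+r. (\<integral>\<^sup>+t. u r t * indicator J t * hl_max h t \<partial>lborel) \<partial>N)
      = (\<integral>\<^sup>+t. (\<integral>\<^sup>+r. u r t * indicator J t * hl_max h t \<partial>N) \<partial>lborel)"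
      by (intro nn_integral_swap_lborel[symmetric] N) measurable
    also have "\<dots> = (\<integral>\<^sup>+t. U t * indicator J t * hl_max h t \<partial>lborel)"
      unfolding U_def by (intro nn_integral_cong) (simp add: nn_integral_multc mult.assoc)
    finally show ?thesis .
  qed
  let ?D = "ennreal (2 * C1 * (1 + (2 * C1 * C2) powr (a - 1)))"
  let ?R = "\<integral>\<^sup>+t\<in>J. ennreal_powr (U t) a \<partial>lborel"
  have trunc: "(\<integral>\<^sup>+\<theta>\<in>I. ennreal_powr (min (X \<theta>) (of_nat n)) a \<partial>lborel) \<le> ?D * ?R" for n :: nat
  proof -
    define Xn where "Xn \<theta> = min (X \<theta>) (of_nat n) * indicator I \<theta>" for \<theta>
    define T where "T = (\<integral>\<^sup>+\<theta>. ennreal_powr (Xn \<theta>) a \<partial>lborel)"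
    define h where "h \<theta> = ennreal_powr (Xn \<theta>) (a - 1)" for \<theta>
    have [measurable]: "Xn \<in> borel_measurable borel" unfolding Xn_def by measurable
    have [measurable]: "h \<in> borel_measurable borel" unfolding h_def by measurable
    have T_eq: "(\<integral>\<^sup>+\<theta>\<in>I. ennreal_powr (min (X \<theta>) (of_nat n)) a \<partial>lborel) = T"
      unfolding T_def Xn_def by (intro nn_integral_cong) (auto split: split_indicator)
    have "T \<le> (\<integral>\<^sup>+\<theta>\<in>I. ennreal_powr (of_nat n) a \<partial>lborel)"
      unfolding T_eq[symmetric] using a by (intro nn_integral_mono mult_right_mono ennreal_powr_mono) auto
    also have "\<dots> = ennreal_powr (of_nat n) a * emeasure lborel I" by (simp add: nn_integral_cmult)
    also have "\<dots> < \<infinity>" using fin ennreal_powr_less_top_iff[of "of_nat n" a]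
      by (simp add: ennreal_mult_less_top of_nat_less_top)
    finally have T_fin: "T < \<infinity>" .
    have "T \<le> (\<integral>\<^sup>+\<theta>. X \<theta> * h \<theta> \<partial>lborel)"
      unfolding T_def
    proof (rule nn_integral_mono)
      fix \<theta>
      have "ennreal_powr (Xn \<theta>) a = Xn \<theta> * h \<theta>"
        using a ennreal_powr_add[of 1 "a - 1" "Xn \<theta>"] by (simp add: h_def)
      also have "\<dots> \<le> X \<theta> * h \<theta>" unfolding Xn_def by (intro mult_right_mono) (auto split: split_indicator)
      finally show "ennreal_powr (Xn \<theta>) a \<le> X \<theta> * h \<theta>" .
    qed
    also have "\<dots> \<le> ennreal C1 * (\<integral>\<^sup>+t. U t * indicator J t * hl_max h t \<partial>lborel)"
      by (intro test) measurable
    finally have T_le: "T \<le> ennreal C1 * (\<integral>\<^sup>+t. U t * indicator J t * hl_max h t \<partial>lborel)" .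
    show ?thesis
    proof (cases "a = 1")
      case True
      \<comment> \<open>The truncation matters here too: for a = 1 the exponent of h is 0, and
        \<open>ennreal_powr top 0\<close> is \<open>top\<close>, whereas finite values give 0 or
        1.\<close>
      have "h \<theta> \<le> 1" for \<theta>
      proof -
        have "Xn \<theta> \<le> of_nat n" by (simp add: Xn_def split: split_indicator)
        then have "Xn \<theta> \<noteq> top" by (metis ennreal_of_nat_neq_top top_unique)
        then show ?thesis unfolding h_def True by (cases "Xn \<theta>") (auto simp: ennreal_powr_ennreal)
      qed
      then have "hl_max h t \<le> 1" for t using hl_max_mono[of h "\<lambda>_. 1" t] hl_max_const_le[of 1 t] by (meson order_trans)
      then have "(\<integral>\<^sup>+t. U t * indicator J t * hl_max h t \<partial>lborel) \<le> (\<integral>\<^sup>+t. U t * indicator J t * 1 \<partial>lborel)"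
        by (intro nn_integral_mono mult_left_mono) auto
      then have "T \<le> ennreal C1 * ?R" using T_le True by (simp add: order_trans[OF _ mult_left_mono])
      also have "\<dots> \<le> ?D * ?R" using C1pos by (intro mult_right_mono ennreal_leI) (auto simp: True)
      finally show ?thesis using T_eq by simp
    next
      case False
      then have a1: "1 < a" using a by simp
      define b where "b = a / (a - 1)"
      have b: "1 < b" using a1 by (simp add: b_def field_simps)
      have C2': "C2 = 16 * b * 2 powr (b - 1) / (b - 1)" using C2[OF a1] by (simp add: b_def)
      have C2pos: "0 < C2" unfolding C2' using b by (intro divide_pos_pos mult_pos_pos) auto
      \<comment> \<open>With the conjugate exponent b, the power b of h is the power a of
        \<open>Xn\<close>. The value of \<eta> makes C1 \<eta> C2 = 1/2, so exactly half of
        \<open>T\<close> reappears on the right, and K is then fixed by K^(1/a) \<eta>^(1 - 1/a) =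
        1, which lets the product x m be split by \<open>ennreal_powr_Young\<close>.\<close>
      define \<eta> where "\<eta> = 1 / (2 * C1 * C2)"
      define K where "K = (2 * C1 * C2) powr (a - 1)"
      have \<eta>: "0 < \<eta>" "0 < K" using C1pos C2pos by (auto simp: \<eta>_def K_def)
      have yg: "x * m \<le> ennreal K * ennreal_powr x a + ennreal \<eta> * ennreal_powr m b" for x m
      proof -
        have e1: "ennreal_powr (ennreal K * ennreal_powr x a) (1/a) = ennreal (K powr (1/a)) * x"
          using a1 \<eta> by (simp add: ennreal_powr_cmult ennreal_powr_inverse)
        have e2: "ennreal_powr (ennreal \<eta> * ennreal_powr m b) (1 - 1/a) = ennreal (\<eta> powr (1 - 1/a)) * m"
        proof -
          have "b * (1 - 1/a) = 1" using a1 by (simp add: b_def field_simps)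
          then show ?thesis using a1 \<eta> by (simp add: ennreal_powr_cmult ennreal_powr_powr)
        qed
        have "K powr (1/a) * \<eta> powr (1 - 1/a) = 1"
        proof -
          have "\<eta> powr (1 - 1/a) = (2 * C1 * C2) powr (- (1 - 1/a))"
            using C1pos C2pos by (subst powr_minus) (simp add: \<eta>_def powr_divide inverse_eq_divide)
          moreover have "K powr (1/a) = (2 * C1 * C2) powr (1 - 1/a)"
            using a1 by (simp add: K_def powr_powr diff_divide_distrib)
          ultimately show ?thesis using C1pos C2pos by (simp add: powr_add[symmetric])
        qed
        then have "x * m = ennreal (K powr (1/a)) * x * (ennreal (\<eta> powr (1 - 1/a)) * m)"
        proof -
          assume e: "K powr (1/a) * \<eta> powr (1 - 1/a) = 1"
          have "ennreal (K powr (1/a)) * x * (ennreal (\<eta> powr (1 - 1/a)) * m) = (ennreal (K powr (1/a)) * ennreal (\<eta> powr (1 - 1/a))) * (x * m)"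
            by (simp add: mult_ac)
          also have "ennreal (K powr (1/a)) * ennreal (\<eta> powr (1 - 1/a)) = 1"
            by (subst ennreal_mult[symmetric]) (simp_all only: e powr_ge_zero ennreal_1)
          finally show ?thesis by simp
        qed
        also have "\<dots> \<le> ennreal K * ennreal_powr x a + ennreal \<eta> * ennreal_powr m b"
          unfolding e1[symmetric] e2[symmetric] using a1 by (intro ennreal_powr_Young) auto
        finally show ?thesis .
      qed
      have hb: "(\<integral>\<^sup>+t. ennreal_powr (hl_max h t) b \<partial>lborel) \<le> ennreal C2 * T"
      proof -
        have "ennreal_powr (h t) b = ennreal_powr (Xn t) a" for t
          using a1 by (simp add: h_def ennreal_powr_powr b_def)
        then show ?thesis unfolding T_def C2' using hl_max_strong_unweighted[of h b] b by simp
      qed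
      have "(\<integral>\<^sup>+t. U t * indicator J t * hl_max h t \<partial>lborel)
        \<le> (\<integral>\<^sup>+t. ennreal K * (ennreal_powr (U t) a * indicator J t) + ennreal \<eta> * ennreal_powr (hl_max h t) b \<partial>lborel)"
        using yg by (intro nn_integral_mono) (auto split: split_indicator)
      also have "\<dots> = ennreal K * ?R + ennreal \<eta> * (\<integral>\<^sup>+t. ennreal_powr (hl_max h t) b \<partial>lborel)"
        by (simp add: nn_integral_add nn_integral_cmult)
      also have "\<dots> \<le> ennreal K * ?R + ennreal \<eta> * (ennreal C2 * T)"
        by (intro add_left_mono mult_left_mono hb) auto
      finally have "T \<le> ennreal C1 * (ennreal K * ?R + ennreal \<eta> * (ennreal C2 * T))"
        using T_le by (meson mult_left_mono order_trans zero_le)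
      also have "\<dots> = ennreal (C1 * K) * ?R + ennreal (C1 * \<eta> * C2) * T"
        using C1pos C2pos \<eta> by (simp add: distrib_left ennreal_mult mult_ac)
      also have "C1 * \<eta> * C2 = 1/2" using C1pos C2pos by (simp add: \<eta>_def)
      finally have T2: "T \<le> ennreal (C1 * K) * ?R + ennreal (1/2) * T" .
      have "T \<le> ennreal (2 * C1 * K) * ?R"
      proof (cases "ennreal (C1 * K) * ?R")
        case (real z)
        obtain v where v: "T = ennreal v" "0 \<le> v" using T_fin by (cases T) auto
        have "ennreal v \<le> ennreal z + ennreal (1/2) * ennreal v"
          using T2 unfolding real(2) v(1) .
        also have "\<dots> = ennreal (z + 1/2 * v)"
          using v real(1) by (subst ennreal_mult[symmetric], simp, simp, subst ennreal_plus) auto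
        finally have "ennreal v \<le> ennreal (z + 1/2 * v)" .
        then have "v \<le> 2 * z" using v real(1) by (subst (asm) ennreal_le_iff) auto
        then have "T \<le> ennreal 2 * ennreal z" using v real(1) by (subst ennreal_mult[symmetric]) (auto intro: ennreal_leI)
        also have "\<dots> = ennreal (2 * C1 * K) * ?R"
          unfolding real(2)[symmetric] mult.assoc[symmetric] using C1pos \<eta> by (subst ennreal_mult[symmetric]) (auto simp: mult.assoc)
        finally show ?thesis .
      next
        case top
        then have "?R = top" by (auto simp: ennreal_mult_eq_top_iff)
        then show ?thesis using C1pos \<eta> by (simp add: ennreal_mult_top)
      qed
      also have "\<dots> \<le> ?D * ?R" using C1pos \<eta> by (intro mult_right_mono ennreal_leI mult_left_mono) (auto simp: K_def)
      finally show ?thesis using T_eq by simp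
    qed
  qed
  have "(\<integral>\<^sup>+\<theta>\<in>I. ennreal_powr (X \<theta>) a \<partial>lborel)
    = (\<integral>\<^sup>+\<theta>. (SUP n. ennreal_powr (min (X \<theta>) (of_nat n)) a * indicator I \<theta>) \<partial>lborel)"
    using a by (simp add: SUP_mult_right_ennreal[symmetric] SUP_ennreal_powr_min)
  also have "\<dots> = (SUP n. (\<integral>\<^sup>+\<theta>\<in>I. ennreal_powr (min (X \<theta>) (of_nat n)) a \<partial>lborel))"
    using a by (intro nn_integral_monotone_convergence_SUP)
      (auto simp: incseq_def le_fun_def intro!: mult_right_mono ennreal_powr_mono min.mono)
  also have "\<dots> \<le> ?D * ?R" using trunc by (intro SUP_least)
  finally show ?thesis unfolding X_def U_def F_def .
qed

text \<open>
  With \<open>U = \<integral> u\<close> and \<open>H = U + e\<close>, factor \<open>u powr s = (u / H powr (1 - a)) powr s * H powr ((1 - a) * s)\<close>.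
  Cauchy--Schwarz on each interval separates the two factors. The choice \<open>s = a/4\<close> puts the squares
  of the factors into \<open>L\<^sup>P\<close> with \<open>P = 2/a\<close> and \<open>P = 2/(1-a)\<close>, and both exponents exceed \<open>1\<close>. The
  small constant \<open>e\<close> only avoids the division by \<open>0\<close>.
\<close>
lemma vector_hl_max_less1:
  fixes u :: "'r \<Rightarrow> real \<Rightarrow> ennreal"
  assumes N: "sigma_finite_measure N"
    and u[measurable]: "(\<lambda>(r, t). u r t) \<in> borel_measurable (N \<Otimes>\<^sub>M borel)"
    and J[measurable]: "J \<in> sets borel" and fin: "emeasure lborel J < \<infinity>"
    and a: "0 < a" "a < 1" and s: "s = a / 4"
    and C1: "C1 = 16 * (2/a) * 2 powr (2/a - 1) / (2/a - 1)"
    and C2: "C2 = 16 * (2/(1-a)) * 2 powr (2/(1-a) - 1) / (2/(1-a) - 1)"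
  shows "(\<integral>\<^sup>+\<theta>. ennreal_powr (\<integral>\<^sup>+r. ennreal_powr (hl_max (\<lambda>t. ennreal_powr (u r t) s * indicator J t) \<theta>) (1/s) \<partial>N) a \<partial>lborel)
    \<le> ennreal ((C1 + C2) * 2 powr a) * (mixed_integral a N u J)"
proof -
  interpret N: sigma_finite_measure N by fact
  define U where "U t = (\<integral>\<^sup>+r. u r t \<partial>N)" for t
  have U[measurable]: "U \<in> borel_measurable borel" unfolding U_def by (intro measurable_nn_integral_swapped N u)
  define F where "F r t = ennreal_powr (u r t) s * indicator J t" for r t
  have F[measurable]: "(\<lambda>(r, t). F r t) \<in> borel_measurable (N \<Otimes>\<^sub>M borel)" unfolding F_def by measurable
  define X where "X \<theta> = (\<integral>\<^sup>+r. ennreal_powr (hl_max (F r) \<theta>) (1/s) \<partial>N)" for \<theta>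
  have MF[measurable]: "(\<lambda>(r, \<theta>). ennreal_powr (hl_max (F r) \<theta>) (1/s)) \<in> borel_measurable (N \<Otimes>\<^sub>M borel)"
    by measurable
  have X[measurable]: "X \<in> borel_measurable borel" unfolding X_def by (intro measurable_nn_integral_swapped N MF)
  let ?R = "\<integral>\<^sup>+t\<in>J. ennreal_powr (U t) a \<partial>lborel"
  let ?L = "\<integral>\<^sup>+\<theta>. ennreal_powr (X \<theta>) a \<partial>lborel"
  have s0: "0 < s" using a s by simp
  have C1pos: "0 < C1" using a unfolding C1 by (intro divide_pos_pos mult_pos_pos) (auto simp: field_simps)
  have C2pos: "0 < C2" using a unfolding C2 by (intro divide_pos_pos mult_pos_pos) (auto simp: field_simps)
  let ?D = "(C1 + C2) * 2 powr a"
  have Dpos: "0 < ?D" using C1pos C2pos by simp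
  obtain L where L: "emeasure lborel J = ennreal L" "0 \<le> L" using fin by (cases "emeasure lborel J") auto
  have main: "?L \<le> ennreal ?D * (?R + ennreal (e powr a * L))" if Rfin: "?R < \<infinity>" and e: "0 < e" for e
  proof -
    define H where "H t = U t + ennreal e" for t
    have [measurable]: "H \<in> borel_measurable borel" unfolding H_def by measurable
    have Hpos: "H t \<noteq> 0" for t using e by (simp add: H_def)
    \<comment> \<open>Where H is infinite, the quotient in the factor \<open>A\<close> below is 0
      and \<open>A * B\<close> does not recover \<open>F\<close>. Finiteness of the right-hand side
      confines this to a null subset of J.\<close>
    have "AE t in lborel. ennreal_powr (U t) a * indicator J t \<noteq> \<infinity>"
      using Rfin by (intro nn_integral_PInf_AE) auto
    then have Hfin: "AE t in lborel. t \<in> J \<longrightarrow> H t < \<infinity>"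
      by (elim eventually_mono) (auto simp: H_def less_top[symmetric] split: split_indicator)
    define A where "A r t = ennreal_powr (u r t / ennreal_powr (H t) (1 - a)) s * indicator J t" for r t
    define B where "B t = ennreal_powr (H t) ((1 - a) * s) * indicator J t" for t
    have A[measurable]: "(\<lambda>(r, t). A r t) \<in> borel_measurable (N \<Otimes>\<^sub>M borel)" unfolding A_def by measurable
    have B[measurable]: "B \<in> borel_measurable borel" unfolding B_def by measurable
    have sq: "(ennreal_powr x c)\<^sup>2 = ennreal_powr x (2 * c)" if "0 < c" for x c
      using ennreal_powr_add[of c c x] that by (simp add: power2_eq_square)
    have FAB: "(hl_max (F r) \<theta>)\<^sup>2 \<le> hl_max (\<lambda>t. (A r t)\<^sup>2) \<theta> * hl_max (\<lambda>t. (B t)\<^sup>2) \<theta>" if "r \<in> space N" for r \<theta>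
    proof (rule hl_max_Cauchy_Schwarz)
      show "A r \<in> borel_measurable borel" using that by measurable
      show "AE t in lborel. F r t \<le> A r t * B t"
        using Hfin
      proof eventually_elim
        case (elim t)
        show ?case
        proof (cases "t \<in> J")
          case True
          define y where "y = ennreal_powr (H t) (1 - a)"
          have y: "y \<noteq> 0" "y \<noteq> top"
            using elim True Hpos[of t] ennreal_powr_less_top_iff[of "H t" "1 - a"]
            by (auto simp: y_def ennreal_powr_eq_0_iff less_top[symmetric])
          have "u r t = u r t / y * y"
            using y by (simp add: ennreal_divide_times ennreal_divide_self less_top)
          then have "ennreal_powr (u r t) s = ennreal_powr (u r t / y) s * ennreal_powr y s"
            using s0 by (metis ennreal_powr_mult)
          then show ?thesis by (simp add: F_def A_def B_def True y_def ennreal_powr_powr)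
        qed (simp add: F_def)
      qed
    qed measurable
    define K where "K \<theta> = ennreal_powr (hl_max (\<lambda>t. (B t)\<^sup>2) \<theta>) (1 / (2 * s))" for \<theta>
    define Y where "Y \<theta> = (\<integral>\<^sup>+r. ennreal_powr (hl_max (\<lambda>t. (A r t)\<^sup>2) \<theta>) (1 / (2 * s)) \<partial>N)" for \<theta>
    have MA[measurable]: "(\<lambda>(r, \<theta>). ennreal_powr (hl_max (\<lambda>t. (A r t)\<^sup>2) \<theta>) (1 / (2 * s))) \<in> borel_measurable (N \<Otimes>\<^sub>M borel)"
      by measurable
    have [measurable]: "K \<in> borel_measurable borel" unfolding K_def by measurable
    have [measurable]: "Y \<in> borel_measurable borel" unfolding Y_def by (intro measurable_nn_integral_swapped N MA)
    have XKY: "X \<theta> \<le> Y \<theta> * K \<theta>" for \<theta>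
    proof -
      have "X \<theta> \<le> (\<integral>\<^sup>+r. ennreal_powr (hl_max (\<lambda>t. (A r t)\<^sup>2) \<theta>) (1 / (2 * s)) * K \<theta> \<partial>N)"
        unfolding X_def
      proof (rule nn_integral_mono)
        fix r assume r: "r \<in> space N"
        have "ennreal_powr (hl_max (F r) \<theta>) (1/s) = ennreal_powr ((hl_max (F r) \<theta>)\<^sup>2) (1 / (2 * s))"
          using sq[of 1 "hl_max (F r) \<theta>"] s0 by (simp add: ennreal_powr_powr)
        also have "\<dots> \<le> ennreal_powr (hl_max (\<lambda>t. (A r t)\<^sup>2) \<theta> * hl_max (\<lambda>t. (B t)\<^sup>2) \<theta>) (1 / (2 * s))"
          using s0 FAB[OF r] by (intro ennreal_powr_mono) auto
        also have "\<dots> = ennreal_powr (hl_max (\<lambda>t. (A r t)\<^sup>2) \<theta>) (1 / (2 * s)) * K \<theta>"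
          using s0 by (simp add: K_def ennreal_powr_mult)
        finally show "ennreal_powr (hl_max (F r) \<theta>) (1/s) \<le> ennreal_powr (hl_max (\<lambda>t. (A r t)\<^sup>2) \<theta>) (1 / (2 * s)) * K \<theta>" .
      qed
      also have "\<dots> = Y \<theta> * K \<theta>" unfolding Y_def by (intro nn_integral_multc) measurable
      finally show ?thesis .
    qed
    \<comment> \<open>Instead of Hoelder's inequality in \<theta>, a pointwise Young inequality
      suffices: the integrals of both summands turn out to be bounded by multiples of the same
      \<open>Z\<close>.\<close>
    have XaYK: "ennreal_powr (X \<theta>) a \<le> Y \<theta> + ennreal_powr (K \<theta>) (a / (1 - a))" for \<theta>
    proof -
      have "ennreal_powr (X \<theta>) a \<le> ennreal_powr (Y \<theta>) a * ennreal_powr (K \<theta>) a"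
        using ennreal_powr_mono[OF XKY, of a] a by (simp add: ennreal_powr_mult)
      also have "ennreal_powr (K \<theta>) a = ennreal_powr (ennreal_powr (K \<theta>) (a / (1 - a))) (1 - a)"
        using a by (simp add: ennreal_powr_powr)
      also have "ennreal_powr (Y \<theta>) a * \<dots> \<le> Y \<theta> + ennreal_powr (K \<theta>) (a / (1 - a))"
        using a by (intro ennreal_powr_Young) auto
      finally show ?thesis .
    qed
    define Z where "Z = (\<integral>\<^sup>+t\<in>J. ennreal_powr (H t) a \<partial>lborel)"
    have KZ: "(\<integral>\<^sup>+\<theta>. ennreal_powr (K \<theta>) (a / (1 - a)) \<partial>lborel) \<le> ennreal C2 * Z"
    proof -
      define P where "P = 2 / (1 - a)"
      have P: "1 < P" using a by (simp add: P_def)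
      have "1 / (2 * s) * (a / (1 - a)) = P" using a by (simp add: s P_def field_simps)
      then have "(\<integral>\<^sup>+\<theta>. ennreal_powr (K \<theta>) (a / (1 - a)) \<partial>lborel) = (\<integral>\<^sup>+\<theta>. ennreal_powr (hl_max (\<lambda>t. (B t)\<^sup>2) \<theta>) P \<partial>lborel)"
        unfolding K_def by (simp add: ennreal_powr_powr)
      also have "\<dots> \<le> ennreal C2 * (\<integral>\<^sup>+t. ennreal_powr ((B t)\<^sup>2) P \<partial>lborel)"
        unfolding C2 P_def[symmetric] using P by (intro hl_max_strong_unweighted) auto
      also have "(\<integral>\<^sup>+t. ennreal_powr ((B t)\<^sup>2) P \<partial>lborel) = Z"
        unfolding Z_def
      proof (rule nn_integral_cong)
        fix t
        have "2 * ((1 - a) * s) * P = a" using a by (simp add: s P_def field_simps)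
        then show "ennreal_powr ((B t)\<^sup>2) P = ennreal_powr (H t) a * indicator J t"
          using a s0 by (auto simp: B_def sq ennreal_powr_powr split: split_indicator)
      qed
      finally show ?thesis .
    qed
    \<comment> \<open>The scalar inequality is applied for each r. As the power 1/s of
      \<open>A r\<close> is u/H^(1-a) on J, integration over \<open>N\<close> leaves U/H^(1-a),
      which is at most H^a because U <= H.\<close>
    have YZ: "(\<integral>\<^sup>+\<theta>. Y \<theta> \<partial>lborel) \<le> ennreal C1 * Z"
    proof -
      define P where "P = 2 / a"
      have P: "1 < P" using a by (simp add: P_def)
      have P': "1 / (2 * s) = P" using a by (simp add: s P_def)
      have "(\<integral>\<^sup>+\<theta>. Y \<theta> \<partial>lborel) = (\<integral>\<^sup>+r. (\<integral>\<^sup>+\<theta>. ennreal_powr (hl_max (\<lambda>t. (A r t)\<^sup>2) \<theta>) P \<partial>lborel) \<partial>N)"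
        unfolding Y_def P' by (intro nn_integral_swap_lborel N) measurable
      also have "\<dots> \<le> (\<integral>\<^sup>+r. ennreal C1 * (\<integral>\<^sup>+t. ennreal_powr ((A r t)\<^sup>2) P \<partial>lborel) \<partial>N)"
        unfolding C1 P_def[symmetric] using P by (intro nn_integral_mono hl_max_strong_unweighted) auto
      also have "\<dots> = (\<integral>\<^sup>+r. ennreal C1 * (\<integral>\<^sup>+t\<in>J. u r t / ennreal_powr (H t) (1 - a) \<partial>lborel) \<partial>N)"
      proof (intro nn_integral_cong arg_cong2[where f="(*)"] refl)
        fix r t
        have "2 * s * P = 1" using a by (simp add: s P_def)
        then show "ennreal_powr ((A r t)\<^sup>2) P = u r t / ennreal_powr (H t) (1 - a) * indicator J t"
          using s0 by (auto simp: A_def sq ennreal_powr_powr split: split_indicator)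
      qed
      also have "\<dots> = ennreal C1 * (\<integral>\<^sup>+r. (\<integral>\<^sup>+t\<in>J. u r t / ennreal_powr (H t) (1 - a) \<partial>lborel) \<partial>N)"
      proof (intro nn_integral_cmult)
        have "(\<lambda>(r, t). u r t / ennreal_powr (H t) (1 - a) * indicator J t) \<in> borel_measurable (N \<Otimes>\<^sub>M lborel)"
          by (simp cong: measurable_cong_sets sets_pair_measure_cong)
        then show "(\<lambda>r. \<integral>\<^sup>+t\<in>J. u r t / ennreal_powr (H t) (1 - a) \<partial>lborel) \<in> borel_measurable N"
          by (rule lborel.borel_measurable_nn_integral)
      qed
      also have "(\<integral>\<^sup>+r. (\<integral>\<^sup>+t\<in>J. u r t / ennreal_powr (H t) (1 - a) \<partial>lborel) \<partial>N)
        = (\<integral>\<^sup>+t. (\<integral>\<^sup>+r. u r t / ennreal_powr (H t) (1 - a) * indicator J t \<partial>N) \<partial>lborel)"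
        by (intro nn_integral_swap_lborel[symmetric] N) measurable
      also have "\<dots> = (\<integral>\<^sup>+t\<in>J. U t / ennreal_powr (H t) (1 - a) \<partial>lborel)"
        unfolding U_def by (intro nn_integral_cong) (simp add: nn_integral_multc nn_integral_divide)
      also have "\<dots> \<le> Z"
        unfolding Z_def
      proof (intro nn_integral_mono mult_right_mono)
        fix t
        have UH: "U t \<le> H t" by (simp add: H_def)
        show "U t / ennreal_powr (H t) (1 - a) \<le> ennreal_powr (H t) a"
        proof (cases "H t = top")
          case False
          define y where "y = ennreal_powr (H t) (1 - a)"
          have y: "y \<noteq> 0" "y \<noteq> top"
            using False Hpos[of t] ennreal_powr_less_top_iff[of "H t" "1 - a"]
            by (auto simp: y_def ennreal_powr_eq_0_iff less_top[symmetric])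
          have "H t = ennreal_powr (H t) a * y"
            using ennreal_powr_add[of a "1 - a" "H t"] a by (simp add: y_def)
          then have "U t / y \<le> ennreal_powr (H t) a * y / y"
            using UH by (metis divide_right_mono_ennreal)
          then show ?thesis using y by (simp add: y_def[symmetric] mult_divide_eq_ennreal)
        qed simp
      qed auto
      finally show ?thesis by (simp add: mult_left_mono)
    qed
    have "?L \<le> (\<integral>\<^sup>+\<theta>. Y \<theta> + ennreal_powr (K \<theta>) (a / (1 - a)) \<partial>lborel)"
      by (intro nn_integral_mono XaYK)
    also have "\<dots> = (\<integral>\<^sup>+\<theta>. Y \<theta> \<partial>lborel) + (\<integral>\<^sup>+\<theta>. ennreal_powr (K \<theta>) (a / (1 - a)) \<partial>lborel)"
      by (intro nn_integral_add) measurable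
    also have "\<dots> \<le> ennreal C1 * Z + ennreal C2 * Z" by (intro add_mono YZ KZ)
    also have "\<dots> = ennreal (C1 + C2) * Z" using C1pos C2pos by (simp add: distrib_right)
    also have "Z \<le> ennreal (2 powr a) * (?R + ennreal (e powr a * L))"
    proof -
      have "Z \<le> (\<integral>\<^sup>+t. ennreal (2 powr a) * (ennreal_powr (U t) a * indicator J t + ennreal (e powr a) * indicator J t) \<partial>lborel)"
        unfolding Z_def
      proof (rule nn_integral_mono)
        fix t
        show "ennreal_powr (H t) a * indicator J t \<le> ennreal (2 powr a) * (ennreal_powr (U t) a * indicator J t + ennreal (e powr a) * indicator J t)"
          using ennreal_powr_sum_le[of a "U t" "ennreal e"] a e
          by (auto simp: H_def ennreal_powr_ennreal split: split_indicator)
      qed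
      also have "\<dots> = ennreal (2 powr a) * (?R + ennreal (e powr a * L))"
        using L by (simp add: nn_integral_cmult nn_integral_add ennreal_mult)
      finally show ?thesis .
    qed
    finally show ?thesis using C1pos C2pos
      by (simp add: mult_left_mono ennreal_mult mult.assoc)
  qed
  have "?L \<le> ennreal ?D * ?R"
  proof (cases "?R = top")
    case True
    moreover have "C1 + C2 \<noteq> 0" using C1pos C2pos by linarith
    ultimately show ?thesis using Dpos by (simp add: ennreal_mult_top)
  next
    case False
    then have Rfin: "?R < \<infinity>" by (simp add: less_top)
    show ?thesis
    proof (rule ennreal_le_epsilon)
      fix d :: real assume d: "0 < d"
      \<comment> \<open>Chosen so that the error \<open>?D * (e powr a * L)\<close> equals d L/(L +
        1) <= d; L + 1 instead of L avoids a division by 0 when J is a null set.\<close>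
      define e where "e = (d / (?D * (L + 1))) powr (1 / a)"
      have q: "0 < d / (?D * (L + 1))"
      proof -
        have "0 < C1 + C2" "0 < L + 1" using C1pos C2pos L by linarith+
        then show ?thesis using d by (intro divide_pos_pos mult_pos_pos) auto
      qed
      have e: "0 < e" unfolding e_def powr_gt_zero using q by (rule less_imp_neq[symmetric])
      have "1 / a * a = 1" using a by simp
      then have "e powr a = d / (?D * (L + 1))"
        by (simp only: e_def powr_powr powr_one[OF less_imp_le[OF q]])
      moreover have "K * (d / (K * (L + 1)) * L) = d * (L / (L + 1))" if "0 < K" for K
        using that L(2) by (simp add: divide_simps)
      ultimately have "?D * (e powr a * L) = d * (L / (L + 1))" using Dpos by metis
      also have "\<dots> \<le> d" using d L(2) by (intro mult_left_le) auto
      finally have "?D * (e powr a * L) \<le> d" .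
      moreover have "?L \<le> ennreal ?D * ?R + ennreal (?D * (e powr a * L))"
        using main[OF Rfin e] Dpos L(2) by (simp add: distrib_left ennreal_mult)
      ultimately show "?L \<le> ennreal ?D * ?R + ennreal d"
        by (meson add_left_mono ennreal_leI order_trans)
    qed
  qed
  then show ?thesis unfolding X_def U_def F_def .
qed

text \<open>Joins the two ranges of \<open>a\<close>: the value of s is 1/4 in the first, where
  every s in (0, 1) is admissible, and the prescribed a/4 in the second. The constant is obtained
  before the measure and the family, hence will not depend on the holomorphic function.\<close>

theorem vector_hl_max:
  assumes a: "0 < a" and s: "s = min 1 a / 4"
  obtains C where "0 < C"
    "\<And>(N :: 'r measure) u I J. \<lbrakk>sigma_finite_measure N; (\<lambda>(r, t). u r t) \<in> borel_measurable (N \<Otimes>\<^sub>M borel);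
       I \<in> sets borel; J \<in> sets borel; emeasure lborel I < \<infinity>; emeasure lborel J < \<infinity>\<rbrakk> \<Longrightarrow>
     (\<integral>\<^sup>+\<theta>\<in>I. ennreal_powr (\<integral>\<^sup>+r. ennreal_powr (hl_max (\<lambda>t. ennreal_powr (u r t) s * indicator J t) \<theta>) (1/s) \<partial>N) a \<partial>lborel)
     \<le> ennreal C * (mixed_integral a N u J)"
proof (cases "1 \<le> a")
  case True
  define C1 where "C1 = 16 * (1/s) * 2 powr (1/s - 1) / (1/s - 1)"
  define C2 where "C2 = 16 * (a/(a-1)) * 2 powr (a/(a-1) - 1) / (a/(a-1) - 1)"
  have s': "0 < s" "s < 1" using s True by auto
  have "0 < C1" using s' unfolding C1_def by (intro divide_pos_pos mult_pos_pos) (auto simp: field_simps)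
  then show thesis
    using vector_hl_max_ge1[OF _ _ _ _ _ True s' C1_def C2_def]
    by (intro that[of "2 * C1 * (1 + (2 * C1 * C2) powr (a - 1))"]) (auto intro!: mult_pos_pos add_pos_nonneg)
next
  case False
  then have a': "a < 1" and s': "s = a / 4" using s by auto
  define C1 where "C1 = 16 * (2/a) * 2 powr (2/a - 1) / (2/a - 1)"
  define C2 where "C2 = 16 * (2/(1-a)) * 2 powr (2/(1-a) - 1) / (2/(1-a) - 1)"
  have "0 < C1" using a a' unfolding C1_def by (intro divide_pos_pos mult_pos_pos) (auto simp: field_simps)
  moreover have "0 < C2" using a a' unfolding C2_def by (intro divide_pos_pos mult_pos_pos) (auto simp: field_simps)
  ultimately have pos: "0 < (C1 + C2) * 2 powr a" by simp
  have restrict: "(\<integral>\<^sup>+\<theta>\<in>I. f \<theta> \<partial>lborel) \<le> (\<integral>\<^sup>+\<theta>. f \<theta> \<partial>lborel)" for f :: "real \<Rightarrow> ennreal" and I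
    by (intro nn_integral_mono) (auto split: split_indicator)
  show thesis
    by (rule that[OF pos], rule order_trans[OF restrict], rule vector_hl_max_less1[OF _ _ _ _ a a' s' C1_def C2_def])
qed

subsection \<open>The Poisson inequality for powers of holomorphic functions\<close>

text \<open>Normalised without the factor 1/(2 pi), and for an evaluation point x on the real
  radius.\<close>

definition poisson_kernel :: "real \<Rightarrow> real \<Rightarrow> real" where
  "poisson_kernel x t = (1 - x\<^sup>2) / (1 - 2 * x * cos t + x\<^sup>2)"

lemma norm_cis_minus_of_real: "(norm (cis t - of_real x))\<^sup>2 = 1 - 2 * x * cos t + x\<^sup>2"
proof -
  have "(norm (cis t - of_real x))\<^sup>2 = (cos t - x)\<^sup>2 + (sin t)\<^sup>2" by (simp add: cmod_power2)
  also have "\<dots> = ((cos t)\<^sup>2 + (sin t)\<^sup>2) - 2 * x * cos t + x\<^sup>2" by (simp add: power2_eq_square algebra_simps)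
  finally show ?thesis by simp
qed

lemma poisson_denominator_pos:
  fixes x t :: real
  assumes "0 \<le> x" "x < 1" shows "0 < 1 - 2 * x * cos t + x\<^sup>2"
proof -
  have "cis t \<noteq> of_real x"
  proof
    assume "cis t = of_real x"
    then have "norm (cis t) = norm (of_real x :: complex)" by simp
    then show False using assms by simp
  qed
  then have "0 < (norm (cis t - of_real x))\<^sup>2" by simp
  then show ?thesis by (simp only: norm_cis_minus_of_real)
qed

lemma poisson_kernel_nonneg: "0 \<le> x \<Longrightarrow> x < 1 \<Longrightarrow> 0 \<le> poisson_kernel x t"
  unfolding poisson_kernel_def using poisson_denominator_pos[of x t]
  by (intro divide_nonneg_nonneg) (auto simp: power_le_one)

lemma continuous_on_poisson_kernel [continuous_intros]:
  fixes f :: "'a::t2_space \<Rightarrow> real"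
  assumes "0 \<le> x" "x < 1" "continuous_on A f"
  shows "continuous_on A (\<lambda>t. poisson_kernel x (f t))"
  unfolding poisson_kernel_def using poisson_denominator_pos[of x] assms
  by (intro continuous_intros) (auto simp: less_imp_neq[symmetric])

text \<open>Cauchy's formula at x, applied to G times (1 - x^2)/(1 - x u). This factor is 1 at u =
  x, and on the unit circle it turns the Cauchy kernel into the Poisson kernel, since there (1 - x
  u)(u - x) = u |u - x|^2.\<close>

lemma poisson_formula:
  assumes cont: "continuous_on (cball 0 1) G" and hol: "G holomorphic_on ball 0 1" and x: "0 \<le> x" "x < 1"
  shows "((\<lambda>t. of_real (poisson_kernel x t) * G (cis t)) has_integral (2 * of_real pi * G (of_real x))) {0..2 * pi}"
proof -
  define f where "f u = G u * (1 - of_real x ^ 2) / (1 - of_real x * u)" for u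
  have nz: "1 - of_real x * u \<noteq> 0" if "norm u \<le> 1" for u :: complex
  proof
    assume "1 - of_real x * u = 0"
    then have "norm (of_real x * u) = 1" by (metis eq_iff_diff_eq_0 norm_one)
    moreover have "norm (of_real x * u) \<le> x * 1" using x that by (simp add: norm_mult mult_left_mono del: mult_1_right)
    ultimately show False using x by simp
  qed
  have "((\<lambda>u. f u / (u - of_real x)) has_contour_integral (2 * of_real pi * \<i> * f (of_real x))) (circlepath 0 1)"
  proof (rule Cauchy_integral_circlepath)
    show "continuous_on (cball 0 1) f" unfolding f_def using nz cont by (intro continuous_intros) auto
    show "f holomorphic_on ball 0 1" unfolding f_def using nz hol by (intro holomorphic_intros) auto
  qed (use x in auto)
  moreover have "f (of_real x) = G (of_real x)"
  proof -
    have "1 - of_real x * of_real x \<noteq> (0::complex)" using nz[of "of_real x"] x by simp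
    then show ?thesis by (simp add: f_def power2_eq_square)
  qed
  ultimately have "((\<lambda>t. f (cis t) / (cis t - of_real x) * \<i> * cis t) has_integral (2 * of_real pi * \<i> * G (of_real x))) {0..2 * pi}"
    by (simp add: circlepath_def has_contour_integral_part_circlepath_iff)
  then have "((\<lambda>t. - \<i> * (f (cis t) / (cis t - of_real x) * \<i> * cis t)) has_integral (- \<i> * (2 * of_real pi * \<i> * G (of_real x)))) {0..2 * pi}"
    by (rule has_integral_mult_right)
  moreover have "- \<i> * (f (cis t) / (cis t - of_real x) * \<i> * cis t) = of_real (poisson_kernel x t) * G (cis t)" for t
  proof -
    have d: "(1 - of_real x * cis t) * (cis t - of_real x) = cis t * of_real (1 - 2 * x * cos t + x\<^sup>2)"
      by (rule complex_eqI) (simp_all add: power2_eq_square algebra_simps flip: sin_cos_squared_add, (simp add: sin_squared_eq[unfolded power2_eq_square] algebra_simps)?)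
    have "- \<i> * (f (cis t) / (cis t - of_real x) * \<i> * cis t) = G (cis t) * (1 - of_real x ^ 2) * cis t / ((1 - of_real x * cis t) * (cis t - of_real x))"
      by (simp add: f_def mult_ac)
    also have "\<dots> = of_real (poisson_kernel x t) * G (cis t)"
      unfolding d poisson_kernel_def using poisson_denominator_pos[OF x, of t] by (simp add: mult_ac)
    finally show ?thesis .
  qed
  moreover have "- \<i> * (2 * of_real pi * \<i> * G (of_real x)) = 2 * of_real pi * G (of_real x)" by (simp add: algebra_simps)
  ultimately show ?thesis by (simp only:)
qed

text \<open>The submean property of |F|^\<sigma> with respect to the unit circle, stated on the real
  radius only; other points are reached later by rotating the function.\<close>

definition poisson_dominated :: "real \<Rightarrow> (complex \<Rightarrow> complex) \<Rightarrow> bool" where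
  "poisson_dominated \<sigma> F \<longleftrightarrow> (\<forall>x. 0 \<le> x \<longrightarrow> x < 1 \<longrightarrow>
     2 * pi * norm (F (of_real x)) powr \<sigma> \<le> integral {0..2 * pi} (\<lambda>t. poisson_kernel x t * norm (F (cis t)) powr \<sigma>))"

text \<open>On a disc without zeros H = exp L, so |H|^\<sigma> is the modulus of the holomorphic
  function exp(\<sigma> L), to which the Poisson formula applies.\<close>

lemma poisson_dominated_nonvanishing:
  assumes \<sigma>: "0 < \<sigma>" and R: "1 < R" and hol: "H holomorphic_on ball 0 R" and nz: "\<And>z. z \<in> ball 0 R \<Longrightarrow> H z \<noteq> 0"
  shows "poisson_dominated \<sigma> H"
  unfolding poisson_dominated_def
proof (intro allI impI)
  fix x :: real assume x: "0 \<le> x" "x < 1"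
  obtain L where L: "L holomorphic_on ball 0 R" "\<And>z. z \<in> ball 0 R \<Longrightarrow> H z = exp (L z)"
    using contractible_imp_holomorphic_log[OF hol _ nz] convex_imp_contractible[OF convex_ball] by blast
  define G where "G z = exp (of_real \<sigma> * L z)" for z
  have G: "G holomorphic_on ball 0 R" unfolding G_def using L by (intro holomorphic_intros) auto
  have normG: "norm (G z) = norm (H z) powr \<sigma>" if "z \<in> ball 0 R" for z
    using L(2)[OF that] by (simp add: G_def powr_def)
  have sub: "cball 0 1 \<subseteq> ball 0 R" using R by auto
  have contG: "continuous_on (cball 0 1) G"
    using G sub holomorphic_on_imp_continuous_on continuous_on_subset by blast
  have int: "((\<lambda>t. of_real (poisson_kernel x t) * G (cis t)) has_integral (2 * of_real pi * G (of_real x))) {0..2 * pi}"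
    using R by (intro poisson_formula contG x holomorphic_on_subset[OF G]) auto
  have contH: "continuous_on {0..2*pi} (\<lambda>t. norm (H (cis t)) powr \<sigma>)"
  proof -
    have "continuous_on {0..2*pi} (\<lambda>t. norm (G (cis t)))"
      using contG by (intro continuous_intros continuous_on_compose2[OF contG]) auto
    then show ?thesis using normG R by (simp cong: continuous_on_cong)
  qed
  have "norm (integral {0..2 * pi} (\<lambda>t. of_real (poisson_kernel x t) * G (cis t)))
    \<le> integral {0..2 * pi} (\<lambda>t. poisson_kernel x t * norm (H (cis t)) powr \<sigma>)"
  proof (rule integral_norm_bound_integral)
    show "(\<lambda>t. poisson_kernel x t * norm (H (cis t)) powr \<sigma>) integrable_on {0..2 * pi}"
      by (intro integrable_continuous_real continuous_on_mult continuous_on_poisson_kernel contH x continuous_on_id)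
    show "norm (of_real (poisson_kernel x t) * G (cis t)) \<le> poisson_kernel x t * norm (H (cis t)) powr \<sigma>" for t
      using poisson_kernel_nonneg[OF x, of t] normG[of "cis t"] R by (simp add: norm_mult)
  qed (use int in blast)
  then show "2 * pi * norm (H (of_real x)) powr \<sigma> \<le> integral {0..2 * pi} (\<lambda>t. poisson_kernel x t * norm (H (cis t)) powr \<sigma>)"
    using normG[of "of_real x"] x R by (simp add: integral_unique[OF int] norm_mult)
qed

text \<open>Zeros on the unit circle are still possible, while the previous argument needs a
  zero-free disc of radius above 1. The dilates G(\<rho> z) with \<rho> < 1 have one, of radius
  1/\<rho>, and both sides of the inequality are continuous in \<rho> up to 1.\<close>

lemma poisson_dominated_nonvanishing_interior:
  assumes \<sigma>: "0 < \<sigma>" and R: "1 < R" and hol: "G holomorphic_on ball 0 R" and nz: "\<And>z. z \<in> ball 0 1 \<Longrightarrow> G z \<noteq> 0"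
  shows "poisson_dominated \<sigma> G"
  unfolding poisson_dominated_def
proof (intro allI impI)
  fix x :: real assume x: "0 \<le> x" "x < 1"
  have cont: "continuous_on (cball 0 1) G"
    using R by (intro continuous_on_subset[OF holomorphic_on_imp_continuous_on[OF hol]]) auto
  define I where "I \<rho> = integral {0..2 * pi} (\<lambda>t. poisson_kernel x t * norm (G (of_real \<rho> * cis t)) powr \<sigma>)" for \<rho> :: real
  have "continuous_on {0..1} (\<lambda>\<rho>. integral (cbox 0 (2 * pi)) (\<lambda>t. poisson_kernel x t * norm (G (of_real \<rho> * cis t)) powr \<sigma>))"
  proof (rule integral_continuous_on_param)
    have "continuous_on ({0..1} \<times> cbox 0 (2 * pi)) (\<lambda>p. G (of_real (fst p) * cis (snd p)))"
      by (intro continuous_on_compose2[OF cont] continuous_intros) (auto simp: norm_mult)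
    then show "continuous_on ({0..1} \<times> cbox 0 (2 * pi)) (\<lambda>(\<rho>, t). poisson_kernel x t * norm (G (of_real \<rho> * cis t)) powr \<sigma>)"
      using x \<sigma> unfolding case_prod_unfold by (intro continuous_intros continuous_on_powr') auto
  qed
  then have contI: "continuous_on {0..1} I" unfolding I_def by simp
  have contL: "continuous_on {0..1} (\<lambda>\<rho>. 2 * pi * norm (G (of_real \<rho> * of_real x)) powr \<sigma>)"
    using \<sigma> x by (intro continuous_intros continuous_on_powr' continuous_on_compose2[OF cont]) (auto simp: norm_mult mult_le_one)
  have ev: "\<forall>\<^sub>F \<rho> in at_left 1. 2 * pi * norm (G (of_real \<rho> * of_real x)) powr \<sigma> \<le> I \<rho>"
  proof -
    have "\<forall>\<^sub>F \<rho> in at_left (1::real). 0 < \<rho> \<and> \<rho> < 1"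
      using eventually_at_left_real[of 0 1] by simp
    then show ?thesis
    proof eventually_elim
      case (elim \<rho>)
      define H where "H z = G (of_real \<rho> * z)" for z
      have "poisson_dominated \<sigma> H"
      proof (rule poisson_dominated_nonvanishing[OF \<sigma>, of "1 / \<rho>"])
        show "1 < 1 / \<rho>" using elim by simp
        have in1: "of_real \<rho> * z \<in> ball 0 1" if "z \<in> ball 0 (1 / \<rho>)" for z :: complex
          using that elim by (auto simp: norm_mult field_simps)
        then show "H z \<noteq> 0" if "z \<in> ball 0 (1 / \<rho>)" for z using nz that by (simp add: H_def)
        have "G holomorphic_on ball 0 1" using hol R by (auto intro: holomorphic_on_subset)
        then have "(G \<circ> (\<lambda>z. of_real \<rho> * z)) holomorphic_on ball 0 (1 / \<rho>)"
          using in1 by (intro holomorphic_on_compose_gen[where t = "ball 0 1"] holomorphic_intros) auto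
        then show "H holomorphic_on ball 0 (1 / \<rho>)" by (simp add: H_def[abs_def] o_def)
      qed
      then show ?case using x unfolding poisson_dominated_def H_def I_def by auto
    qed
  qed
  have at_left_lim: "(f \<longlongrightarrow> f 1) (at_left (1::real))" if "continuous_on {0..1} f" for f :: "real \<Rightarrow> real"
    using continuous_on_Icc_at_leftD[OF that] by simp
  have "2 * pi * norm (G (of_real 1 * of_real x)) powr \<sigma> \<le> I 1"
    using at_left_lim[OF contL] at_left_lim[OF contI] ev
    by (intro tendsto_le[OF trivial_limit_at_left_real]) auto
  then show "2 * pi * norm (G (of_real x)) powr \<sigma> \<le> integral {0..2 * pi} (\<lambda>t. poisson_kernel x t * norm (G (cis t)) powr \<sigma>)"
    by (simp add: I_def)
qed

section \<open>Division by Blaschke factors and subharmonicity in the presence of zeros\<close>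

lemma blaschke_factor_bound:
  fixes a z :: complex
  assumes "norm a < 1"
  shows "norm z \<le> 1 \<Longrightarrow> norm (z - a) \<le> norm (1 - cnj a * z)" "norm z = 1 \<Longrightarrow> norm (z - a) = norm (1 - cnj a * z)"
proof -
  have eq: "(norm (1 - cnj a * z))\<^sup>2 - (norm (z - a))\<^sup>2 = (1 - (norm a)\<^sup>2) * (1 - (norm z)\<^sup>2)"
    unfolding cmod_power2 by (simp add: power2_eq_square algebra_simps)
  show A: "norm (z - a) \<le> norm (1 - cnj a * z)" if z: "norm z \<le> 1"
  proof -
    have "0 \<le> (1 - (norm a)\<^sup>2) * (1 - (norm z)\<^sup>2)"
      using assms z by (intro mult_nonneg_nonneg) (auto simp: power_le_one)
    then have "(norm (z - a))\<^sup>2 \<le> (norm (1 - cnj a * z))\<^sup>2" using eq by linarith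
    then show ?thesis by (rule power2_le_imp_le) simp
  qed
  show "norm (z - a) = norm (1 - cnj a * z)" if z: "norm z = 1"
  proof -
    have "(norm (z - a))\<^sup>2 = (norm (1 - cnj a * z))\<^sup>2" using eq z by simp
    then show ?thesis by (rule power2_eq_imp_eq) simp_all
  qed
qed

text \<open>Induction on the number of distinct zeros. A zero a of order k is removed by replacing
  (z - a)^k with (1 - cnj a z)^k, that is, by dividing by a Blaschke factor: the new factor has no
  zeros in the disc, its modulus is larger inside and equal on the circle. Multiplicity goes in one
  step, so \<open>card\<close> drops by exactly one.\<close>

lemma remove_zeros_in_disc:
  assumes "finite {z \<in> ball 0 1. F z = 0}" "card {z \<in> ball 0 1. F z = 0} = n"
    and "1 < R" "F holomorphic_on ball 0 R" "\<exists>z\<in>ball 0 R. F z \<noteq> 0"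
  shows "\<exists>G. G holomorphic_on ball 0 R \<and> (\<forall>z\<in>ball 0 1. G z \<noteq> 0) \<and>
     (\<forall>z\<in>ball 0 1. norm (F z) \<le> norm (G z)) \<and> (\<forall>z\<in>sphere 0 1. norm (F z) = norm (G z))"
  using assms
proof (induction n arbitrary: F)
  case 0
  then have "\<forall>z\<in>ball 0 1. F z \<noteq> 0" by auto
  then show ?case using "0.prems" by (intro exI[of _ F]) auto
next
  case (Suc n)
  let ?Z = "{z \<in> ball 0 1. F z = 0}"
  have "?Z \<noteq> {}" using Suc.prems(2) by (metis card.empty nat.distinct(1))
  then obtain a where a: "norm a < 1" "F a = 0" by auto
  have nonconst: "\<not> F constant_on ball 0 R"
    using Suc.prems(3,5) a unfolding constant_on_def by (metis dist_0_norm mem_ball order_less_trans)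
  have aR: "a \<in> ball 0 R" using a(1) Suc.prems(3) by simp
  obtain g r k where g: "0 < k" "0 < r" "ball a r \<subseteq> ball 0 R" "g holomorphic_on ball a r"
     "\<And>w. w \<in> ball a r \<Longrightarrow> F w = (w - a)^k * g w" "\<And>w. w \<in> ball a r \<Longrightarrow> g w \<noteq> 0"
    by (rule holomorphic_factor_zero_nonconstant[OF Suc.prems(4) open_ball connected_ball aR a(2) nonconst]) (rule that)
  \<comment> \<open>The quotient F/(z - a)^k with its removable singularity filled in by the local
    factor g; holomorphy is glued from the punctured disc and the small ball around a.\<close>
  define Q where "Q z = (if z = a then g a else F z / (z - a)^k)" for z
  have FQ: "F z = (z - a)^k * Q z" for z using a(2) g(1) by (simp add: Q_def)
  have "Q holomorphic_on (ball 0 R - {a})"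
  proof -
    have "(\<lambda>z. F z / (z - a)^k) holomorphic_on (ball 0 R - {a})"
      using Suc.prems(4) by (intro holomorphic_intros) (auto intro: holomorphic_on_subset)
    then show ?thesis by (rule holomorphic_transform) (auto simp: Q_def)
  qed
  moreover have "Q holomorphic_on ball a r"
    using g(4) by (rule holomorphic_transform) (use g(5) in \<open>auto simp: Q_def\<close>)
  ultimately have "Q holomorphic_on ((ball 0 R - {a}) \<union> ball a r)"
    by (intro holomorphic_on_Un open_delete open_ball)
  moreover have "(ball 0 R - {a}) \<union> ball a r = ball 0 R" using g(2,3) by auto
  ultimately have Q: "Q holomorphic_on ball 0 R" by simp
  define E where "E z = Q z * (1 - cnj a * z)^k" for z
  have E: "E holomorphic_on ball 0 R" unfolding E_def using Q by (intro holomorphic_intros)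
  have b0: "1 - cnj a * z \<noteq> 0" if "norm z < 1" for z
  proof
    assume "1 - cnj a * z = 0"
    then have "norm (cnj a * z) = 1" by (metis eq_iff_diff_eq_0 norm_one)
    moreover have "norm (cnj a * z) \<le> norm a * 1" using that by (simp add: norm_mult mult_left_mono del: mult_1_right)
    ultimately show False using a(1) by simp
  qed
  have Qa: "Q a \<noteq> 0" using g(2,6) by (simp add: Q_def)
  have Z: "{z \<in> ball 0 1. E z = 0} = ?Z - {a}"
    using b0 Qa FQ by (auto simp: E_def)
  have "finite {z \<in> ball 0 1. E z = 0}" "card {z \<in> ball 0 1. E z = 0} = n"
    unfolding Z using Suc.prems(1,2) a by auto
  moreover have "\<exists>z\<in>ball 0 R. E z \<noteq> 0"
    using Qa b0[OF a(1)] a(1) Suc.prems(3) by (intro bexI[of _ a]) (auto simp: E_def)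
  ultimately obtain G where G: "G holomorphic_on ball 0 R" "\<forall>z\<in>ball 0 1. G z \<noteq> 0"
     "\<forall>z\<in>ball 0 1. norm (E z) \<le> norm (G z)" "\<forall>z\<in>sphere 0 1. norm (E z) = norm (G z)"
    using Suc.IH[of E] Suc.prems(3) E by blast
  have "norm (F z) \<le> norm (E z)" if "z \<in> ball 0 1" for z
    using blaschke_factor_bound(1)[OF a(1), of z] that unfolding FQ E_def norm_mult norm_power
    by (subst mult.commute) (auto intro!: mult_left_mono power_mono)
  moreover have "norm (F z) = norm (E z)" if "z \<in> sphere 0 1" for z
    using blaschke_factor_bound(2)[OF a(1), of z] that unfolding FQ E_def norm_mult norm_power by auto
  ultimately have "\<forall>z\<in>ball 0 1. norm (F z) \<le> norm (G z)" "\<forall>z\<in>sphere 0 1. norm (F z) = norm (G z)"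
    using G(3,4) order_trans by (blast, simp)
  then show ?case using G(1,2) by (intro exI[of _ G]) auto
qed

text \<open>Division by the zeros yields a zero-free majorant G with the same modulus on the circle,
  so the integral is unchanged while the left-hand side only grows. The detour makes arbitrarily
  small exponents \<sigma> possible.\<close>

lemma poisson_dominated_holomorphic:
  assumes \<sigma>: "0 < \<sigma>" and R: "1 < R" and hol: "F holomorphic_on ball 0 R"
  shows "poisson_dominated \<sigma> F"
proof (cases "F constant_on ball 0 R")
  case True
  then obtain c where c: "\<And>z. z \<in> ball 0 R \<Longrightarrow> F z = c" unfolding constant_on_def by blast
  show ?thesis
  proof (cases "c = 0")
    case True
    have "F (of_real x) = 0" if "0 \<le> x" "x < 1" for x using c[of "of_real x"] that R True by simp
    moreover have "F (cis t) = 0" for t using c[of "cis t"] R True by simp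
    ultimately show ?thesis unfolding poisson_dominated_def by simp
  next
    case False
    then show ?thesis using c by (intro poisson_dominated_nonvanishing[OF \<sigma> R hol]) auto
  qed
next
  case False
  have "finite {z \<in> cball 0 1. F z = 0}"
    using R False by (intro holomorphic_compact_finite_zeros[OF hol]) auto
  then have fin: "finite {z \<in> ball 0 1. F z = 0}" by (rule finite_subset[rotated]) auto
  have "\<exists>z\<in>ball 0 R. F z \<noteq> 0" using False unfolding constant_on_def by auto
  then obtain G where G: "G holomorphic_on ball 0 R" "\<forall>z\<in>ball 0 1. G z \<noteq> 0"
     "\<forall>z\<in>ball 0 1. norm (F z) \<le> norm (G z)" "\<forall>z\<in>sphere 0 1. norm (F z) = norm (G z)"
    using remove_zeros_in_disc[OF fin refl R hol] by blast
  have "poisson_dominated \<sigma> G" using G by (intro poisson_dominated_nonvanishing_interior[OF \<sigma> R]) auto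
  moreover have "2 * pi * norm (F (of_real x)) powr \<sigma> \<le> 2 * pi * norm (G (of_real x)) powr \<sigma>" if "0 \<le> x" "x < 1" for x :: real
    using G(3) that \<sigma> by (intro mult_left_mono powr_mono2) auto
  moreover have "norm (F (cis t)) = norm (G (cis t))" for t using G(4) by simp
  ultimately show ?thesis unfolding poisson_dominated_def
    by (simp only:) (blast intro: order_trans)
qed

theorem poisson_inequality:
  assumes \<sigma>: "0 < \<sigma>" and hol: "f holomorphic_on ball 0 1" and r: "0 < r" "r < 1" and \<rho>: "0 \<le> \<rho>" "\<rho> < r"
  shows "ennreal (norm (f (of_real \<rho> * cis \<tau>)) powr \<sigma>) \<le> ennreal (1 / (2 * pi)) *
    (\<integral>\<^sup>+t\<in>{0..2 * pi}. ennreal (poisson_kernel (\<rho> / r) t) * ennreal (norm (f (of_real r * cis (t + \<tau>))) powr \<sigma>) \<partial>lborel)"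
proof -
  define x where "x = \<rho> / r"
  have x: "0 \<le> x" "x < 1" using \<rho> r by (auto simp: x_def)
  \<comment> \<open>The rotation brings the point to the real radius, and the dilation turns the
    circle of radius r into the unit circle; F is then holomorphic on the disc of radius 1/r >
    1.\<close>
  define F where "F w = f (of_real r * cis \<tau> * w)" for w
  have in1: "of_real r * cis \<tau> * z \<in> ball 0 1" if "z \<in> ball 0 (1 / r)" for z :: complex
    using that r by (auto simp: norm_mult field_simps)
  have "(f \<circ> (\<lambda>z. of_real r * cis \<tau> * z)) holomorphic_on ball 0 (1 / r)"
    using in1 hol by (intro holomorphic_on_compose_gen[where t = "ball 0 1"] holomorphic_intros) auto
  then have F: "F holomorphic_on ball 0 (1 / r)" by (simp add: F_def[abs_def] o_def)
  have R: "1 < 1 / r" using r by simp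
  let ?g = "\<lambda>t. poisson_kernel x t * norm (F (cis t)) powr \<sigma>"
  have "poisson_dominated \<sigma> F" by (rule poisson_dominated_holomorphic[OF \<sigma> R F])
  then have le: "2 * pi * norm (F (of_real x)) powr \<sigma> \<le> integral {0..2 * pi} ?g"
    using x unfolding poisson_dominated_def by blast
  have contF: "continuous_on {0..2*pi} (\<lambda>t. F (cis t))"
    using R by (intro continuous_on_compose2[OF holomorphic_on_imp_continuous_on[OF F]] continuous_intros) auto
  have cont: "continuous_on {0..2*pi} ?g"
    using \<sigma> x contF by (intro continuous_intros continuous_on_powr') auto
  have "(?g has_integral integral {0..2 * pi} ?g) {0..2 * pi}"
    using cont by (intro integrable_integral integrable_continuous_real)
  moreover have "(\<lambda>t. indicator {0..2*pi} t * ?g t) \<in> borel_measurable borel"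
    using borel_measurable_continuous_on_indicator[OF _ cont] by (simp add: )
  ultimately have "(\<integral>\<^sup>+t\<in>{0..2 * pi}. ennreal (?g t) \<partial>lborel) = ennreal (integral {0..2 * pi} ?g)"
    using x by (intro nn_integral_has_integral_lebesgue') (auto simp: poisson_kernel_nonneg)
  moreover have "F (of_real x) = f (of_real \<rho> * cis \<tau>)"
    using r by (simp add: F_def x_def mult_ac)
  moreover have "ennreal (?g t) = ennreal (poisson_kernel (\<rho> / r) t) * ennreal (norm (f (of_real r * cis (t + \<tau>))) powr \<sigma>)" for t
    using x by (subst ennreal_mult) (auto simp: F_def x_def poisson_kernel_nonneg cis_mult[symmetric] mult_ac)
  ultimately have "(\<integral>\<^sup>+t\<in>{0..2 * pi}. ennreal (poisson_kernel (\<rho> / r) t) * ennreal (norm (f (of_real r * cis (t + \<tau>))) powr \<sigma>) \<partial>lborel)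
    = ennreal (integral {0..2 * pi} ?g)" by simp
  moreover have "ennreal (norm (f (of_real \<rho> * cis \<tau>)) powr \<sigma>) \<le> ennreal (1 / (2 * pi)) * ennreal (integral {0..2 * pi} ?g)"
  proof -
    have "norm (F (of_real x)) powr \<sigma> \<le> 1 / (2 * pi) * integral {0..2 * pi} ?g"
      using le by (simp add: field_simps)
    then have "ennreal (norm (F (of_real x)) powr \<sigma>) \<le> ennreal (1 / (2 * pi) * integral {0..2 * pi} ?g)" by (rule ennreal_leI)
    also have "\<dots> = ennreal (1 / (2 * pi)) * ennreal (integral {0..2 * pi} ?g)" by (rule ennreal_mult') simp
    finally show ?thesis using \<open>F (of_real x) = f (of_real \<rho> * cis \<tau>)\<close> by simp
  qed
  ultimately show ?thesis by simp
qed

subsection \<open>Periodic integrals\<close>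

lemma nn_integral_shift:
  fixes h :: "real \<Rightarrow> ennreal"
  assumes "h \<in> borel_measurable borel"
  shows "(\<integral>\<^sup>+t. h (t + c) \<partial>lborel) = (\<integral>\<^sup>+t. h t \<partial>lborel)"
  using nn_integral_real_affine[OF assms, of 1 c] by (simp add: add.commute)

lemma periodic_2pi_int:
  fixes h :: "real \<Rightarrow> 'a"
  assumes per: "\<And>t. h (t + 2 * pi) = h t"
  shows "h (t + 2 * pi * of_int k) = h t"
proof -
  have nat: "h (t + 2 * pi * of_nat n) = h t" for n t
  proof (induction n)
    case (Suc n)
    have "h (t + 2 * pi * of_nat (Suc n)) = h ((t + 2 * pi * of_nat n) + 2 * pi)" by (simp add: algebra_simps)
    then show ?case using per Suc by simp
  qed simp
  show ?thesis
  proof (cases "0 \<le> k")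
    case True
    then show ?thesis using nat[of t "nat k"] by simp
  next
    case False
    then show ?thesis using nat[of "t + 2 * pi * of_int k" "nat (- k)"] by (simp add: algebra_simps)
  qed
qed

lemma periodic_nn_integral_Ico:
  fixes h :: "real \<Rightarrow> ennreal"
  assumes [measurable]: "h \<in> borel_measurable borel" and per: "\<And>t. h (t + 2 * pi) = h t"
  shows "(\<integral>\<^sup>+t\<in>{c..<c + 2 * pi}. h t \<partial>lborel) = (\<integral>\<^sup>+t\<in>{0..<2 * pi}. h t \<partial>lborel)"
proof -
  have base: "(\<integral>\<^sup>+t\<in>{c..<c + 2 * pi}. h t \<partial>lborel) = (\<integral>\<^sup>+t\<in>{0..<2 * pi}. h t \<partial>lborel)"
    if c: "0 \<le> c" "c < 2 * pi" for c
  proof -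
    have "(\<integral>\<^sup>+t\<in>{2 * pi..<c + 2 * pi}. h t \<partial>lborel) = (\<integral>\<^sup>+t. h (t + 2 * pi) * indicator {2 * pi..<c + 2 * pi} (t + 2 * pi) \<partial>lborel)"
      by (intro nn_integral_shift[symmetric]) measurable
    also have "\<dots> = (\<integral>\<^sup>+t\<in>{0..<c}. h t \<partial>lborel)"
      by (intro nn_integral_cong) (auto simp: per split: split_indicator)
    finally have sh: "(\<integral>\<^sup>+t\<in>{2 * pi..<c + 2 * pi}. h t \<partial>lborel) = (\<integral>\<^sup>+t\<in>{0..<c}. h t \<partial>lborel)" .
    have "(\<integral>\<^sup>+t\<in>{c..<c + 2 * pi}. h t \<partial>lborel) =
       (\<integral>\<^sup>+t. h t * indicator {c..<2 * pi} t + h t * indicator {2 * pi..<c + 2 * pi} t \<partial>lborel)"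
      using c by (intro nn_integral_cong) (auto split: split_indicator)
    also have "\<dots> = (\<integral>\<^sup>+t\<in>{c..<2 * pi}. h t \<partial>lborel) + (\<integral>\<^sup>+t\<in>{0..<c}. h t \<partial>lborel)"
      unfolding sh[symmetric] by (intro nn_integral_add) measurable
    also have "\<dots> = (\<integral>\<^sup>+t. h t * indicator {c..<2 * pi} t + h t * indicator {0..<c} t \<partial>lborel)"
      by (intro nn_integral_add[symmetric]) measurable
    also have "\<dots> = (\<integral>\<^sup>+t\<in>{0..<2 * pi}. h t \<partial>lborel)"
      using c by (intro nn_integral_cong) (auto split: split_indicator)
    finally show ?thesis .
  qed
  define k where "k = \<lfloor>c / (2 * pi)\<rfloor>"
  define b where "b = c - 2 * pi * of_int k"
  have "of_int k \<le> c / (2 * pi)" "c / (2 * pi) < of_int k + 1" by (simp_all add: k_def)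
  then have b: "0 \<le> b" "b < 2 * pi" by (simp_all add: b_def field_simps)
  have "(\<integral>\<^sup>+t\<in>{c..<c + 2 * pi}. h t \<partial>lborel) =
    (\<integral>\<^sup>+t. h (t + 2 * pi * of_int k) * indicator {c..<c + 2 * pi} (t + 2 * pi * of_int k) \<partial>lborel)"
    by (intro nn_integral_shift[symmetric]) measurable
  also have "\<dots> = (\<integral>\<^sup>+t\<in>{b..<b + 2 * pi}. h t \<partial>lborel)"
    by (intro nn_integral_cong) (auto simp: periodic_2pi_int[of h, OF per] b_def split: split_indicator)
  finally show ?thesis using base[OF b] by simp
qed

lemma nn_integral_Icc_Ico:
  fixes h :: "real \<Rightarrow> ennreal"
  shows "(\<integral>\<^sup>+t\<in>{a..b}. h t \<partial>lborel) = (\<integral>\<^sup>+t\<in>{a..<b}. h t \<partial>lborel)"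
  using AE_lborel_singleton[of b] by (intro nn_integral_cong_AE) (auto elim!: eventually_mono split: split_indicator)

lemma periodic_nn_integral:
  fixes h :: "real \<Rightarrow> ennreal"
  assumes "h \<in> borel_measurable borel" and "\<And>t. h (t + 2 * pi) = h t"
  shows "(\<integral>\<^sup>+t\<in>{c..c + 2 * pi}. h t \<partial>lborel) = (\<integral>\<^sup>+t\<in>{0..2 * pi}. h t \<partial>lborel)"
  unfolding nn_integral_Icc_Ico by (rule periodic_nn_integral_Ico[OF assms])

subsection \<open>Pointwise domination by the maximal function\<close>

text \<open>Up to pi/3 the derivative cos u - 1/2 of the difference is nonnegative; beyond, sin u is
  at least sin(pi/3) = sqrt 3 / 2, which exceeds pi/4 >= u/2.\<close>

lemma half_le_sin:
  assumes "0 \<le> u" "u \<le> pi / 2" shows "u / 2 \<le> sin u"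
proof (cases "u \<le> pi / 3")
  case True
  have "(\<lambda>u. sin u - u / 2) 0 \<le> (\<lambda>u. sin u - u / 2) u"
  proof (rule DERIV_nonneg_imp_nondecreasing[OF assms(1)])
    fix v assume v: "0 \<le> v" "v \<le> u"
    have "cos (pi / 3) \<le> cos v" using v True by (intro cos_monotone_0_pi_le) auto
    then have "0 \<le> cos v - 1 / 2" by (simp add: cos_60)
    moreover have "((\<lambda>u. sin u - u / 2) has_real_derivative (cos v - 1 / 2)) (at v)"
      by (auto intro!: derivative_eq_intros)
    ultimately show "\<exists>y. ((\<lambda>u. sin u - u / 2) has_real_derivative y) (at v) \<and> 0 \<le> y" by blast
  qed
  then show ?thesis by simp
next
  case False
  have "u / 2 \<le> pi / 4" using assms by simp
  also have "\<dots> \<le> sqrt 3 / 2"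
  proof -
    have "pi / 2 \<le> 1.6" using pi_less_4 pi_approx by simp
    moreover have "1.6 \<le> sqrt 3" by (rule real_le_rsqrt) (simp add: power2_eq_square)
    ultimately show ?thesis by linarith
  qed
  also have "sqrt 3 / 2 = sin (pi / 3)" by (simp add: sin_60)
  also have "\<dots> \<le> sin u" using assms False by (intro sin_monotone_2pi_le) auto
  finally show ?thesis .
qed

lemma one_minus_cos_ge:
  assumes "\<bar>t\<bar> \<le> pi" shows "t\<^sup>2 / 8 \<le> 1 - cos t"
proof -
  define u where "u = \<bar>t\<bar> / 2"
  have u: "0 \<le> u" "u \<le> pi / 2" using assms by (simp_all add: u_def)
  have "1 - cos t = 1 - cos (2 * u)" by (simp add: u_def)
  also have "\<dots> = 2 * (sin u)\<^sup>2" by (simp add: cos_double_sin)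
  also have "\<dots> \<ge> 2 * (u / 2)\<^sup>2" using half_le_sin[OF u] u by (intro mult_left_mono power_mono) auto
  finally show ?thesis by (simp add: u_def power_divide)
qed

text \<open>With d = 1 - x the numerator is at most 2d and the denominator is d^2 + 2x(1 - cos t).
  The latter is at least t^2/40: for x >= 1/2 by the cosine term, for x < 1/2 because d^2 >= 1/4 and
  pi^2 < 10. Hence the constant 80.\<close>

lemma poisson_kernel_le:
  assumes x: "0 \<le> x" "x < 1"
  shows "poisson_kernel x t \<le> 2 / (1 - x)" "\<bar>t\<bar> \<le> pi \<Longrightarrow> t \<noteq> 0 \<Longrightarrow> poisson_kernel x t \<le> 80 * (1 - x) / t\<^sup>2"
proof -
  define d where "d = 1 - x"
  define m where "m = 1 - 2 * x * cos t + x\<^sup>2"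
  have d: "0 < d" "d \<le> 1" using x by (auto simp: d_def)
  have m: "m = d\<^sup>2 + 2 * x * (1 - cos t)" by (simp add: m_def d_def power2_eq_square algebra_simps)
  have mpos: "0 < m" unfolding m_def by (rule poisson_denominator_pos[OF x])
  have num: "1 - x\<^sup>2 \<le> 2 * d"
  proof -
    have "1 - x\<^sup>2 = d * (1 + x)" by (simp add: d_def power2_eq_square algebra_simps)
    also have "\<dots> \<le> d * 2" using x d by (intro mult_left_mono) auto
    finally show ?thesis by simp
  qed
  have k: "poisson_kernel x t \<le> 2 * d / m"
    unfolding poisson_kernel_def m_def[symmetric] using num mpos by (intro divide_right_mono) auto
  have md: "d\<^sup>2 \<le> m" using m x cos_le_one[of t] by simp
  have "2 * d / m \<le> 2 * d / d\<^sup>2" using d md by (intro divide_left_mono mult_pos_pos mpos) auto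
  also have "\<dots> = 2 / d" using d by (simp add: power2_eq_square)
  finally show "poisson_kernel x t \<le> 2 / (1 - x)" using k by (simp add: d_def)
  show "poisson_kernel x t \<le> 80 * (1 - x) / t\<^sup>2" if t: "\<bar>t\<bar> \<le> pi" "t \<noteq> 0"
  proof -
    have "t\<^sup>2 / 40 \<le> m"
    proof (cases "x \<ge> 1 / 2")
      case True
      have "t\<^sup>2 / 40 \<le> t\<^sup>2 / 8" by simp
      also have "\<dots> \<le> 1 * (1 - cos t)" using one_minus_cos_ge[OF t(1)] by simp
      also have "\<dots> \<le> 2 * x * (1 - cos t)" using True by (intro mult_right_mono) auto
      also have "\<dots> \<le> m" using m by simp
      finally show ?thesis .
    next
      case False
      have "t\<^sup>2 = \<bar>t\<bar>\<^sup>2" by simp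
      also have "\<dots> \<le> pi\<^sup>2" using t by (intro power_mono) auto
      also have "\<dots> \<le> (3.15)\<^sup>2" using pi_approx by (intro power_mono) auto
      finally have "t\<^sup>2 / 40 \<le> 1 / 4" by (simp add: power2_eq_square)
      also have "\<dots> = (1 / 2)\<^sup>2" by (simp add: power2_eq_square)
      also have "\<dots> \<le> d\<^sup>2" using False by (intro power_mono) (auto simp: d_def)
      finally show ?thesis using md by simp
    qed
    then have "2 * d / m \<le> 2 * d / (t\<^sup>2 / 40)" using d t by (intro divide_left_mono mult_pos_pos mpos) auto
    then show ?thesis using k by (simp add: d_def)
  qed
qed

text \<open>At the least j with |t| <= 2^j \<delta> the decay 80 \<delta>/t^2 is used with |t| >
  2^(j-1) \<delta>, which gives 320 = 80 * 4. Height 4^(-j) against length 2^j leaves the summable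
  2^(-j) when the majorant is integrated.\<close>

lemma poisson_kernel_dyadic:
  assumes \<delta>: "0 < \<delta>" and x: "0 \<le> x" "\<delta> / 2 \<le> 1 - x" "1 - x \<le> \<delta>" and t: "\<bar>t\<bar> \<le> pi"
  shows "ennreal (poisson_kernel x t) \<le> (\<Sum>j. ennreal (320 * (1/4) ^ j / \<delta>) * indicator {t. \<bar>t\<bar> \<le> 2 ^ j * \<delta>} t)"
proof -
  have x1: "x < 1" using \<delta> x by linarith
  have "\<exists>j. \<bar>t\<bar> \<le> 2 ^ j * \<delta> \<and> poisson_kernel x t \<le> 320 * (1/4) ^ j / \<delta>"
  proof (cases "\<bar>t\<bar> \<le> \<delta>")
    case True
    have "poisson_kernel x t \<le> 2 / (1 - x)" by (rule poisson_kernel_le[OF x(1) x1])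
    also have "\<dots> \<le> 2 / (\<delta> / 2)" using \<delta> x x1 by (intro divide_left_mono) auto
    also have "\<dots> \<le> 320 / \<delta>" using \<delta> by (simp add: field_simps)
    finally show ?thesis using True by (intro exI[of _ 0]) auto
  next
    case False
    have ex: "\<exists>j::nat. \<bar>t\<bar> \<le> 2 ^ j * \<delta>"
    proof -
      obtain j :: nat where "\<bar>t\<bar> / \<delta> < 2 ^ j" using real_arch_pow[of 2 "\<bar>t\<bar> / \<delta>"] by auto
      then show ?thesis using \<delta> by (intro exI[of _ j]) (simp add: field_simps)
    qed
    define j where "j = (LEAST j::nat. \<bar>t\<bar> \<le> 2 ^ j * \<delta>)"
    have j: "\<bar>t\<bar> \<le> 2 ^ j * \<delta>" unfolding j_def using ex by (rule LeastI_ex)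
    have "j \<noteq> 0" using j False by (cases j) auto
    then obtain i where i: "j = Suc i" by (cases j) auto
    have "\<not> \<bar>t\<bar> \<le> 2 ^ i * \<delta>" using not_less_Least[of i "\<lambda>j. \<bar>t\<bar> \<le> 2 ^ j * \<delta>"] i j_def by simp
    then have ti: "2 ^ i * \<delta> < \<bar>t\<bar>" by simp
    then have t0: "t \<noteq> 0" using \<delta> by (metis abs_zero less_asym mult_pos_pos zero_less_numeral zero_less_power)
    have "(2 ^ i * \<delta>)\<^sup>2 \<le> \<bar>t\<bar>\<^sup>2" using ti \<delta> by (intro power_mono) auto
    then have sq: "(2 ^ i * \<delta>)\<^sup>2 \<le> t\<^sup>2" by simp
    have "poisson_kernel x t \<le> 80 * (1 - x) / t\<^sup>2" by (rule poisson_kernel_le(2)[OF x(1) x1 t t0])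
    also have "\<dots> \<le> 80 * \<delta> / t\<^sup>2" using x by (intro divide_right_mono) auto
    also have "\<dots> \<le> 80 * \<delta> / (2 ^ i * \<delta>)\<^sup>2" using sq \<delta> t0 by (intro divide_left_mono mult_pos_pos) auto
    also have "\<dots> = 320 * (1/4) ^ j / \<delta>"
    proof -
      have "(2::real) ^ i * 2 ^ i = 4 ^ i" by (simp flip: power_mult_distrib)
      then have "(2 ^ i * \<delta>)\<^sup>2 = 4 ^ i * \<delta> * \<delta>" by (simp add: power2_eq_square mult_ac)
      then show ?thesis using \<delta> by (simp add: i power_divide)
    qed
    finally show ?thesis using j by blast
  qed
  then obtain j where j: "\<bar>t\<bar> \<le> 2 ^ j * \<delta>" "poisson_kernel x t \<le> 320 * (1/4) ^ j / \<delta>" by blast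
  have "ennreal (poisson_kernel x t) \<le> (\<Sum>i\<in>{j}. ennreal (320 * (1/4) ^ i / \<delta>) * indicator {t. \<bar>t\<bar> \<le> 2 ^ i * \<delta>} t)"
    using j by (auto intro: ennreal_leI)
  also have "\<dots> \<le> (\<Sum>j. ennreal (320 * (1/4) ^ j / \<delta>) * indicator {t. \<bar>t\<bar> \<le> 2 ^ j * \<delta>} t)"
    by (rule sum_le_suminf) auto
  finally show ?thesis .
qed

lemma holomorphic_circle_measurable:
  assumes hol: "f holomorphic_on ball 0 1" and r: "0 \<le> r" "r < 1"
  shows "(\<lambda>t. f (of_real r * cis t)) \<in> borel_measurable borel"
proof -
  have "continuous_on UNIV (\<lambda>t. f (of_real r * cis t))"
    using r by (intro continuous_on_compose2[OF holomorphic_on_imp_continuous_on[OF hol]] continuous_intros) (auto simp: norm_mult)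
  then show ?thesis by (rule borel_measurable_continuous_onI)
qed

lemma cis_periodic: "cis (t + 2 * pi) = cis t"
  by (simp add: cis_mult[symmetric])

text \<open>
  The window \<open>{-5..11}\<close> contains all points at distance at most \<open>pi + 1\<close> from \<open>{0..2 * pi}\<close>, which is
  where the Poisson integral over one period centred at \<open>\<tau>\<close> lives; \<open>{- 2 * pi..4 * pi}\<close> below contains
  all points at distance at most \<open>1\<close> from the window.
\<close>
lemma power_bound_by_hl_max:
  assumes \<sigma>: "0 < \<sigma>" and hol: "f holomorphic_on ball 0 1" and r: "0 < r" "r < 1"
    and \<rho>: "0 \<le> \<rho>" "\<rho> \<le> max 0 (2 * r - 1)" and \<theta>: "\<theta> \<in> {0..2 * pi}" and \<tau>: "\<bar>\<tau> - \<theta>\<bar> \<le> 1 - \<rho>"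
    and G: "\<And>x. 1 - r \<le> x \<Longrightarrow>
      (\<integral>\<^sup>+t\<in>{t. \<bar>t - \<theta>\<bar> \<le> x}. ennreal (norm (f (of_real r * cis t)) powr \<sigma>) * indicator {-5..11} t \<partial>lborel)
      \<le> 2 * (\<integral>\<^sup>+t\<in>{t. \<bar>t - \<theta>\<bar> \<le> 2 * x}. G t \<partial>lborel)"
  shows "ennreal (norm (f (of_real \<rho> * cis \<tau>)) powr \<sigma>) \<le> ennreal 20480 * hl_max G \<theta>"
proof -
  define \<delta> where "\<delta> = 1 - \<rho>"
  define x where "x = \<rho> / r"
  define F where "F t = ennreal (norm (f (of_real r * cis t)) powr \<sigma>)" for t
  have F[measurable]: "F \<in> borel_measurable borel"
  proof -
    have [measurable]: "(\<lambda>t. f (of_real r * cis t)) \<in> borel_measurable borel"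
      using holomorphic_circle_measurable[OF hol] r by simp
    show ?thesis unfolding F_def by measurable
  qed
  have Fper: "F (t + 2 * pi) = F t" for t by (simp add: F_def cis_periodic)
  have \<rho>r: "\<rho> < r" using \<rho> r by auto
  have \<delta>: "0 < \<delta>" "\<delta> \<le> 1" "1 - r \<le> \<delta>" using \<rho> \<rho>r r by (auto simp: \<delta>_def)
  have x: "0 \<le> x" "x < 1" using \<rho> \<rho>r r by (auto simp: x_def)
  \<comment> \<open>The only use of \<rho> <= 2r - 1: it makes 1 - \<rho>/r comparable with \<delta>
    = 1 - \<rho>, the scale at which the kernel is cut up.\<close>
  have xd: "\<delta> / 2 \<le> 1 - x" "1 - x \<le> \<delta>"
  proof -
    have "\<rho> * r \<le> \<rho> * 1" using \<rho> r by (intro mult_left_mono) auto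
    then show "1 - x \<le> \<delta>" using r by (simp add: x_def \<delta>_def field_simps)
    show "\<delta> / 2 \<le> 1 - x"
    proof (cases "\<rho> = 0")
      case False
      then have "\<rho> \<le> 2 * r - 1" using \<rho> by auto
      then have "\<delta> / 2 \<le> r - \<rho>" by (simp add: \<delta>_def)
      also have "\<dots> \<le> (r - \<rho>) / r"
        using r \<rho>r mult_left_mono[of r 1 "r - \<rho>"] by (simp add: pos_le_divide_eq)
      also have "\<dots> = 1 - x" using r by (simp add: x_def field_simps)
      finally show ?thesis .
    qed (simp add: x_def \<delta>_def)
  qed
  have pk[measurable]: "poisson_kernel x \<in> borel_measurable borel"
    unfolding poisson_kernel_def by measurable
  have pkper: "poisson_kernel x (t + 2 * pi) = poisson_kernel x t" for t by (simp add: poisson_kernel_def)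
  \<comment> \<open>Recentring from \<tau> to \<theta> doubles the radius, as |\<tau> - \<theta>| <=
    \<delta>; hypothesis \<open>G\<close> doubles it again and adds a factor 2, and
    \<open>integral_le_hl_max\<close> contributes 4. Together this is 32.\<close>
  have annulus: "(\<integral>\<^sup>+t. F (t + \<tau>) * (indicator {t. \<bar>t\<bar> \<le> 2 ^ j * \<delta>} t * indicator {- pi..pi} t) \<partial>lborel)
     \<le> ennreal (2 ^ j * 32 * \<delta>) * hl_max G \<theta>" for j :: nat
  proof -
    have "(\<integral>\<^sup>+t. F (t + \<tau>) * (indicator {t. \<bar>t\<bar> \<le> 2 ^ j * \<delta>} t * indicator {- pi..pi} t) \<partial>lborel)
      = (\<integral>\<^sup>+t. F (t + \<tau>) * (indicator {t. \<bar>t - \<tau>\<bar> \<le> 2 ^ j * \<delta>} (t + \<tau>) * indicator {\<tau> - pi..\<tau> + pi} (t + \<tau>)) \<partial>lborel)"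
      by (intro nn_integral_cong) (auto split: split_indicator)
    also have "\<dots> = (\<integral>\<^sup>+t. F t * (indicator {t. \<bar>t - \<tau>\<bar> \<le> 2 ^ j * \<delta>} t * indicator {\<tau> - pi..\<tau> + pi} t) \<partial>lborel)"
      by (rule nn_integral_shift) measurable
    also have "\<dots> \<le> (\<integral>\<^sup>+t\<in>{t. \<bar>t - \<theta>\<bar> \<le> 2 ^ j * 2 * \<delta>}. F t * indicator {-5..11} t \<partial>lborel)"
    proof (rule nn_integral_mono)
      fix t
      have 1: "t \<in> {-5..11}" if "t \<in> {\<tau> - pi..\<tau> + pi}"
        using that \<tau> \<theta> \<rho> pi_approx by auto
      have "\<delta> \<le> 2 ^ j * \<delta>" using \<delta> by simp
      then have 2: "\<bar>t - \<theta>\<bar> \<le> 2 ^ j * 2 * \<delta>" if "\<bar>t - \<tau>\<bar> \<le> 2 ^ j * \<delta>"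
        using that \<tau> unfolding \<delta>_def[symmetric] by linarith
      show "F t * (indicator {t. \<bar>t - \<tau>\<bar> \<le> 2 ^ j * \<delta>} t * indicator {\<tau> - pi..\<tau> + pi} t)
        \<le> F t * indicator {-5..11} t * indicator {t. \<bar>t - \<theta>\<bar> \<le> 2 ^ j * 2 * \<delta>} t"
        using 1 2 by (auto split: split_indicator)
    qed
    also have "\<dots> \<le> 2 * (\<integral>\<^sup>+t\<in>{t. \<bar>t - \<theta>\<bar> \<le> 2 * (2 ^ j * 2 * \<delta>)}. G t \<partial>lborel)"
      unfolding F_def
    proof (rule G)
      have "1 * \<delta> \<le> (2 ^ j * 2) * \<delta>" using \<delta> by (intro mult_right_mono) (auto intro: order_trans[OF _ mult_mono[of 1 _ 1 2]])
      then show "1 - r \<le> 2 ^ j * 2 * \<delta>" using \<delta> by linarith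
    qed
    also have "\<dots> \<le> 2 * (ennreal (4 * (2 * (2 ^ j * 2 * \<delta>))) * hl_max G \<theta>)"
      using \<delta> by (intro mult_left_mono integral_le_hl_max) auto
    also have "\<dots> = ennreal (2 ^ j * 32 * \<delta>) * hl_max G \<theta>"
    proof -
      have "2 * ennreal (4 * (2 * (2 ^ j * 2 * \<delta>))) = ennreal (2 * (4 * (2 * (2 ^ j * 2 * \<delta>))))"
        using \<delta> by (subst ennreal_mult[of 2]) auto
      also have "2 * (4 * (2 * (2 ^ j * 2 * \<delta>))) = 2 ^ j * 32 * \<delta>" by simp
      finally show ?thesis by (simp add: mult.assoc[symmetric])
    qed
    finally show ?thesis .
  qed
  have "ennreal (norm (f (of_real \<rho> * cis \<tau>)) powr \<sigma>) \<le> ennreal (1 / (2 * pi)) *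
    (\<integral>\<^sup>+t\<in>{0..2 * pi}. ennreal (poisson_kernel x t) * F (t + \<tau>) \<partial>lborel)"
    using poisson_inequality[OF \<sigma> hol r \<rho>(1) \<rho>r, of \<tau>] by (simp add: x_def F_def)
  also have "\<dots> \<le> 1 * (\<integral>\<^sup>+t\<in>{0..2 * pi}. ennreal (poisson_kernel x t) * F (t + \<tau>) \<partial>lborel)"
    using pi_gt3 by (intro mult_right_mono) (auto intro!: ennreal_le_1[THEN iffD2])
  also have "1 * (\<integral>\<^sup>+t\<in>{0..2 * pi}. ennreal (poisson_kernel x t) * F (t + \<tau>) \<partial>lborel)
    = (\<integral>\<^sup>+t\<in>{- pi..- pi + 2 * pi}. ennreal (poisson_kernel x t) * F (t + \<tau>) \<partial>lborel)"
    unfolding mult_1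
  proof (rule periodic_nn_integral[symmetric])
    show "(\<lambda>t. ennreal (poisson_kernel x t) * F (t + \<tau>)) \<in> borel_measurable borel" by measurable
    show "ennreal (poisson_kernel x (t + 2 * pi)) * F (t + 2 * pi + \<tau>) = ennreal (poisson_kernel x t) * F (t + \<tau>)" for t
      using Fper[of "t + \<tau>"] pkper[of t] by (simp add: ac_simps)
  qed
  also have "\<dots> \<le> (\<integral>\<^sup>+t. (\<Sum>j. ennreal (320 * (1/4) ^ j / \<delta>) * (F (t + \<tau>) * (indicator {t. \<bar>t\<bar> \<le> 2 ^ j * \<delta>} t * indicator {- pi..pi} t))) \<partial>lborel)"
  proof (rule nn_integral_mono)
    fix t
    show "ennreal (poisson_kernel x t) * F (t + \<tau>) * indicator {- pi..- pi + 2 * pi} t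
      \<le> (\<Sum>j. ennreal (320 * (1/4) ^ j / \<delta>) * (F (t + \<tau>) * (indicator {t. \<bar>t\<bar> \<le> 2 ^ j * \<delta>} t * indicator {- pi..pi} t)))"
    proof (cases "t \<in> {- pi..pi}")
      case True
      then have "ennreal (poisson_kernel x t) \<le> (\<Sum>j. ennreal (320 * (1/4) ^ j / \<delta>) * indicator {t. \<bar>t\<bar> \<le> 2 ^ j * \<delta>} t)"
        by (intro poisson_kernel_dyadic \<delta> x xd) auto
      then have "ennreal (poisson_kernel x t) * F (t + \<tau>) \<le> (\<Sum>j. ennreal (320 * (1/4) ^ j / \<delta>) * indicator {t. \<bar>t\<bar> \<le> 2 ^ j * \<delta>} t) * F (t + \<tau>)"
        by (intro mult_right_mono) auto
      also have "\<dots> = (\<Sum>j. ennreal (320 * (1/4) ^ j / \<delta>) * indicator {t. \<bar>t\<bar> \<le> 2 ^ j * \<delta>} t * F (t + \<tau>))"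
        by simp
      finally show ?thesis using True by (simp add: mult_ac)
    qed auto
  qed
  also have "\<dots> = (\<Sum>j. ennreal (320 * (1/4) ^ j / \<delta>) * (\<integral>\<^sup>+t. F (t + \<tau>) * (indicator {t. \<bar>t\<bar> \<le> 2 ^ j * \<delta>} t * indicator {- pi..pi} t) \<partial>lborel))"
    by (subst nn_integral_suminf) (auto simp: nn_integral_cmult)
  \<comment> \<open>Here 10240 = 320 * 32, and (1/4)^j 2^j = (1/2)^j sums to 2, which gives
    20480.\<close>
  also have "\<dots> \<le> (\<Sum>j. ennreal (10240 * (1/2) ^ j) * hl_max G \<theta>)"
  proof (intro suminf_le)
    fix j
    have "ennreal (320 * (1/4) ^ j / \<delta>) * (\<integral>\<^sup>+t. F (t + \<tau>) * (indicator {t. \<bar>t\<bar> \<le> 2 ^ j * \<delta>} t * indicator {- pi..pi} t) \<partial>lborel)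
      \<le> ennreal (320 * (1/4) ^ j / \<delta>) * (ennreal (2 ^ j * 32 * \<delta>) * hl_max G \<theta>)"
      by (intro mult_left_mono annulus) auto
    also have "\<dots> = ennreal (10240 * (1/2) ^ j) * hl_max G \<theta>"
    proof -
      have "320 * (1/4) ^ j / \<delta> * (2 ^ j * 32 * \<delta>) = 10240 * ((1/4) ^ j * 2 ^ j)" using \<delta> by simp
      also have "(1/4) ^ j * 2 ^ j = (1/2 :: real) ^ j" by (simp flip: power_mult_distrib)
      finally have "320 * (1/4) ^ j / \<delta> * (2 ^ j * 32 * \<delta>) = 10240 * (1/2) ^ j" .
      then show ?thesis using \<delta> by (simp add: mult.assoc[symmetric] ennreal_mult[symmetric])
    qed
    finally show "ennreal (320 * (1/4) ^ j / \<delta>) * (\<integral>\<^sup>+t. F (t + \<tau>) * (indicator {t. \<bar>t\<bar> \<le> 2 ^ j * \<delta>} t * indicator {- pi..pi} t) \<partial>lborel)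
      \<le> ennreal (10240 * (1/2) ^ j) * hl_max G \<theta>" .
  qed auto
  also have "\<dots> = (\<Sum>j. ennreal (10240 * (1/2) ^ j)) * hl_max G \<theta>" by simp
  also have "(\<Sum>j. ennreal (10240 * (1/2) ^ j)) = ennreal 20480"
  proof (rule suminf_ennreal_eq)
    have "(\<lambda>j. 10240 * (1/2 :: real) ^ j) sums (10240 * (1 / (1 - 1/2)))"
      by (intro sums_mult geometric_sums) auto
    then show "(\<lambda>j. 10240 * (1/2 :: real) ^ j) sums 20480" by simp
  qed auto
  finally show ?thesis .
qed

text \<open>Jensen's inequality for the concave power s, up to a factor 2. If m is the mean of g,
  Young's inequality gives g^s m^(1-s) <= g + m, whose mean is 2m; division by m^(1-s) is legitimate
  unless m is 0 or infinite, and these cases are immediate.\<close>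

lemma average_powr_le:
  fixes g :: "real \<Rightarrow> ennreal"
  assumes [measurable]: "g \<in> borel_measurable borel" and s: "0 < s" "s < 1" and \<eta>: "0 < \<eta>"
  shows "ennreal (1 / (2 * \<eta>)) * (\<integral>\<^sup>+t'\<in>{t'. \<bar>t' - t\<bar> < \<eta>}. ennreal_powr (g t') s \<partial>lborel)
    \<le> 2 * ennreal_powr (ennreal (1 / (2 * \<eta>)) * (\<integral>\<^sup>+t'\<in>{t'. \<bar>t' - t\<bar> < \<eta>}. g t' \<partial>lborel)) s"
proof -
  let ?i = "indicator {t'. \<bar>t' - t\<bar> < \<eta>} :: real \<Rightarrow> ennreal"
  let ?c = "ennreal (1 / (2 * \<eta>))"
  define m where "m = ?c * (\<integral>\<^sup>+t'. g t' * ?i t' \<partial>lborel)"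
  have vol: "?c * (\<integral>\<^sup>+t'. m * ?i t' \<partial>lborel) = m"
  proof -
    have "{t'. \<bar>t' - t\<bar> < \<eta>} = {t - \<eta><..<t + \<eta>}" by auto
    then have "(\<integral>\<^sup>+t'. m * ?i t' \<partial>lborel) = m * ennreal (2 * \<eta>)" using \<eta> by (simp add: nn_integral_cmult)
    then have "?c * (\<integral>\<^sup>+t'. m * ?i t' \<partial>lborel) = (?c * ennreal (2 * \<eta>)) * m" by (simp add: mult_ac)
    also have "?c * ennreal (2 * \<eta>) = 1" using \<eta> by (subst ennreal_mult[symmetric]) auto
    finally show ?thesis by simp
  qed
  consider "m = 0" | "m = top" | "m \<noteq> 0" "m \<noteq> top" by blast
  then show ?thesis
  proof cases
    case 1
    then have "(\<integral>\<^sup>+t'. g t' * ?i t' \<partial>lborel) = 0" using \<eta> by (auto simp: m_def)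
    then have "AE t' in lborel. g t' * ?i t' = 0" by (subst (asm) nn_integral_0_iff_AE) auto
    then have "AE t' in lborel. ennreal_powr (g t') s * ?i t' = 0" by (elim eventually_mono) auto
    then have "(\<integral>\<^sup>+t'. ennreal_powr (g t') s * ?i t' \<partial>lborel) = 0" by (subst nn_integral_0_iff_AE) auto
    then show ?thesis by simp
  next
    case 2
    then show ?thesis unfolding m_def[symmetric] by (simp add: ennreal_mult_top)
  next
    case 3
    define w where "w = ennreal_powr m (1 - s)"
    have w: "w \<noteq> 0" "w \<noteq> top" using 3 ennreal_powr_less_top_iff[of m "1 - s"]
      by (auto simp: w_def ennreal_powr_eq_0_iff less_top[symmetric])
    have "?c * (\<integral>\<^sup>+t'. ennreal_powr (g t') s * ?i t' \<partial>lborel) * w = ?c * (\<integral>\<^sup>+t'. ennreal_powr (g t') s * w * ?i t' \<partial>lborel)"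
      unfolding mult.assoc by (subst nn_integral_multc[symmetric]) (auto intro!: arg_cong2[where f="(*)"] nn_integral_cong simp: mult_ac)
    also have "\<dots> \<le> ?c * (\<integral>\<^sup>+t'. g t' * ?i t' + m * ?i t' \<partial>lborel)"
      unfolding w_def using ennreal_powr_Young[OF s]
      by (intro mult_left_mono nn_integral_mono) (auto split: split_indicator)
    also have "\<dots> = ?c * (\<integral>\<^sup>+t'. g t' * ?i t' \<partial>lborel) + ?c * (\<integral>\<^sup>+t'. m * ?i t' \<partial>lborel)"
      by (simp add: nn_integral_add distrib_left)
    also have "\<dots> = 2 * m" unfolding vol m_def[symmetric] by (simp add: mult_2)
    also have "\<dots> = 2 * ennreal_powr m s * w"
      using ennreal_powr_add[of s "1 - s" m] s by (simp add: w_def mult.assoc)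
    finally have "?c * (\<integral>\<^sup>+t'. ennreal_powr (g t') s * ?i t' \<partial>lborel) * w / w \<le> 2 * ennreal_powr m s * w / w"
      by (rule divide_right_mono_ennreal)
    then show ?thesis using w by (simp add: mult_divide_eq_ennreal m_def)
  qed
qed

text \<open>The value of F at t' is spread uniformly over |t - t'| < \<eta>, and Fubini turns the
  spreading into averages. Since \<eta> <= x the radius grows at most to 2x, and since \<eta> <= 1
  the points stay in the larger window.\<close>

lemma integral_le_integral_of_averages:
  fixes F :: "real \<Rightarrow> ennreal"
  assumes [measurable]: "F \<in> borel_measurable borel" and \<eta>: "0 < \<eta>" "\<eta> \<le> 1" "\<eta> \<le> x"
  shows "(\<integral>\<^sup>+t\<in>{t. \<bar>t - \<theta>\<bar> \<le> x}. F t * indicator {-5..11} t \<partial>lborel)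
    \<le> (\<integral>\<^sup>+t\<in>{t. \<bar>t - \<theta>\<bar> \<le> 2 * x}. ennreal (1 / (2 * \<eta>)) * (\<integral>\<^sup>+t'\<in>{t'. \<bar>t' - t\<bar> < \<eta>}. F t' \<partial>lborel)
          * indicator {- 2 * pi..4 * pi} t \<partial>lborel)"
proof -
  let ?c = "ennreal (1 / (2 * \<eta>))"
  have vol: "(\<integral>\<^sup>+t\<in>{t. \<bar>t' - t\<bar> < \<eta>}. ?c \<partial>lborel) = 1" for t'
  proof -
    have "{t. \<bar>t' - t\<bar> < \<eta>} = {t' - \<eta><..<t' + \<eta>}" by auto
    then have "(\<integral>\<^sup>+t\<in>{t. \<bar>t' - t\<bar> < \<eta>}. ?c \<partial>lborel) = ?c * ennreal (2 * \<eta>)" using \<eta> by (simp add: nn_integral_cmult)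
    also have "\<dots> = 1" using \<eta> by (subst ennreal_mult[symmetric]) auto
    finally show ?thesis .
  qed
  have [measurable]: "(\<lambda>(t', t). indicator {t. \<bar>t' - t\<bar> < \<eta>} t :: ennreal) \<in> borel_measurable (borel \<Otimes>\<^sub>M borel)"
    unfolding indicator_def by measurable
  have "(\<integral>\<^sup>+t'\<in>{t. \<bar>t - \<theta>\<bar> \<le> x}. F t' * indicator {-5..11} t' \<partial>lborel)
    = (\<integral>\<^sup>+t'. (\<integral>\<^sup>+t. F t' * indicator {-5..11} t' * indicator {t. \<bar>t - \<theta>\<bar> \<le> x} t' * (?c * indicator {t. \<bar>t' - t\<bar> < \<eta>} t) \<partial>lborel) \<partial>lborel)"
    by (subst nn_integral_cmult) (auto simp only: vol mult_1_right, measurable)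
  also have "\<dots> \<le> (\<integral>\<^sup>+t'. (\<integral>\<^sup>+t. ?c * (F t' * indicator {t'. \<bar>t' - t\<bar> < \<eta>} t' * indicator {- 2 * pi..4 * pi} t * indicator {t. \<bar>t - \<theta>\<bar> \<le> 2 * x} t) \<partial>lborel) \<partial>lborel)"
  proof (intro nn_integral_mono)
    fix t' t
    have "t \<in> {- 2 * pi..4 * pi}" if "t' \<in> {-5..11}" "\<bar>t' - t\<bar> < \<eta>"
    proof -
      have "\<bar>t' - t\<bar> < 1" using that(2) \<eta> by linarith
      then show ?thesis using that(1) pi_approx by auto
    qed
    moreover have "\<bar>t - \<theta>\<bar> \<le> 2 * x" if "\<bar>t' - \<theta>\<bar> \<le> x" "\<bar>t' - t\<bar> < \<eta>" using that \<eta> by linarith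
    ultimately show "F t' * indicator {-5..11} t' * indicator {t. \<bar>t - \<theta>\<bar> \<le> x} t' * (?c * indicator {t. \<bar>t' - t\<bar> < \<eta>} t)
      \<le> ?c * (F t' * indicator {t'. \<bar>t' - t\<bar> < \<eta>} t' * indicator {- 2 * pi..4 * pi} t * indicator {t. \<bar>t - \<theta>\<bar> \<le> 2 * x} t)"
      by (auto simp: mult_ac split: split_indicator)
  qed
  also have "\<dots> = (\<integral>\<^sup>+t. (\<integral>\<^sup>+t'. ?c * (F t' * indicator {t'. \<bar>t' - t\<bar> < \<eta>} t' * indicator {- 2 * pi..4 * pi} t * indicator {t. \<bar>t - \<theta>\<bar> \<le> 2 * x} t) \<partial>lborel) \<partial>lborel)"
  proof (rule lborel_pair.Fubini')
    have [measurable]: "(\<lambda>(t', t). indicator {t'. \<bar>t' - t\<bar> < \<eta>} t' :: ennreal) \<in> borel_measurable (borel \<Otimes>\<^sub>M borel)"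
      unfolding indicator_def by measurable
    show "(\<lambda>(t, t'). ?c * (F t' * indicator {t'. \<bar>t' - t\<bar> < \<eta>} t' * indicator {- 2 * pi..4 * pi} t * indicator {t. \<bar>t - \<theta>\<bar> \<le> 2 * x} t)) \<in> borel_measurable (lborel \<Otimes>\<^sub>M lborel)"
      unfolding indicator_def by measurable
  qed
  also have "\<dots> = (\<integral>\<^sup>+t\<in>{t. \<bar>t - \<theta>\<bar> \<le> 2 * x}. ennreal (1 / (2 * \<eta>)) * (\<integral>\<^sup>+t'\<in>{t'. \<bar>t' - t\<bar> < \<eta>}. F t' \<partial>lborel)
          * indicator {- 2 * pi..4 * pi} t \<partial>lborel)"
  proof (rule nn_integral_cong)
    fix t
    have "(\<lambda>t'. ?c * (F t' * indicator {t'. \<bar>t' - t\<bar> < \<eta>} t' * indicator {- 2 * pi..4 * pi} t * indicator {t. \<bar>t - \<theta>\<bar> \<le> 2 * x} t))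
      = (\<lambda>t'. (?c * indicator {- 2 * pi..4 * pi} t * indicator {t. \<bar>t - \<theta>\<bar> \<le> 2 * x} t) * (F t' * indicator {t'. \<bar>t' - t\<bar> < \<eta>} t'))"
      by (simp add: mult_ac)
    then show "(\<integral>\<^sup>+t'. ?c * (F t' * indicator {t'. \<bar>t' - t\<bar> < \<eta>} t' * indicator {- 2 * pi..4 * pi} t * indicator {t. \<bar>t - \<theta>\<bar> \<le> 2 * x} t) \<partial>lborel)
      = ?c * (\<integral>\<^sup>+t'\<in>{t'. \<bar>t' - t\<bar> < \<eta>}. F t' \<partial>lborel) * indicator {- 2 * pi..4 * pi} t * indicator {t. \<bar>t - \<theta>\<bar> \<le> 2 * x} t"
      by (simp only:) (subst nn_integral_cmult, auto simp: mult_ac)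
  qed
  finally show ?thesis .
qed

subsection \<open>Doubling tails and monotone functions\<close>

lemma measurable_mono_ennreal:
  fixes \<phi> :: "real \<Rightarrow> ennreal"
  assumes "mono \<phi>"
  shows "\<phi> \<in> borel_measurable borel"
proof (rule borel_measurableI_greater)
  fix y
  have "is_interval {r. y < \<phi> r}"
    unfolding is_interval_1 using assms by (auto simp: mono_def intro: less_le_trans)
  then have "{r. y < \<phi> r} \<in> sets borel" by (simp add: is_interval_convex real_interval_borel_measurable)
  then show "{x \<in> space borel. y < \<phi> x} \<in> sets borel" by simp
qed

text \<open>The density is meant to contain the factor r of the area element, which makes its total
  mass finite. Doubling is asked for on all of [0, 1) and not only near 1, so that radii need no
  case distinction later.\<close>

locale doubling_tail =
  fixes w :: "real \<Rightarrow> ennreal" and K :: real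
  assumes w_meas [measurable]: "w \<in> borel_measurable borel"
    and K: "0 < K"
    and doubling: "\<And>r. 0 \<le> r \<Longrightarrow> r < 1 \<Longrightarrow>
      (\<integral>\<^sup>+s\<in>{r..<1}. w s \<partial>lborel) \<le> ennreal K * (\<integral>\<^sup>+s\<in>{(1 + r) / 2..<1}. w s \<partial>lborel)"
    and total_finite: "(\<integral>\<^sup>+s\<in>{0..<1}. w s \<partial>lborel) < \<infinity>"
begin

definition \<nu> :: "real measure" where "\<nu> = density lborel (\<lambda>r. w r * indicator {0..<1} r)"

lemma sets_\<nu> [measurable_cong, simp]: "sets \<nu> = sets borel" by (simp add: \<nu>_def)

lemma space_\<nu> [simp]: "space \<nu> = UNIV" by (simp add: \<nu>_def)

lemma nn_integral_\<nu>:
  "f \<in> borel_measurable borel \<Longrightarrow> (\<integral>\<^sup>+r. f r \<partial>\<nu>) = (\<integral>\<^sup>+r. w r * indicator {0..<1} r * f r \<partial>lborel)"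
  unfolding \<nu>_def by (subst nn_integral_density) auto

lemma AE_\<nu>: "AE r in \<nu>. 0 < r \<and> r < 1"
proof -
  have "AE r in lborel. r \<noteq> (0::real)" by (rule AE_lborel_singleton)
  then have "AE r in lborel. 0 < w r * indicator {0..<1} r \<longrightarrow> 0 < r \<and> r < 1"
    by (elim eventually_mono) (auto split: split_indicator_asm)
  then show ?thesis unfolding \<nu>_def by (subst AE_density) auto
qed

lemma sigma_finite_\<nu>: "sigma_finite_measure \<nu>"
proof -
  have "finite_measure \<nu>"
    using total_finite by (intro finite_measureI) (simp add: \<nu>_def emeasure_density less_top)
  then show ?thesis by (simp add: finite_measure.axioms)
qed

text \<open>By monotonicity the superlevel set in [0, 1) is, up to its endpoint b, the interval [b,
  1), and the shifted superlevel set contains every r in ((1 + b)/2, 1). So the claim is doubling at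
  b. At r = (1 + b)/2 the shifted function may still be at most y; this single point is discarded as
  a null set.\<close>

lemma superlevel_le:
  fixes \<phi> :: "real \<Rightarrow> ennreal"
  assumes mono: "mono \<phi>"
  shows "(\<integral>\<^sup>+r. indicator {r. y < \<phi> r} r \<partial>\<nu>) \<le> ennreal K * (\<integral>\<^sup>+r. indicator {r. y < \<phi> (max 0 (2 * r - 1))} r \<partial>\<nu>)"
proof -
  have [measurable]: "\<phi> \<in> borel_measurable borel" by (rule measurable_mono_ennreal[OF mono])
  define S where "S = {r. 0 \<le> r \<and> r < 1 \<and> y < \<phi> r}"
  show ?thesis
  proof (cases "S = {}")
    case True
    then have "(\<integral>\<^sup>+r. indicator {r. y < \<phi> r} r \<partial>\<nu>) = 0"
      by (subst nn_integral_\<nu>, measurable, subst nn_integral_0_iff_AE) (auto simp: S_def split: split_indicator)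
    then show ?thesis by simp
  next
    case False
    define b where "b = Inf S"
    have bdd: "bdd_below S" by (intro bdd_belowI[of _ 0]) (auto simp: S_def)
    obtain r0 where r0: "r0 \<in> S" using False by auto
    have b: "0 \<le> b" "b < 1" using False cInf_lower[OF r0 bdd] r0 unfolding b_def
      by (auto simp: S_def intro!: cInf_greatest)
    have lower: "b \<le> r" if "r \<in> S" for r unfolding b_def by (rule cInf_lower[OF that bdd])
    have above: "y < \<phi> r" if br: "b < r" for r
    proof -
      obtain r' where "r' \<in> S" "r' < r" using cInf_lessD[OF False br[unfolded b_def]] by blast
      then have "y < \<phi> r'" "\<phi> r' \<le> \<phi> r" using monoD[OF mono, of r' r] by (auto simp: S_def)
      then show ?thesis by (rule less_le_trans)
    qed
    have "(\<integral>\<^sup>+r. indicator {r. y < \<phi> r} r \<partial>\<nu>) \<le> (\<integral>\<^sup>+s\<in>{b..<1}. w s \<partial>lborel)"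
      using lower by (subst nn_integral_\<nu>, measurable, intro nn_integral_mono) (auto simp: S_def split: split_indicator)
    also have "\<dots> \<le> ennreal K * (\<integral>\<^sup>+s\<in>{(1 + b) / 2..<1}. w s \<partial>lborel)" by (rule doubling[OF b])
    also have "(\<integral>\<^sup>+s\<in>{(1 + b) / 2..<1}. w s \<partial>lborel) \<le> (\<integral>\<^sup>+r. indicator {r. y < \<phi> (max 0 (2 * r - 1))} r \<partial>\<nu>)"
    proof (subst nn_integral_\<nu>, measurable, intro nn_integral_mono_AE)
      show "AE r in lborel. w r * indicator {(1 + b) / 2..<1} r \<le> w r * indicator {0..<1} r * indicator {r. y < \<phi> (max 0 (2 * r - 1))} r"
        using AE_lborel_singleton[of "(1 + b) / 2"]
      proof eventually_elim
        case (elim r)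
        have "y < \<phi> (max 0 (2 * r - 1))" if "(1 + b) / 2 \<le> r"
          using above[of "max 0 (2 * r - 1)"] that elim by auto
        then show ?case using b by (auto split: split_indicator)
      qed
    qed
    finally show ?thesis by (simp add: mult_left_mono)
  qed
qed

text \<open>The layer cake formula with exponent 1 reduces the integral to superlevel sets. Doubling
  enters the estimates only here, and only for functions monotone in the radius.\<close>

lemma integral_shift_le:
  fixes \<phi> :: "real \<Rightarrow> ennreal"
  assumes mono: "mono \<phi>"
  shows "(\<integral>\<^sup>+r. \<phi> r \<partial>\<nu>) \<le> ennreal K * (\<integral>\<^sup>+r. \<phi> (max 0 (2 * r - 1)) \<partial>\<nu>)"
proof -
  interpret \<nu>: sigma_finite_measure \<nu> by (rule sigma_finite_\<nu>)
  have layer: "(\<integral>\<^sup>+r. \<psi> r \<partial>\<nu>) = (\<integral>\<^sup>+\<tau>. ennreal (exp (- \<tau>)) * (\<integral>\<^sup>+r. indicator {r. ennreal (exp (- \<tau>)) < \<psi> r} r \<partial>\<nu>) \<partial>lborel)"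
    if [measurable]: "\<psi> \<in> borel_measurable borel" for \<psi>
  proof -
    have "(\<integral>\<^sup>+r. \<psi> r \<partial>\<nu>) = (\<integral>\<^sup>+r. (\<integral>\<^sup>+\<tau>\<in>{\<tau>. ennreal (exp (- \<tau>)) < \<psi> r}. ennreal (exp (- \<tau>)) \<partial>lborel) \<partial>\<nu>)"
      using powr_layer_cake[of 1] by simp
    also have "\<dots> = (\<integral>\<^sup>+\<tau>. (\<integral>\<^sup>+r. ennreal (exp (- \<tau>)) * indicator {\<tau>. ennreal (exp (- \<tau>)) < \<psi> r} \<tau> \<partial>\<nu>) \<partial>lborel)"
    proof (rule nn_integral_swap_lborel[symmetric, OF sigma_finite_\<nu>])
      show "(\<lambda>(r, \<tau>). ennreal (exp (- \<tau>)) * indicator {\<tau>. ennreal (exp (- \<tau>)) < \<psi> r} \<tau>) \<in> borel_measurable (\<nu> \<Otimes>\<^sub>M borel)"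
        unfolding indicator_def by measurable
    qed
    also have "\<dots> = (\<integral>\<^sup>+\<tau>. ennreal (exp (- \<tau>)) * (\<integral>\<^sup>+r. indicator {r. ennreal (exp (- \<tau>)) < \<psi> r} r \<partial>\<nu>) \<partial>lborel)"
      by (subst nn_integral_cmult[symmetric]) (auto intro!: nn_integral_cong split: split_indicator)
    finally show ?thesis .
  qed
  have [measurable]: "\<phi> \<in> borel_measurable borel" by (rule measurable_mono_ennreal[OF mono])
  have [measurable]: "(\<lambda>\<tau>. \<integral>\<^sup>+r. indicator {r. ennreal (exp (- \<tau>)) < \<psi> r} r \<partial>\<nu>) \<in> borel_measurable borel"
    if [measurable]: "\<psi> \<in> borel_measurable borel" for \<psi>
    by (intro \<nu>.borel_measurable_nn_integral) (unfold indicator_def, measurable)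
  have "(\<integral>\<^sup>+r. \<phi> r \<partial>\<nu>) = (\<integral>\<^sup>+\<tau>. ennreal (exp (- \<tau>)) * (\<integral>\<^sup>+r. indicator {r. ennreal (exp (- \<tau>)) < \<phi> r} r \<partial>\<nu>) \<partial>lborel)"
    by (rule layer) measurable
  also have "\<dots> \<le> (\<integral>\<^sup>+\<tau>. ennreal (exp (- \<tau>)) * (ennreal K * (\<integral>\<^sup>+r. indicator {r. ennreal (exp (- \<tau>)) < \<phi> (max 0 (2 * r - 1))} r \<partial>\<nu>)) \<partial>lborel)"
    by (intro nn_integral_mono mult_left_mono superlevel_le mono) auto
  also have "\<dots> = ennreal K * (\<integral>\<^sup>+\<tau>. ennreal (exp (- \<tau>)) * (\<integral>\<^sup>+r. indicator {r. ennreal (exp (- \<tau>)) < \<phi> (max 0 (2 * r - 1))} r \<partial>\<nu>) \<partial>lborel)"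
    by (subst nn_integral_cmult[symmetric]) (auto simp: mult_ac)
  also have "\<dots> = ennreal K * (\<integral>\<^sup>+r. \<phi> (max 0 (2 * r - 1)) \<partial>\<nu>)"
    by (subst (2) layer) auto
  finally show ?thesis .
qed

end

subsection \<open>Comparison of radial and averaged square functions\<close>

definition radial_power :: "real \<Rightarrow> (complex \<Rightarrow> complex) \<Rightarrow> real \<Rightarrow> real \<Rightarrow> ennreal" where
  "radial_power p f r t = ennreal (norm (f (of_real r * cis t)) powr p)"

text \<open>For 0 < r < 1 the mean is over the arc that \<open>Gamma_region (cis t)\<close> cuts out
  of the circle of radius r. Angles live on the line and not modulo 2 pi, which is harmless because
  1 - r < pi.\<close>

definition arc_average :: "real \<Rightarrow> (complex \<Rightarrow> complex) \<Rightarrow> real \<Rightarrow> real \<Rightarrow> ennreal" where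
  "arc_average p f r t = ennreal (1 / (2 * (1 - r))) *
     (\<integral>\<^sup>+t'\<in>{t'. \<bar>t' - t\<bar> < 1 - r}. radial_power p f r t' \<partial>lborel)"

text \<open>
  The truncated nontangential maximal function. In contrast to the two families above it is monotone
  in \<open>r\<close>, which is what the doubling condition needs.
\<close>
definition nontangential_sup :: "real \<Rightarrow> (complex \<Rightarrow> complex) \<Rightarrow> real \<Rightarrow> real \<Rightarrow> ennreal" where
  "nontangential_sup p f \<theta> r = (SUP (\<rho>, \<tau>) \<in> {(\<rho>, \<tau>). 0 \<le> \<rho> \<and> \<rho> \<le> r \<and> \<bar>\<tau> - \<theta>\<bar> \<le> 1 - \<rho>}. radial_power p f \<rho> \<tau>)"

lemma mono_nontangential_sup: "mono (nontangential_sup p f \<theta>)"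
  unfolding nontangential_sup_def by (intro monoI SUP_subset_mono) auto

lemma radial_power_le_nontangential_sup:
  "0 \<le> \<rho> \<Longrightarrow> \<rho> \<le> r \<Longrightarrow> \<bar>\<tau> - \<theta>\<bar> \<le> 1 - \<rho> \<Longrightarrow> radial_power p f \<rho> \<tau> \<le> nontangential_sup p f \<theta> r"
  unfolding nontangential_sup_def by (rule SUP_upper2[of "(\<rho>, \<tau>)"]) auto

lemma measurable_radial_power [measurable]:
  assumes [measurable]: "f \<in> borel_measurable borel"
  shows "(\<lambda>(r, t). radial_power p f r t) \<in> borel_measurable (borel \<Otimes>\<^sub>M borel)"
proof -
  have [measurable]: "cis \<in> borel_measurable borel"
    by (intro borel_measurable_continuous_onI continuous_intros)
  show ?thesis unfolding radial_power_def by measurable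
qed

lemma measurable_arc_average [measurable]:
  assumes [measurable]: "f \<in> borel_measurable borel"
  shows "(\<lambda>(r, t). arc_average p f r t) \<in> borel_measurable (borel \<Otimes>\<^sub>M borel)"
  unfolding arc_average_def indicator_def by measurable

lemma measurable_radial_power_slice [measurable]:
  assumes [measurable]: "f \<in> borel_measurable borel"
  shows "radial_power p f r \<in> borel_measurable borel"
  by measurable

lemma measurable_arc_average_slice [measurable]:
  assumes [measurable]: "f \<in> borel_measurable borel"
  shows "arc_average p f r \<in> borel_measurable borel"
  by measurable

lemma radial_power_periodic: "radial_power p f r (t + 2 * pi) = radial_power p f r t"
  by (simp add: radial_power_def cis_periodic)

lemma arc_average_periodic:
  assumes [measurable]: "f \<in> borel_measurable borel"
  shows "arc_average p f r (t + 2 * pi) = arc_average p f r t"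
proof -
  have "(\<integral>\<^sup>+t'\<in>{t'. \<bar>t' - (t + 2 * pi)\<bar> < 1 - r}. radial_power p f r t' \<partial>lborel)
    = (\<integral>\<^sup>+t'. radial_power p f r (t' + 2 * pi) * indicator {t'. \<bar>t' - (t + 2 * pi)\<bar> < 1 - r} (t' + 2 * pi) \<partial>lborel)"
    by (intro nn_integral_shift[symmetric]) measurable
  then show ?thesis unfolding arc_average_def
    by (simp add: radial_power_periodic indicator_def)
qed

lemma arc_average_le_nontangential_sup:
  assumes r: "0 \<le> r" "r < 1"
  shows "arc_average p f r \<theta> \<le> nontangential_sup p f \<theta> r"
proof -
  let ?N = "nontangential_sup p f \<theta> r"
  have "(\<integral>\<^sup>+t'\<in>{t'. \<bar>t' - \<theta>\<bar> < 1 - r}. radial_power p f r t' \<partial>lborel)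
    \<le> (\<integral>\<^sup>+t'\<in>{\<theta> - (1 - r)<..<\<theta> + (1 - r)}. ?N \<partial>lborel)"
    using r radial_power_le_nontangential_sup[of r r _ \<theta> p f]
    by (intro nn_integral_mono) (auto split: split_indicator)
  also have "\<dots> = ?N * ennreal (2 * (1 - r))" using r by (subst nn_integral_cmult) auto
  finally have "arc_average p f r \<theta> \<le> ennreal (1 / (2 * (1 - r))) * (?N * ennreal (2 * (1 - r)))"
    unfolding arc_average_def by (intro mult_left_mono) auto
  also have "\<dots> = (ennreal (1 / (2 * (1 - r))) * ennreal (2 * (1 - r))) * ?N" by (simp add: mult_ac)
  also have "ennreal (1 / (2 * (1 - r))) * ennreal (2 * (1 - r)) = 1"
    using r by (subst ennreal_mult[symmetric]) auto
  finally show ?thesis by simp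
qed

text \<open>Besides measurability and periodicity, this is all that the dominating family has to
  satisfy. The doubled radius and the larger window on the right are room for averaging over arcs of
  half-length 1 - r <= x; the factor 2 is the one from \<open>average_powr_le\<close>.\<close>

definition controls_circle_means :: "real \<Rightarrow> real \<Rightarrow> (complex \<Rightarrow> complex) \<Rightarrow> (real \<Rightarrow> real \<Rightarrow> ennreal) \<Rightarrow> bool" where
  "controls_circle_means p s f v \<longleftrightarrow> (\<forall>r \<theta> x. 0 < r \<longrightarrow> r < 1 \<longrightarrow> 1 - r \<le> x \<longrightarrow>
      (\<integral>\<^sup>+t\<in>{t. \<bar>t - \<theta>\<bar> \<le> x}. ennreal (norm (f (of_real r * cis t)) powr (s * p)) * indicator {-5..11} t \<partial>lborel)
      \<le> 2 * (\<integral>\<^sup>+t\<in>{t. \<bar>t - \<theta>\<bar> \<le> 2 * x}. (ennreal_powr (v r t) s * indicator {- 2 * pi..4 * pi} t) \<partial>lborel))"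

lemma ennreal_powr_radial_power:
  "ennreal_powr (radial_power p f r t) s = ennreal (norm (f (of_real r * cis t)) powr (s * p))"
  by (simp add: radial_power_def ennreal_powr_ennreal powr_powr mult.commute)

lemma controls_circle_means_radial_power: "controls_circle_means p s f (radial_power p f)"
  unfolding controls_circle_means_def ennreal_powr_radial_power
proof (intro allI impI)
  fix r \<theta> x :: real assume "0 < r" "r < 1" "1 - r \<le> x"
  let ?F = "\<lambda>t. ennreal (norm (f (of_real r * cis t)) powr (s * p))"
  have "(\<integral>\<^sup>+t\<in>{t. \<bar>t - \<theta>\<bar> \<le> x}. ?F t * indicator {-5..11} t \<partial>lborel)
    \<le> 1 * (\<integral>\<^sup>+t\<in>{t. \<bar>t - \<theta>\<bar> \<le> 2 * x}. ?F t * indicator {- 2 * pi..4 * pi} t \<partial>lborel)"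
    unfolding mult_1 using \<open>r < 1\<close> \<open>1 - r \<le> x\<close> pi_approx by (intro nn_integral_mono) (auto split: split_indicator)
  also have "\<dots> \<le> 2 * (\<integral>\<^sup>+t\<in>{t. \<bar>t - \<theta>\<bar> \<le> 2 * x}. ?F t * indicator {- 2 * pi..4 * pi} t \<partial>lborel)"
    by (intro mult_right_mono) auto
  finally show "(\<integral>\<^sup>+t\<in>{t. \<bar>t - \<theta>\<bar> \<le> x}. ?F t * indicator {-5..11} t \<partial>lborel)
    \<le> 2 * (\<integral>\<^sup>+t\<in>{t. \<bar>t - \<theta>\<bar> \<le> 2 * x}. ?F t * indicator {- 2 * pi..4 * pi} t \<partial>lborel)" .
qed

text \<open>Spreading |f|^(sp) over arcs produces the mean of the power s of |f|^p, and the concave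
  Jensen inequality replaces it by the power s of the mean.\<close>

lemma controls_circle_means_arc_average:
  assumes f[measurable]: "f \<in> borel_measurable borel" and s: "0 < s" "s < 1"
  shows "controls_circle_means p s f (arc_average p f)"
  unfolding controls_circle_means_def
proof (intro allI impI)
  fix r \<theta> x :: real assume r: "0 < r" "r < 1" "1 - r \<le> x"
  let ?F = "\<lambda>t. ennreal (norm (f (of_real r * cis t)) powr (s * p))"
  have F: "?F = (\<lambda>t. ennreal_powr (radial_power p f r t) s)" by (simp add: ennreal_powr_radial_power)
  have Fm: "?F \<in> borel_measurable borel" unfolding F by measurable
  have "(\<integral>\<^sup>+t\<in>{t. \<bar>t - \<theta>\<bar> \<le> x}. ?F t * indicator {-5..11} t \<partial>lborel)
    \<le> (\<integral>\<^sup>+t\<in>{t. \<bar>t - \<theta>\<bar> \<le> 2 * x}. ennreal (1 / (2 * (1 - r))) * (\<integral>\<^sup>+t'\<in>{t'. \<bar>t' - t\<bar> < 1 - r}. ?F t' \<partial>lborel)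
          * indicator {- 2 * pi..4 * pi} t \<partial>lborel)"
    using r by (intro integral_le_integral_of_averages Fm) auto
  also have "\<dots> \<le> (\<integral>\<^sup>+t\<in>{t. \<bar>t - \<theta>\<bar> \<le> 2 * x}. 2 * ennreal_powr (arc_average p f r t) s * indicator {- 2 * pi..4 * pi} t \<partial>lborel)"
    unfolding ennreal_powr_radial_power[symmetric] arc_average_def using r s by (intro nn_integral_mono mult_right_mono average_powr_le) auto
  also have "\<dots> = 2 * (\<integral>\<^sup>+t\<in>{t. \<bar>t - \<theta>\<bar> \<le> 2 * x}. ennreal_powr (arc_average p f r t) s * indicator {- 2 * pi..4 * pi} t \<partial>lborel)"
    by (subst nn_integral_cmult[symmetric]) (auto simp: mult.assoc)
  finally show "(\<integral>\<^sup>+t\<in>{t. \<bar>t - \<theta>\<bar> \<le> x}. ?F t * indicator {-5..11} t \<partial>lborel)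
    \<le> 2 * (\<integral>\<^sup>+t\<in>{t. \<bar>t - \<theta>\<bar> \<le> 2 * x}. ennreal_powr (arc_average p f r t) s * indicator {- 2 * pi..4 * pi} t \<partial>lborel)" .
qed

lemma three_periods:
  fixes h :: "real \<Rightarrow> ennreal"
  assumes [measurable]: "h \<in> borel_measurable borel" and per: "\<And>t. h (t + 2 * pi) = h t"
  shows "(\<integral>\<^sup>+t\<in>{- 2 * pi..4 * pi}. h t \<partial>lborel) \<le> 3 * (\<integral>\<^sup>+t\<in>{0..2 * pi}. h t \<partial>lborel)"
proof -
  let ?P = "\<integral>\<^sup>+t\<in>{0..2 * pi}. h t \<partial>lborel"
  have P: "(\<integral>\<^sup>+t\<in>{c..c + 2 * pi}. h t \<partial>lborel) = ?P" for c
    by (intro periodic_nn_integral per) measurable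
  have "(\<integral>\<^sup>+t\<in>{- 2 * pi..4 * pi}. h t \<partial>lborel)
    \<le> (\<integral>\<^sup>+t. h t * indicator {- 2 * pi..- 2 * pi + 2 * pi} t + h t * indicator {0..0 + 2 * pi} t + h t * indicator {2 * pi..2 * pi + 2 * pi} t \<partial>lborel)"
    by (intro nn_integral_mono) (auto split: split_indicator)
  also have "\<dots> = ?P + ?P + ?P"
    by (subst nn_integral_add, measurable, subst nn_integral_add, measurable) (simp only: P)
  also have "\<dots> = (1 + 1 + 1) * ?P" by (simp only: distrib_right mult_1)
  finally show ?thesis by simp
qed

section \<open>Nontangential domination under the doubling condition\<close>

context doubling_tail
begin

text \<open>The maximal function depends on \<theta> and r only, so the Poisson estimate for
  |f|^(sp) is uniform over the cut-off region and is raised to the power 1/s afterwards. For r <=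
  1/2 the only admissible radius is 0.\<close>

lemma nontangential_sup_bound:
  assumes p: "0 < p" and s: "0 < s" and hol: "f holomorphic_on ball 0 1" and v: "controls_circle_means p s f v"
    and r: "0 < r" "r < 1" and \<theta>: "\<theta> \<in> {0..2 * pi}"
  shows "nontangential_sup p f \<theta> (max 0 (2 * r - 1)) \<le>
    ennreal (20480 powr (1 / s)) * ennreal_powr (hl_max (\<lambda>t. ennreal_powr (v r t) s * indicator {- 2 * pi..4 * pi} t) \<theta>) (1 / s)"
  unfolding nontangential_sup_def
proof (rule SUP_least, clarify)
  fix \<rho> \<tau> assume *: "0 \<le> \<rho>" "\<rho> \<le> max 0 (2 * r - 1)" "\<bar>\<tau> - \<theta>\<bar> \<le> 1 - \<rho>"
  let ?M = "hl_max (\<lambda>t. ennreal_powr (v r t) s * indicator {- 2 * pi..4 * pi} t) \<theta>"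
  have "ennreal (norm (f (of_real \<rho> * cis \<tau>)) powr (s * p)) \<le> ennreal 20480 * ?M"
    using p s r * \<theta> v unfolding controls_circle_means_def
    by (intro power_bound_by_hl_max[OF _ hol r]) auto
  then have "ennreal_powr (ennreal_powr (radial_power p f \<rho> \<tau>) s) (1 / s) \<le> ennreal_powr (ennreal 20480 * ?M) (1 / s)"
    unfolding ennreal_powr_radial_power using s by (intro ennreal_powr_mono) auto
  also have "ennreal_powr (ennreal 20480 * ?M) (1 / s) = ennreal (20480 powr (1 / s)) * ennreal_powr ?M (1 / s)"
    using s by (intro ennreal_powr_cmult) auto
  finally show "radial_power p f \<rho> \<tau> \<le> ennreal (20480 powr (1 / s)) * ennreal_powr ?M (1 / s)"
    using s by (simp only: ennreal_powr_inverse)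
qed

text \<open>The families u and v are unrelated: u has to lie below the nontangential supremum, v has
  to control the circle means. Inserting the radial and the averaged family in either order gives
  both comparisons with one constant.\<close>

lemma nontangential_integral_bound:
  assumes p: "0 < p" and a: "0 < a" and s: "s = min 1 a / 4"
  obtains C where "0 < C"
    "\<And>f v u. \<lbrakk>f holomorphic_on ball 0 1; controls_circle_means p s f v;
        (\<lambda>(r, t). v r t) \<in> borel_measurable (borel \<Otimes>\<^sub>M borel);
        \<And>r t. v r (t + 2 * pi) = v r t;
        \<And>r t. 0 \<le> r \<Longrightarrow> r < 1 \<Longrightarrow> u r t \<le> nontangential_sup p f t r\<rbrakk> \<Longrightarrow>
      (mixed_integral a \<nu> u {0..2 * pi})
      \<le> ennreal C * (mixed_integral a \<nu> v {0..2 * pi})"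
proof -
  obtain C where C: "0 < C"
    "\<And>(N :: real measure) u I J. \<lbrakk>sigma_finite_measure N; (\<lambda>(r, t). u r t) \<in> borel_measurable (N \<Otimes>\<^sub>M borel);
       I \<in> sets borel; J \<in> sets borel; emeasure lborel I < \<infinity>; emeasure lborel J < \<infinity>\<rbrakk> \<Longrightarrow>
     (\<integral>\<^sup>+\<theta>\<in>I. ennreal_powr (\<integral>\<^sup>+r. ennreal_powr (hl_max (\<lambda>t. ennreal_powr (u r t) s * indicator J t) \<theta>) (1/s) \<partial>N) a \<partial>lborel)
     \<le> ennreal C * (mixed_integral a N u J)"
    using vector_hl_max[OF a s] by blast
  have s0: "0 < s" using s a by simp
  define D where "D = K * 20480 powr (1 / s)"
  have D: "0 < D" using K by (simp add: D_def)
  show thesis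
  proof (rule that[of "D powr a * (C * 3)"])
    show "0 < D powr a * (C * 3)" using D C(1) by simp
    fix f and v u :: "real \<Rightarrow> real \<Rightarrow> ennreal"
    assume hol: "f holomorphic_on ball 0 1" and v: "controls_circle_means p s f v"
      and vm[measurable]: "(\<lambda>(r, t). v r t) \<in> borel_measurable (borel \<Otimes>\<^sub>M borel)"
      and vper: "\<And>r t. v r (t + 2 * pi) = v r t"
      and u: "\<And>r t. 0 \<le> r \<Longrightarrow> r < 1 \<Longrightarrow> u r t \<le> nontangential_sup p f t r"
    let ?J = "{- 2 * pi..4 * pi}"
    define X where "X \<theta> = (\<integral>\<^sup>+r. ennreal_powr (hl_max (\<lambda>t. ennreal_powr (v r t) s * indicator ?J t) \<theta>) (1/s) \<partial>\<nu>)" for \<theta>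
    define U where "U t = (\<integral>\<^sup>+r. v r t \<partial>\<nu>)" for t
    have vN[measurable]: "(\<lambda>(r, t). v r t) \<in> borel_measurable (\<nu> \<Otimes>\<^sub>M borel)"
      using vm by (simp cong: measurable_cong_sets sets_pair_measure_cong)
    have [measurable]: "U \<in> borel_measurable borel"
      unfolding U_def by (intro measurable_nn_integral_swapped sigma_finite_\<nu> vN)
    have Uper: "U (t + 2 * pi) = U t" for t by (simp add: U_def vper)
    have uX: "(\<integral>\<^sup>+r. u r \<theta> \<partial>\<nu>) \<le> ennreal D * X \<theta>" if \<theta>: "\<theta> \<in> {0..2 * pi}" for \<theta>
    proof -
      have "(\<integral>\<^sup>+r. u r \<theta> \<partial>\<nu>) \<le> (\<integral>\<^sup>+r. nontangential_sup p f \<theta> r \<partial>\<nu>)"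
        by (intro nn_integral_mono_AE eventually_mono[OF AE_\<nu>] u) auto
      also have "\<dots> \<le> ennreal K * (\<integral>\<^sup>+r. nontangential_sup p f \<theta> (max 0 (2 * r - 1)) \<partial>\<nu>)"
        by (intro integral_shift_le mono_nontangential_sup)
      also have "(\<integral>\<^sup>+r. nontangential_sup p f \<theta> (max 0 (2 * r - 1)) \<partial>\<nu>)
        \<le> (\<integral>\<^sup>+r. ennreal (20480 powr (1 / s)) * ennreal_powr (hl_max (\<lambda>t. ennreal_powr (v r t) s * indicator ?J t) \<theta>) (1 / s) \<partial>\<nu>)"
        by (intro nn_integral_mono_AE eventually_mono[OF AE_\<nu>] nontangential_sup_bound[OF p s0 hol v _ _ \<theta>]) auto
      also have "\<dots> = ennreal (20480 powr (1 / s)) * X \<theta>"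
        unfolding X_def by (intro nn_integral_cmult) measurable
      finally show ?thesis using K by (simp add: D_def ennreal_mult mult.assoc mult_left_mono)
    qed
    have "(mixed_integral a \<nu> u {0..2 * pi})
      \<le> (\<integral>\<^sup>+\<theta>. ennreal (D powr a) * (ennreal_powr (X \<theta>) a * indicator {0..2 * pi} \<theta>) \<partial>lborel)"
    proof (rule nn_integral_mono)
      fix \<theta> :: real
      show "ennreal_powr (\<integral>\<^sup>+r. u r \<theta> \<partial>\<nu>) a * indicator {0..2 * pi} \<theta> \<le> ennreal (D powr a) * (ennreal_powr (X \<theta>) a * indicator {0..2 * pi} \<theta>)"
      proof (cases "\<theta> \<in> {0..2 * pi}")
        case True
        then show ?thesis using ennreal_powr_mono[OF uX[OF True], of a] a D by (simp add: ennreal_powr_cmult)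
      qed simp
    qed
    also have "\<dots> = ennreal (D powr a) * (\<integral>\<^sup>+\<theta>\<in>{0..2 * pi}. ennreal_powr (X \<theta>) a \<partial>lborel)"
    proof (rule nn_integral_cmult)
      have "X \<in> borel_measurable borel" unfolding X_def
        by (intro measurable_nn_integral_swapped sigma_finite_\<nu>) measurable
      then show "(\<lambda>\<theta>. ennreal_powr (X \<theta>) a * indicator {0..2 * pi} \<theta>) \<in> borel_measurable lborel" by measurable
    qed
    also have "\<dots> \<le> ennreal (D powr a) * (ennreal C * (\<integral>\<^sup>+t\<in>?J. ennreal_powr (U t) a \<partial>lborel))"
      unfolding X_def U_def by (intro mult_left_mono C(2) sigma_finite_\<nu> vN) auto
    also have "\<dots> \<le> ennreal (D powr a) * (ennreal C * (3 * (\<integral>\<^sup>+t\<in>{0..2 * pi}. ennreal_powr (U t) a \<partial>lborel)))"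
      by (intro mult_left_mono three_periods) (auto simp: Uper)
    also have "\<dots> = ennreal (D powr a * (C * 3)) * (\<integral>\<^sup>+t\<in>{0..2 * pi}. ennreal_powr (U t) a \<partial>lborel)"
      using C(1) by (simp add: ennreal_mult mult.assoc)
    finally show "(mixed_integral a \<nu> u {0..2 * pi})
      \<le> ennreal (D powr a * (C * 3)) * (mixed_integral a \<nu> v {0..2 * pi})"
      unfolding U_def .
  qed
qed

theorem radial_arc_comparison:
  assumes p: "0 < p" and a: "0 < a"
  obtains C where "0 < C"
    "\<And>f. \<lbrakk>f holomorphic_on ball 0 1; f \<in> borel_measurable borel\<rbrakk> \<Longrightarrow>
      (mixed_integral a \<nu> (radial_power p f) {0..2 * pi})
      \<le> ennreal C * (mixed_integral a \<nu> (arc_average p f) {0..2 * pi})"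
    "\<And>f. \<lbrakk>f holomorphic_on ball 0 1; f \<in> borel_measurable borel\<rbrakk> \<Longrightarrow>
      (mixed_integral a \<nu> (arc_average p f) {0..2 * pi})
      \<le> ennreal C * (mixed_integral a \<nu> (radial_power p f) {0..2 * pi})"
proof -
  define s where "s = min 1 a / 4"
  have s: "0 < s" "s < 1" using a by (auto simp: s_def)
  show thesis
  proof (rule nontangential_integral_bound[OF p a s_def])
    fix C
    assume C: "0 < C" "\<And>f v u. \<lbrakk>f holomorphic_on ball 0 1; controls_circle_means p s f v;
        (\<lambda>(r, t). v r t) \<in> borel_measurable (borel \<Otimes>\<^sub>M borel);
        \<And>r t. v r (t + 2 * pi) = v r t;
        \<And>r t. 0 \<le> r \<Longrightarrow> r < 1 \<Longrightarrow> u r t \<le> nontangential_sup p f t r\<rbrakk> \<Longrightarrow>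
      (mixed_integral a \<nu> u {0..2 * pi})
      \<le> ennreal C * (mixed_integral a \<nu> v {0..2 * pi})"
    show thesis
    proof (rule that[OF C(1)])
    fix f :: "complex \<Rightarrow> complex" assume f: "f holomorphic_on ball 0 1" "f \<in> borel_measurable borel"
    show "(mixed_integral a \<nu> (radial_power p f) {0..2 * pi})
      \<le> ennreal C * (mixed_integral a \<nu> (arc_average p f) {0..2 * pi})"
      by (rule C(2)[OF f(1) controls_circle_means_arc_average[OF f(2) s] measurable_arc_average[OF f(2)]
            arc_average_periodic[OF f(2)] radial_power_le_nontangential_sup]) auto
    show "(mixed_integral a \<nu> (arc_average p f) {0..2 * pi})
      \<le> ennreal C * (mixed_integral a \<nu> (radial_power p f) {0..2 * pi})"
      by (rule C(2)[OF f(1) controls_circle_means_radial_power measurable_radial_power[OF f(2)]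
            radial_power_periodic arc_average_le_nontangential_sup]) auto
    qed
  qed
qed

end

subsection \<open>Polar coordinates\<close>

lemma lborel_complex_eq: "(lborel :: complex measure) = distr (lborel \<Otimes>\<^sub>M lborel) borel (\<lambda>(x, y). Complex x y)"
proof (rule lborel_eqI)
  have cont: "continuous_on UNIV (\<lambda>p. Complex (fst p) (snd p))"
    unfolding Complex_eq by (intro continuous_intros)
  then have m: "(\<lambda>(x, y). Complex x y) \<in> borel \<rightarrow>\<^sub>M borel"
    by (simp add: case_prod_unfold borel_measurable_continuous_onI)
  then have [measurable]: "(\<lambda>(x, y). Complex x y) \<in> (lborel \<Otimes>\<^sub>M lborel) \<rightarrow>\<^sub>M borel"
    by (simp add: lborel_prod)
  fix l u :: complex assume lu: "\<And>b. b \<in> Basis \<Longrightarrow> l \<bullet> b \<le> u \<bullet> b"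
  have lu': "Re l \<le> Re u" "Im l \<le> Im u"
    using lu[of 1] lu[of \<i>] by (simp_all add: Basis_complex_def inner_complex_def)
  have "emeasure (distr (lborel \<Otimes>\<^sub>M lborel) borel (\<lambda>(x, y). Complex x y)) (box l u)
    = emeasure (lborel \<Otimes>\<^sub>M lborel) ((\<lambda>(x, y). Complex x y) -` box l u \<inter> space (lborel \<Otimes>\<^sub>M lborel))"
    by (rule emeasure_distr) auto
  also have "(\<lambda>(x, y). Complex x y) -` box l u \<inter> space (lborel \<Otimes>\<^sub>M lborel) = {Re l<..<Re u} \<times> {Im l<..<Im u}"
    by (auto simp: space_pair_measure box_def Basis_complex_def inner_complex_def)
  also have "emeasure (lborel \<Otimes>\<^sub>M lborel) ({Re l<..<Re u} \<times> {Im l<..<Im u}) = ennreal (Re u - Re l) * ennreal (Im u - Im l)"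
    using lu' by (subst lborel.emeasure_pair_measure_Times) auto
  also have "\<dots> = (\<Prod>b\<in>Basis. (u - l) \<bullet> b)"
    using lu' by (simp add: Basis_complex_def inner_complex_def ennreal_mult[symmetric])
  finally show "emeasure (distr (lborel \<Otimes>\<^sub>M lborel) borel (\<lambda>(x, y). Complex x y)) (box l u) = ennreal (\<Prod>b\<in>Basis. (u - l) \<bullet> b)" .
qed simp

lemma measurable_Complex [measurable (raw)]:
  assumes [measurable]: "f \<in> borel_measurable M" "g \<in> borel_measurable M"
  shows "(\<lambda>x. Complex (f x) (g x)) \<in> borel_measurable M"
  unfolding Complex_eq by measurable

lemma measurable_cis [measurable]: "cis \<in> borel_measurable borel"
  by (intro borel_measurable_continuous_onI continuous_intros)

lemma nn_integral_complex:
  fixes F :: "complex \<Rightarrow> ennreal"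
  assumes [measurable]: "F \<in> borel_measurable borel"
  shows "(\<integral>\<^sup>+z. F z \<partial>lborel) = (\<integral>\<^sup>+x. (\<integral>\<^sup>+y. F (Complex x y) \<partial>lborel) \<partial>lborel)"
proof -
  have "(\<integral>\<^sup>+z. F z \<partial>lborel) = (\<integral>\<^sup>+p. F (case p of (x, y) \<Rightarrow> Complex x y) \<partial>(lborel \<Otimes>\<^sub>M lborel))"
    unfolding lborel_complex_eq by (subst nn_integral_distr) auto
  also have "\<dots> = (\<integral>\<^sup>+x. (\<integral>\<^sup>+y. F (Complex x y) \<partial>lborel) \<partial>lborel)"
    by (subst lborel.nn_integral_fst[symmetric]) auto
  finally show ?thesis .
qed

text \<open>The substitution is carried out with arctan on compact intervals, where its derivative
  1/(1 + s^2) cancels 1/(cos t)^2, and is completed by monotone convergence. \<open>Suc n\<close>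
  keeps the intervals nondegenerate.\<close>

lemma nn_integral_tan_substitution:
  fixes h :: "real \<Rightarrow> ennreal"
  assumes [measurable]: "h \<in> borel_measurable borel"
  shows "(\<integral>\<^sup>+s. h s \<partial>lborel) = (\<integral>\<^sup>+t\<in>{- (pi/2)<..<pi/2}. h (tan t) * ennreal (1 / (cos t)\<^sup>2) \<partial>lborel)"
proof -
  define k where "k t = h (tan t) * ennreal (1 / (cos t)\<^sup>2)" for t
  have [measurable]: "k \<in> borel_measurable borel" unfolding k_def tan_def by measurable
  have fin: "(\<integral>\<^sup>+t\<in>{arctan (- real (Suc n))..arctan (real (Suc n))}. k t \<partial>lborel)
     = (\<integral>\<^sup>+s\<in>{- real (Suc n)..real (Suc n)}. h s \<partial>lborel)" for n
  proof -
    have "(\<integral>\<^sup>+t\<in>{arctan (- real (Suc n))..arctan (real (Suc n))}. k t \<partial>lborel)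
      = (\<integral>\<^sup>+s\<in>{- real (Suc n)..real (Suc n)}. k (arctan s) * ennreal (inverse (1 + s\<^sup>2)) \<partial>lborel)"
    proof (rule nn_integral_substitution_aux)
      show "continuous_on {- real (Suc n)..real (Suc n)} (\<lambda>s. inverse (1 + s\<^sup>2))"
        by (intro continuous_intros) (metis add_pos_nonneg less_irrefl zero_le_power2 zero_less_one)
      show "(arctan has_real_derivative inverse (1 + s\<^sup>2)) (at s)" for s by (rule DERIV_arctan)
    qed (auto intro!: add_nonneg_nonneg)
    also have "\<dots> = (\<integral>\<^sup>+s\<in>{- real (Suc n)..real (Suc n)}. h s \<partial>lborel)"
    proof (rule nn_integral_cong)
      fix s :: real
      have pos: "0 < 1 + s\<^sup>2" by (simp add: add_pos_nonneg)
      have "(cos (arctan s))\<^sup>2 = inverse (1 + s\<^sup>2)" using cos_arctan[of s] pos by (simp add: power_divide inverse_eq_divide)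
      then have "ennreal (1 / (cos (arctan s))\<^sup>2) * ennreal (inverse (1 + s\<^sup>2)) = 1"
        using pos by (subst ennreal_mult[symmetric]) auto
      then show "k (arctan s) * ennreal (inverse (1 + s\<^sup>2)) * indicator {- real (Suc n)..real (Suc n)} s = h s * indicator {- real (Suc n)..real (Suc n)} s"
        by (simp add: k_def tan_arctan mult.assoc)
    qed
    finally show ?thesis .
  qed
  have "(\<integral>\<^sup>+s. h s \<partial>lborel) = (\<integral>\<^sup>+s. (SUP n. h s * indicator {- real (Suc n)..real (Suc n)} s) \<partial>lborel)"
  proof (rule nn_integral_cong)
    fix s :: real
    obtain n :: nat where "\<bar>s\<bar> \<le> real n" using real_arch_simple by blast
    then have n: "s \<in> {- real (Suc n)..real (Suc n)}" by auto
    show "h s = (SUP n. h s * indicator {- real (Suc n)..real (Suc n)} s)"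
    proof (rule antisym)
      show "h s \<le> (SUP n. h s * indicator {- real (Suc n)..real (Suc n)} s)"
        using n by (intro SUP_upper2[of n]) auto
    qed (auto intro!: SUP_least split: split_indicator)
  qed
  also have "\<dots> = (SUP n. \<integral>\<^sup>+s\<in>{- real (Suc n)..real (Suc n)}. h s \<partial>lborel)"
    by (intro nn_integral_monotone_convergence_SUP)
      (auto simp: incseq_def le_fun_def intro!: mult_left_mono split: split_indicator)
  also have "\<dots> = (SUP n. \<integral>\<^sup>+t\<in>{arctan (- real (Suc n))..arctan (real (Suc n))}. k t \<partial>lborel)"
    by (simp only: fin)
  also have "\<dots> = (\<integral>\<^sup>+t. (SUP n. k t * indicator {arctan (- real (Suc n))..arctan (real (Suc n))} t) \<partial>lborel)"
  proof (intro nn_integral_monotone_convergence_SUP[symmetric])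
    show "incseq (\<lambda>n t. k t * indicator {arctan (- real (Suc n))..arctan (real (Suc n))} t)"
      unfolding incseq_def le_fun_def
    proof (intro allI impI mult_left_mono)
      fix m n :: nat and t :: real assume "m \<le> n"
      then have "arctan (- real (Suc n)) \<le> arctan (- real (Suc m))" "arctan (real (Suc m)) \<le> arctan (real (Suc n))"
        by (simp_all add: arctan_le_iff)
      then show "indicator {arctan (- real (Suc m))..arctan (real (Suc m))} t \<le> (indicator {arctan (- real (Suc n))..arctan (real (Suc n))} t :: ennreal)"
        by (auto split: split_indicator)
    qed auto
  qed measurable
  also have "\<dots> = (\<integral>\<^sup>+t\<in>{- (pi/2)<..<pi/2}. k t \<partial>lborel)"
  proof (rule nn_integral_cong)
    fix t :: real
    show "(SUP n. k t * indicator {arctan (- real (Suc n))..arctan (real (Suc n))} t) = k t * indicator {- (pi/2)<..<pi/2} t"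
    proof (cases "t \<in> {- (pi/2)<..<pi/2}")
      case True
      obtain n :: nat where "\<bar>tan t\<bar> \<le> real n" using real_arch_simple by blast
      then have "- real (Suc n) \<le> tan t" "tan t \<le> real (Suc n)" by auto
      then have "arctan (- real (Suc n)) \<le> arctan (tan t)" "arctan (tan t) \<le> arctan (real (Suc n))"
        by (simp_all only: arctan_le_iff)
      then have n: "t \<in> {arctan (- real (Suc n))..arctan (real (Suc n))}" using True by (simp add: arctan_tan)
      show ?thesis
      proof (rule antisym)
        show "k t * indicator {- (pi/2)<..<pi/2} t \<le> (SUP n. k t * indicator {arctan (- real (Suc n))..arctan (real (Suc n))} t)"
          using n True by (intro SUP_upper2[of n]) auto
      qed (use True in \<open>auto intro!: SUP_least split: split_indicator\<close>)
    next
      case False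
      have "t \<notin> {arctan (- real (Suc n))..arctan (real (Suc n))}" for n
        using False arctan_bounded[of "- real (Suc n)"] arctan_bounded[of "real (Suc n)"] by auto
      then show ?thesis using False by simp
    qed
  qed
  finally show ?thesis unfolding k_def .
qed

text \<open>Only one-dimensional substitutions are used: y = x s, then s = tan t, then x = r cos t.
  Their factors x, 1/(cos t)^2 and cos t multiply to r.\<close>

lemma nn_integral_right_half_plane:
  fixes F :: "complex \<Rightarrow> ennreal"
  assumes [measurable]: "F \<in> borel_measurable borel"
  shows "(\<integral>\<^sup>+x\<in>{0<..}. (\<integral>\<^sup>+y. F (Complex x y) \<partial>lborel) \<partial>lborel)
    = (\<integral>\<^sup>+t\<in>{- (pi/2)<..<pi/2}. (\<integral>\<^sup>+r. ennreal r * indicator {0<..} r * F (of_real r * cis t) \<partial>lborel) \<partial>lborel)"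
proof -
  have [measurable]: "tan \<in> borel_measurable (borel :: real measure)" unfolding tan_def[abs_def] by measurable
  have "(\<integral>\<^sup>+x\<in>{0<..}. (\<integral>\<^sup>+y. F (Complex x y) \<partial>lborel) \<partial>lborel)
    = (\<integral>\<^sup>+x. (\<integral>\<^sup>+s. ennreal x * indicator {0<..} x * F (Complex x (x * s)) \<partial>lborel) \<partial>lborel)"
  proof (rule nn_integral_cong)
    fix x :: real
    show "(\<integral>\<^sup>+y. F (Complex x y) \<partial>lborel) * indicator {0<..} x = (\<integral>\<^sup>+s. ennreal x * indicator {0<..} x * F (Complex x (x * s)) \<partial>lborel)"
    proof (cases "0 < x")
      case True
      have "(\<integral>\<^sup>+y. F (Complex x y) \<partial>lborel) = ennreal \<bar>x\<bar> * (\<integral>\<^sup>+s. F (Complex x (0 + x * s)) \<partial>lborel)"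
        using True by (intro nn_integral_real_affine) auto
      then show ?thesis using True by (simp add: nn_integral_cmult)
    qed simp
  qed
  also have "\<dots> = (\<integral>\<^sup>+s. (\<integral>\<^sup>+x. ennreal x * indicator {0<..} x * F (Complex x (x * s)) \<partial>lborel) \<partial>lborel)"
    by (intro lborel_pair.Fubini') measurable
  also have "\<dots> = (\<integral>\<^sup>+t\<in>{- (pi/2)<..<pi/2}. (\<integral>\<^sup>+x. ennreal x * indicator {0<..} x * F (Complex x (x * tan t)) \<partial>lborel) * ennreal (1 / (cos t)\<^sup>2) \<partial>lborel)"
    by (rule nn_integral_tan_substitution) measurable
  also have "\<dots> = (\<integral>\<^sup>+t\<in>{- (pi/2)<..<pi/2}. (\<integral>\<^sup>+r. ennreal r * indicator {0<..} r * F (of_real r * cis t) \<partial>lborel) \<partial>lborel)"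
  proof (rule nn_integral_cong)
    fix t :: real
    show "(\<integral>\<^sup>+x. ennreal x * indicator {0<..} x * F (Complex x (x * tan t)) \<partial>lborel) * ennreal (1 / (cos t)\<^sup>2) * indicator {- (pi/2)<..<pi/2} t
      = (\<integral>\<^sup>+r. ennreal r * indicator {0<..} r * F (of_real r * cis t) \<partial>lborel) * indicator {- (pi/2)<..<pi/2} t"
    proof (cases "t \<in> {- (pi/2)<..<pi/2}")
      case True
      then have c: "0 < cos t" by (intro cos_gt_zero_pi) auto
      have "(\<integral>\<^sup>+x. ennreal x * indicator {0<..} x * F (Complex x (x * tan t)) \<partial>lborel)
        = ennreal \<bar>cos t\<bar> * (\<integral>\<^sup>+r. ennreal (0 + cos t * r) * indicator {0<..} (0 + cos t * r) * F (Complex (0 + cos t * r) ((0 + cos t * r) * tan t)) \<partial>lborel)"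
        using c by (intro nn_integral_real_affine) auto
      also have "\<dots> = ennreal (cos t) * (\<integral>\<^sup>+r. ennreal (cos t) * (ennreal r * indicator {0<..} r * F (of_real r * cis t)) \<partial>lborel)"
      proof -
        have "ennreal (0 + cos t * r) * indicator {0<..} (0 + cos t * r) * F (Complex (0 + cos t * r) ((0 + cos t * r) * tan t))
          = ennreal (cos t) * (ennreal r * indicator {0<..} r * F (of_real r * cis t))" for r
        proof -
          have "Complex (cos t * r) (cos t * r * tan t) = of_real r * cis t"
            using c by (auto simp: complex_eq_iff tan_def)
          then show ?thesis using c by (auto simp: ennreal_mult mult.assoc zero_less_mult_iff split: split_indicator)
        qed
        then show ?thesis using c by simp
      qed
      also have "\<dots> = ennreal ((cos t)\<^sup>2) * (\<integral>\<^sup>+r. ennreal r * indicator {0<..} r * F (of_real r * cis t) \<partial>lborel)"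
        using c by (subst nn_integral_cmult) (auto simp: power2_eq_square ennreal_mult mult.assoc)
      finally have "(\<integral>\<^sup>+x. ennreal x * indicator {0<..} x * F (Complex x (x * tan t)) \<partial>lborel) * ennreal (1 / (cos t)\<^sup>2)
        = (ennreal ((cos t)\<^sup>2) * ennreal (1 / (cos t)\<^sup>2)) * (\<integral>\<^sup>+r. ennreal r * indicator {0<..} r * F (of_real r * cis t) \<partial>lborel)"
        by (simp add: mult_ac)
      also have "ennreal ((cos t)\<^sup>2) * ennreal (1 / (cos t)\<^sup>2) = 1" using c by (subst ennreal_mult[symmetric]) auto
      finally show ?thesis by simp
    qed simp
  qed
  finally show ?thesis .
qed

text \<open>The left half-plane follows from the right one by z -> -z, which shifts the angle by pi,
  and the imaginary axis is a null set. The free starting angle c allows the range to be centred at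
  the axis of a lens.\<close>

theorem nn_integral_polar:
  fixes F :: "complex \<Rightarrow> ennreal"
  assumes [measurable]: "F \<in> borel_measurable borel"
  shows "(\<integral>\<^sup>+z. F z \<partial>lborel) =
    (\<integral>\<^sup>+t\<in>{c..c + 2 * pi}. (\<integral>\<^sup>+r. ennreal r * indicator {0<..} r * F (of_real r * cis t) \<partial>lborel) \<partial>lborel)"
proof -
  define Q where "Q t = (\<integral>\<^sup>+r. ennreal r * indicator {0<..} r * F (of_real r * cis t) \<partial>lborel)" for t
  have [measurable]: "Q \<in> borel_measurable borel" unfolding Q_def by measurable
  have Qper: "Q (t + 2 * pi) = Q t" for t by (simp add: Q_def cis_periodic)
  define G where "G x = (\<integral>\<^sup>+y. F (Complex x y) \<partial>lborel)" for x
  have [measurable]: "G \<in> borel_measurable borel" unfolding G_def by measurable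
  have "(\<integral>\<^sup>+z. F z \<partial>lborel) = (\<integral>\<^sup>+x. G x \<partial>lborel)" unfolding G_def by (rule nn_integral_complex) measurable
  also have "\<dots> = (\<integral>\<^sup>+x. G x * indicator {0<..} x + G x * indicator {..<0} x \<partial>lborel)"
    using AE_lborel_singleton[of "0::real"] by (intro nn_integral_cong_AE) (auto elim!: eventually_mono split: split_indicator)
  also have "\<dots> = (\<integral>\<^sup>+x\<in>{0<..}. G x \<partial>lborel) + (\<integral>\<^sup>+x\<in>{..<0}. G x \<partial>lborel)"
    by (intro nn_integral_add) measurable
  also have "(\<integral>\<^sup>+x\<in>{0<..}. G x \<partial>lborel) = (\<integral>\<^sup>+t\<in>{- (pi/2)<..<pi/2}. Q t \<partial>lborel)"
    unfolding G_def Q_def by (rule nn_integral_right_half_plane) measurable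
  also have "(\<integral>\<^sup>+x\<in>{..<0}. G x \<partial>lborel) = (\<integral>\<^sup>+t\<in>{pi/2<..<3*pi/2}. Q t \<partial>lborel)"
  proof -
    have "(\<integral>\<^sup>+x\<in>{..<0}. G x \<partial>lborel) = ennreal \<bar>-1\<bar> * (\<integral>\<^sup>+x. G (0 + (-1) * x) * indicator {..<0} (0 + (-1) * x) \<partial>lborel)"
      by (rule nn_integral_real_affine) auto
    also have "\<dots> = (\<integral>\<^sup>+x\<in>{0<..}. (\<integral>\<^sup>+y. F (- Complex x y) \<partial>lborel) \<partial>lborel)"
    proof -
      have "G (- x) = (\<integral>\<^sup>+y. F (- Complex x y) \<partial>lborel)" for x
      proof -
        have "G (- x) = ennreal \<bar>-1\<bar> * (\<integral>\<^sup>+y. F (Complex (- x) (0 + (-1) * y)) \<partial>lborel)"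
          unfolding G_def by (rule nn_integral_real_affine) auto
        also have "(\<lambda>y. Complex (- x) (0 + (-1) * y)) = (\<lambda>y. - Complex x y)" by (simp add: complex_eq_iff fun_eq_iff)
        finally show ?thesis by simp
      qed
      then show ?thesis by (auto intro!: nn_integral_cong split: split_indicator)
    qed
    also have "\<dots> = (\<integral>\<^sup>+t\<in>{- (pi/2)<..<pi/2}. (\<integral>\<^sup>+r. ennreal r * indicator {0<..} r * F (- (of_real r * cis t)) \<partial>lborel) \<partial>lborel)"
      by (rule nn_integral_right_half_plane) measurable
    also have "\<dots> = (\<integral>\<^sup>+t. Q (t + pi) * indicator {pi/2<..<3*pi/2} (t + pi) \<partial>lborel)"
    proof (rule nn_integral_cong)
      fix t
      have "- (of_real r * cis t) = of_real r * cis (t + pi)" for r by (simp add: cis_mult[symmetric])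
      then show "(\<integral>\<^sup>+r. ennreal r * indicator {0<..} r * F (- (of_real r * cis t)) \<partial>lborel) * indicator {- (pi/2)<..<pi/2} t
        = Q (t + pi) * indicator {pi/2<..<3*pi/2} (t + pi)"
        unfolding Q_def by (auto split: split_indicator)
    qed
    also have "\<dots> = (\<integral>\<^sup>+t\<in>{pi/2<..<3*pi/2}. Q t \<partial>lborel)"
      by (rule nn_integral_shift) measurable
    finally show ?thesis .
  qed
  also have "(\<integral>\<^sup>+t\<in>{- (pi/2)<..<pi/2}. Q t \<partial>lborel) + (\<integral>\<^sup>+t\<in>{pi/2<..<3*pi/2}. Q t \<partial>lborel)
    = (\<integral>\<^sup>+t. Q t * indicator {- (pi/2)<..<pi/2} t + Q t * indicator {pi/2<..<3*pi/2} t \<partial>lborel)"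
    by (intro nn_integral_add[symmetric]) measurable
  also have "\<dots> = (\<integral>\<^sup>+t\<in>{- (pi/2)..- (pi/2) + 2 * pi}. Q t \<partial>lborel)"
    using AE_lborel_singleton[of "- (pi/2)"] AE_lborel_singleton[of "pi/2"] AE_lborel_singleton[of "3*pi/2"]
    by (intro nn_integral_cong_AE, eventually_elim) (auto split: split_indicator)
  also have "\<dots> = (\<integral>\<^sup>+t\<in>{0..2 * pi}. Q t \<partial>lborel)"
    by (intro periodic_nn_integral Qper) measurable
  also have "\<dots> = (\<integral>\<^sup>+t\<in>{c..c + 2 * pi}. Q t \<partial>lborel)"
    by (intro periodic_nn_integral[symmetric] Qper) measurable
  finally show ?thesis unfolding Q_def .
qed

text \<open>Polar coordinates: the circles whose radii lie in a null set of positive numbers sweep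
  out a null set of the plane.\<close>

lemma AE_norm_of_AE:
  assumes "AE r in lborel. 0 < r \<longrightarrow> P r"
  shows "AE z in (lborel :: complex measure). z \<noteq> 0 \<longrightarrow> P (norm z)"
proof -
  obtain N where N: "N \<in> null_sets lborel" "{r. \<not> (0 < r \<longrightarrow> P r)} \<subseteq> N"
    using assms unfolding eventually_ae_filter by auto
  then have [measurable]: "N \<in> sets borel" by (auto simp: null_sets_def)
  let ?F = "\<lambda>z::complex. indicator N (norm z) :: ennreal"
  have Nz: "AE r in lborel. r \<notin> N" using N(1) by (rule AE_not_in)
  have "(\<integral>\<^sup>+z. ?F z \<partial>lborel) = (\<integral>\<^sup>+t\<in>{0..0 + 2 * pi}. (\<integral>\<^sup>+r. ennreal r * indicator {0<..} r * ?F (of_real r * cis t) \<partial>lborel) \<partial>lborel)"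
    by (rule nn_integral_polar) measurable
  also have "(\<lambda>t. \<integral>\<^sup>+r. ennreal r * indicator {0<..} r * ?F (of_real r * cis t) \<partial>lborel) = (\<lambda>t. 0)"
  proof
    fix t
    have "(\<integral>\<^sup>+r. ennreal r * indicator {0<..} r * ?F (of_real r * cis t) \<partial>lborel) = (\<integral>\<^sup>+(r::real). 0 \<partial>lborel)"
      using Nz by (intro nn_integral_cong_AE) (auto elim!: eventually_mono simp: norm_mult split: split_indicator)
    then show "(\<integral>\<^sup>+r. ennreal r * indicator {0<..} r * ?F (of_real r * cis t) \<partial>lborel) = 0" by simp
  qed
  finally have "(\<integral>\<^sup>+z. ?F z \<partial>lborel) = 0" by simp
  then have "AE z in lborel. ?F z = 0" by (subst (asm) nn_integral_0_iff_AE) auto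
  moreover have "P r" if "0 < r" "r \<notin> N" for r using N(2) that by auto
  ultimately show ?thesis by (elim eventually_mono) (auto split: split_indicator_asm)
qed

text \<open>By polar coordinates almost every ray meets a null set in a null set of radii. One such
  ray is enough to read off the profile of a radial function.\<close>

lemma AE_ray_of_AE:
  assumes "AE z in (lborel :: complex measure). P z"
  obtains t where "AE r in lborel. 0 < r \<longrightarrow> P (of_real r * cis t)"
proof -
  obtain N where N: "N \<in> null_sets (lborel :: complex measure)" "{z. \<not> P z} \<subseteq> N"
    using assms unfolding eventually_ae_filter by auto
  then have [measurable]: "N \<in> sets borel" by (auto simp: null_sets_def)
  let ?Q = "\<lambda>t. \<integral>\<^sup>+r. ennreal r * indicator {0<..} r * indicator N (of_real r * cis t) \<partial>lborel"
  have "(\<integral>\<^sup>+t\<in>{0..0 + 2 * pi}. ?Q t \<partial>lborel) = (\<integral>\<^sup>+z. indicator N z \<partial>lborel)"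
    by (rule nn_integral_polar[symmetric]) measurable
  also have "\<dots> = 0" using N(1) by (auto simp: null_sets_def)
  finally have "AE t in lborel. ?Q t * indicator {0..0 + 2 * pi} t = 0" by (subst (asm) nn_integral_0_iff_AE) auto
  moreover have "\<not> (AE t in lborel. t \<notin> {0..2 * pi})"
  proof
    assume "AE t in lborel. t \<notin> {0..2 * pi}"
    then have "emeasure lborel {t \<in> space lborel. t \<in> {0..2 * pi}} = 0" by (rule emeasure_eq_0_AE)
    moreover have "{t \<in> space lborel. t \<in> {0..2 * pi}} = {0..2 * pi}" by auto
    ultimately have "emeasure lborel {0..2 * pi} = 0" by (simp only:)
    then show False by simp
  qed
  ultimately obtain t where t: "?Q t = 0" "t \<in> {0..2 * pi}"
  proof -
    assume that: "\<And>t. ?Q t = 0 \<Longrightarrow> t \<in> {0..2 * pi} \<Longrightarrow> thesis"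
      and *: "AE t in lborel. ?Q t * indicator {0..0 + 2 * pi} t = 0" "\<not> (AE t in lborel. t \<notin> {0..2 * pi})"
    show thesis
    proof (rule ccontr)
      assume "\<not> thesis"
      then have "?Q t \<noteq> 0 \<or> t \<notin> {0..2 * pi}" for t using that by blast
      then have "AE t in lborel. t \<notin> {0..2 * pi}"
        using *(1) by (elim eventually_mono) (auto split: split_indicator_asm)
      then show False using *(2) by simp
    qed
  qed
  have "AE r in lborel. ennreal r * indicator {0<..} r * indicator N (of_real r * cis t) = (0::ennreal)"
    using t(1) by (subst (asm) nn_integral_0_iff_AE) auto
  then show thesis using N(2)
    by (intro that[of t]) (auto elim!: eventually_mono split: split_indicator_asm)
qed

subsection \<open>Radial weights\<close>

lemma AE_scale_measure:
  assumes "AE x in M. P x" shows "AE x in scale_measure r M. P x"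
proof -
  obtain N where "N \<in> null_sets M" "{x \<in> space M. \<not> P x} \<subseteq> N"
    using assms unfolding eventually_ae_filter by auto
  moreover from this have "N \<in> null_sets (scale_measure r M)" by (auto simp: null_sets_def)
  ultimately show ?thesis unfolding eventually_ae_filter by (auto simp: space_scale_measure)
qed

lemma nn_integral_area_measure:
  assumes [measurable]: "g \<in> borel_measurable borel" and ae: "AE z in lborel. h z = g z"
  shows "(\<integral>\<^sup>+z. h z \<partial>area_measure) = ennreal (1 / pi) * (\<integral>\<^sup>+z. g z \<partial>lborel)"
proof -
  have "AE z in area_measure. h z = g z"
    unfolding area_measure_def by (intro AE_scale_measure AE_completion ae)
  then have "(\<integral>\<^sup>+z. h z \<partial>area_measure) = (\<integral>\<^sup>+z. g z \<partial>area_measure)" by (rule nn_integral_cong_AE)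
  also have "\<dots> = ennreal (1 / pi) * (\<integral>\<^sup>+z. g z \<partial>lebesgue)"
    unfolding area_measure_def by (intro nn_integral_scale_measure) (simp add: measurable_completion)
  finally show ?thesis by (simp add: nn_integral_completion)
qed

text \<open>
  A radial weight is only Lebesgue measurable in the plane; its profile along a suitable ray agrees
  almost everywhere with a Borel function of the radius.
\<close>
lemma radial_weight_profile:
  assumes "radial_weight \<omega>"
  obtains w where "w \<in> borel_measurable borel"
    "AE r in lborel. 0 < r \<and> r < 1 \<longrightarrow> ennreal (\<omega> (of_real r)) = w r"
    "AE z in lborel. z \<noteq> 0 \<and> norm z < 1 \<longrightarrow> ennreal (\<omega> z) = w (norm z)"
    "(\<integral>\<^sup>+r\<in>{0..<1}. w r * ennreal r \<partial>lborel) < \<infinity>"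
proof -
  have [measurable]: "ball (0::complex) 1 \<in> sets borel" by simp
  have wt: "weight \<omega>" by (rule assms[unfolded radial_weight_def, THEN conjunct1])
  have nonneg: "0 \<le> \<omega> z" if "z \<in> ball 0 1" for z
    by (rule bspec[OF conjunct1[OF wt[unfolded weight_def]] that])
  have rad: "\<omega> z = \<omega> (of_real (norm z))" if "z \<in> ball 0 1" for z
    by (rule bspec[OF conjunct2[OF assms[unfolded radial_weight_def]] that])
  have int: "integrable lebesgue (\<lambda>z. indicator (ball 0 1) z *\<^sub>R \<omega> z)"
    by (rule wt[unfolded weight_def set_integrable_def, THEN conjunct2])
  let ?h = "\<lambda>z. ennreal (indicator (ball 0 1) z *\<^sub>R \<omega> z)"
  have "?h \<in> borel_measurable (completion lborel)"
    by (rule measurable_compose[OF borel_measurable_integrable[OF int] measurable_ennreal])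
  then obtain g where g[measurable]: "g \<in> borel_measurable borel" and gae: "AE z in lborel. ?h z = g z"
    using completion_ex_borel_measurable[of ?h lborel] by auto
  obtain t where t: "AE r in lborel. 0 < r \<longrightarrow> ?h (of_real r * cis t) = g (of_real r * cis t)"
    using AE_ray_of_AE[OF gae] by blast
  define w where "w r = g (of_real r * cis t)" for r
  have w[measurable]: "w \<in> borel_measurable borel" unfolding w_def by measurable
  have w1: "AE r in lborel. 0 < r \<longrightarrow> r < 1 \<longrightarrow> ennreal (\<omega> (of_real r)) = w r"
    using t
  proof eventually_elim
    case (elim r)
    show ?case
    proof (intro impI)
      assume r: "0 < r" "r < 1"
      then have in_ball: "of_real r * cis t \<in> ball 0 1" by (simp add: norm_mult)
      then have "\<omega> (of_real r * cis t) = \<omega> (of_real r)" using rad[OF in_ball] r by (simp add: norm_mult)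
      then show "ennreal (\<omega> (of_real r)) = w r" using elim r in_ball by (simp add: w_def)
    qed
  qed
  have w2: "AE z in lborel. z \<noteq> 0 \<and> norm z < 1 \<longrightarrow> ennreal (\<omega> z) = w (norm z)"
    using AE_norm_of_AE[OF w1]
  proof eventually_elim
    case (elim z)
    show ?case using elim rad[of z] by auto
  qed
  have "(\<integral>\<^sup>+z. indicator (ball (0::complex) 1) z * w (norm z) \<partial>lborel) = (\<integral>\<^sup>+z. ?h z \<partial>lborel)"
    using w2 AE_lborel_singleton[of "0::complex"]
    by (intro nn_integral_cong_AE, eventually_elim) (auto split: split_indicator)
  also have "\<dots> = (\<integral>\<^sup>+z. ennreal (norm (indicator (ball 0 1) z *\<^sub>R \<omega> z)) \<partial>lebesgue)"
    unfolding nn_integral_completion using nonneg by (intro nn_integral_cong) (auto split: split_indicator)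
  also have "\<dots> < \<infinity>" using int by (simp add: integrable_iff_bounded)
  finally have fin: "(\<integral>\<^sup>+z. indicator (ball (0::complex) 1) z * w (norm z) \<partial>lborel) < \<infinity>" .
  let ?T = "\<integral>\<^sup>+r\<in>{0..<1}. w r * ennreal r \<partial>lborel"
  have "(\<integral>\<^sup>+z. indicator (ball (0::complex) 1) z * w (norm z) \<partial>lborel)
    = (\<integral>\<^sup>+s\<in>{0..0 + 2 * pi}. (\<integral>\<^sup>+r. ennreal r * indicator {0<..} r * (indicator (ball 0 1) (of_real r * cis s) * w (norm (of_real r * cis s))) \<partial>lborel) \<partial>lborel)"
    by (rule nn_integral_polar) measurable
  also have "\<dots> = (\<integral>\<^sup>+s\<in>{0..0 + 2 * pi}. ?T \<partial>lborel)"
  proof -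
    have "ennreal r * indicator {0<..} r * (indicator (ball 0 1) (of_real r * cis s) * w (norm (of_real r * cis s))) = w r * ennreal r * indicator {0..<1} r"
      for s r
      by (cases "r = 0") (auto simp: norm_mult mult_ac split: split_indicator)
    then show ?thesis by (simp only:)
  qed
  also have "\<dots> = ?T * ennreal (2 * pi)" by (subst nn_integral_cmult) auto
  finally have "?T < \<infinity>" using fin by (auto simp: ennreal_mult_less_top ennreal_mult_eq_top_iff less_top)
  moreover have "AE r in lborel. 0 < r \<and> r < 1 \<longrightarrow> ennreal (\<omega> (of_real r)) = w r"
    using w1 by eventually_elim auto
  ultimately show thesis using that[OF w _ w2] by blast
qed

text \<open>\<open>weight_hat\<close> lacks the factor r of the area element, but on [1/2, 1) the
  two tails agree up to a factor 2, so doubling passes to the tail with r near 1. Away from 1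
  doubling is automatic: the whole mass is finite, and tails are positive because
  \<open>weight_hat\<close> is.\<close>

lemma D_hat_doubling_tail:
  assumes "\<omega> \<in> D_hat"
  obtains w K where "doubling_tail (\<lambda>r. w r * ennreal r) K" "w \<in> borel_measurable borel"
    "AE r in lborel. 0 < r \<and> r < 1 \<longrightarrow> ennreal (\<omega> (of_real r)) = w r"
    "AE z in lborel. z \<noteq> 0 \<and> norm z < 1 \<longrightarrow> ennreal (\<omega> z) = w (norm z)"
proof -
  have rw: "radial_weight \<omega>" and pos: "\<And>z. z \<in> ball 0 1 \<Longrightarrow> 0 < weight_hat \<omega> z" using assms by (auto simp: D_hat_def)
  obtain C where C: "0 < C" "\<forall>\<^sub>F r in at_left (1::real).
           weight_hat \<omega> (of_real r) \<le> ennreal C * weight_hat \<omega> (of_real ((1 + r) / 2))"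
    using assms by (auto simp: D_hat_def)
  obtain w where w[measurable]: "w \<in> borel_measurable borel"
    and w1: "AE r in lborel. 0 < r \<and> r < 1 \<longrightarrow> ennreal (\<omega> (of_real r)) = w r"
    and w2: "AE z in lborel. z \<noteq> 0 \<and> norm z < 1 \<longrightarrow> ennreal (\<omega> z) = w (norm z)"
    and fin: "(\<integral>\<^sup>+r\<in>{0..<1}. w r * ennreal r \<partial>lborel) < \<infinity>"
    using radial_weight_profile[OF rw] by blast
  define T where "T r = (\<integral>\<^sup>+s\<in>{r..<1}. w s * ennreal s \<partial>lborel)" for r :: real
  define H where "H r = (\<integral>\<^sup>+s\<in>{r..<1}. w s \<partial>lborel)" for r :: real
  have H: "weight_hat \<omega> (of_real r) = H r" if "0 \<le> r" for r
    unfolding weight_hat_def H_def nn_integral_completion using w1 AE_lborel_singleton[of "0::real"]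
  proof (intro nn_integral_cong_AE, eventually_elim)
    case (elim s)
    then show ?case using that by (auto split: split_indicator)
  qed
  have TH: "T r \<le> H r" if "0 \<le> r" for r
    unfolding T_def H_def
  proof (rule nn_integral_mono)
    fix s
    show "w s * ennreal s * indicator {r..<1} s \<le> w s * indicator {r..<1} s"
      using that mult_left_mono[of "ennreal s" 1 "w s"] by (auto split: split_indicator)
  qed
  have HT: "H r \<le> 2 * T r" if "1/2 \<le> r" for r
  proof -
    have "H r \<le> (\<integral>\<^sup>+s. 2 * (w s * ennreal s * indicator {r..<1} s) \<partial>lborel)"
      unfolding H_def
    proof (rule nn_integral_mono)
      fix s
      have "1 \<le> 2 * ennreal s" if "r \<le> s"
      proof -
        have "1 \<le> ennreal (2 * s)" using that \<open>1/2 \<le> r\<close> by simp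
        then show ?thesis using that \<open>1/2 \<le> r\<close> by (simp add: ennreal_mult)
      qed
      then show "w s * indicator {r..<1} s \<le> 2 * (w s * ennreal s * indicator {r..<1} s)"
        using mult_left_mono[of 1 "2 * ennreal s" "w s"] by (auto simp: mult_ac split: split_indicator)
    qed
    then show ?thesis by (simp add: T_def nn_integral_cmult)
  qed
  have Tmono: "T r' \<le> T r" if "r \<le> r'" for r r'
    unfolding T_def using that by (intro nn_integral_mono mult_left_mono) (auto split: split_indicator)
  have Tpos: "0 < T r" if "r < 1" for r
  proof -
    have "0 < H (max r (1/2))" using H[of "max r (1/2)"] pos[of "of_real (max r (1/2))"] that by simp
    then have "0 < T (max r (1/2))" using HT[of "max r (1/2)"] by (auto simp: zero_less_iff_neq_zero)
    then show ?thesis using Tmono[of r "max r (1/2)"] by simp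
  qed
  have Tfin: "T 0 < \<infinity>" using fin by (simp add: T_def)
  obtain b where b: "b < 1" "\<And>r. b < r \<Longrightarrow> r < 1 \<Longrightarrow> weight_hat \<omega> (of_real r) \<le> ennreal C * weight_hat \<omega> (of_real ((1 + r) / 2))"
    using C(2) unfolding eventually_at_left_field by auto
  define r1 where "r1 = max b (1/2)"
  have r1: "r1 < 1" "b \<le> r1" "1/2 \<le> r1" using b by (auto simp: r1_def)
  obtain x0 where x0: "T 0 = ennreal x0" "0 \<le> x0" using Tfin by (cases "T 0") auto
  obtain x2 where x2: "T ((1 + r1) / 2) = ennreal x2" "0 \<le> x2"
    using Tfin Tmono[of 0 "(1 + r1) / 2"] r1 by (cases "T ((1 + r1) / 2)") (auto simp: top_unique)
  have x2pos: "0 < x2" using Tpos[of "(1 + r1) / 2"] x2 r1 by simp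
  \<comment> \<open>The term 2C serves r > r1. For r <= r1 the tail at r is at most x0, while the
    tail at (1 + r)/2 is at least x2, so x0/x2 suffices.\<close>
  define K where "K = 2 * C + x0 / x2"
  have K: "0 < K" using C x0 x2pos by (simp add: K_def add_pos_nonneg)
  have doub: "T r \<le> ennreal K * T ((1 + r) / 2)" if r: "0 \<le> r" "r < 1" for r
  proof (cases "r1 < r")
    case True
    have "T r \<le> H r" by (rule TH[OF r(1)])
    also have "\<dots> \<le> ennreal C * H ((1 + r) / 2)" using b(2)[of r] True r r1 H[of r] H[of "(1 + r) / 2"] by simp
    also have "\<dots> \<le> ennreal C * (2 * T ((1 + r) / 2))" using r by (intro mult_left_mono HT) auto
    also have "\<dots> = ennreal (2 * C) * T ((1 + r) / 2)" using C by (simp add: ennreal_mult mult_ac)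
    also have "\<dots> \<le> ennreal K * T ((1 + r) / 2)" using x0 x2pos by (intro mult_right_mono ennreal_leI) (auto simp: K_def)
    finally show ?thesis .
  next
    case False
    have "T r \<le> T 0" by (rule Tmono[OF r(1)])
    also have "\<dots> = ennreal (x0 / x2) * ennreal x2" using x0 x2pos by (subst ennreal_mult[symmetric]) auto
    also have "\<dots> \<le> ennreal K * T ((1 + r) / 2)"
      unfolding x2(1)[symmetric] using C False by (intro mult_mono ennreal_leI Tmono) (auto simp: K_def)
    finally show ?thesis .
  qed
  have "doubling_tail (\<lambda>r. w r * ennreal r) K"
    using K doub fin unfolding T_def by unfold_locales auto
  then show thesis using that w w1 w2 by blast
qed

subsection \<open>The lens regions in polar coordinates\<close>

lemma measurable_Arg [measurable]: "Arg \<in> borel_measurable borel"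
proof -
  have [measurable]: "(\<real>\<^sub>\<le>\<^sub>0 :: complex set) \<in> sets borel" by (intro borel_closed closed_nonpos_Reals_complex)
  have [measurable]: "(\<lambda>z. indicator (- \<real>\<^sub>\<le>\<^sub>0) z *\<^sub>R Arg z) \<in> borel_measurable borel"
    by (intro borel_measurable_continuous_on_indicator continuous_on_Arg) measurable
  have "Arg = (\<lambda>z. if z = 0 then 0 else if z \<in> \<real>\<^sub>\<le>\<^sub>0 then pi else indicator (- \<real>\<^sub>\<le>\<^sub>0) z *\<^sub>R Arg z)"
  proof
    fix z :: complex
    have "Arg z = pi" if "z \<noteq> 0" "z \<in> \<real>\<^sub>\<le>\<^sub>0"
      using that by (auto simp: Arg_eq_pi complex_nonpos_Reals_iff less_le complex_eq_iff)
    then show "Arg z = (if z = 0 then 0 else if z \<in> \<real>\<^sub>\<le>\<^sub>0 then pi else indicator (- \<real>\<^sub>\<le>\<^sub>0) z *\<^sub>R Arg z)"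
      by (simp add: Arg_zero)
  qed
  then show ?thesis by (subst \<open>Arg = _\<close>) measurable
qed

lemma measurable_Gamma_region [measurable]: "Gamma_region \<xi> \<in> sets borel"
proof -
  have [measurable]: "(ball 0 1 :: complex set) \<in> sets borel" by simp
  have "{z \<in> space borel. z \<in> ball 0 1 \<and> (\<exists>k::int. \<bar>Arg z - Arg \<xi> + 2 * pi * of_int k\<bar> < norm \<xi> - norm z)} \<in> sets borel"
    by measurable
  then show ?thesis by (simp add: Gamma_region_def)
qed

lemma Arg_cis_eq_mod: "0 < r \<Longrightarrow> \<exists>m::int. Arg (of_real r * cis t) = t + 2 * pi * of_int m"
proof -
  assume r: "0 < r"
  then have "of_real r * cis t \<noteq> 0" by simp
  then have "of_real r * cis t = of_real (norm (of_real r * cis t)) * cis (Arg (of_real r * cis t))"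
    by (simp add: rcis_cmod_Arg[unfolded rcis_def])
  then have "cis t = cis (Arg (of_real r * cis t))" using r by (simp add: norm_mult)
  then have "cos t = cos (Arg (of_real r * cis t))" "sin t = sin (Arg (of_real r * cis t))"
    by (metis cis.sel)+
  then show ?thesis using sin_cos_eq_iff[of "Arg (of_real r * cis t)" t] by simp
qed

text \<open>With t within pi of \<theta>, adding a nonzero multiple of 2 pi leaves a difference
  above pi, while the aperture 1 - r is below 1. So only the multiple that undoes the normalisation
  of \<open>Arg\<close> can occur.\<close>

lemma Gamma_region_polar:
  assumes r: "0 < r" "r < 1" and t: "\<bar>t - \<theta>\<bar> < pi"
  shows "of_real r * cis t \<in> Gamma_region (cis \<theta>) \<longleftrightarrow> \<bar>t - \<theta>\<bar> < 1 - r"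
proof -
  obtain m where m: "Arg (of_real r * cis t) = t + 2 * pi * of_int m" using Arg_cis_eq_mod[OF r(1)] by blast
  obtain n where n: "Arg (cis \<theta>) = \<theta> + 2 * pi * of_int n" using Arg_cis_eq_mod[of 1 \<theta>] by auto
  have eq: "Arg (of_real r * cis t) - Arg (cis \<theta>) + 2 * pi * of_int k = (t - \<theta>) + 2 * pi * of_int (m - n + k)" for k :: int
    unfolding m n by (simp add: algebra_simps)
  have small: "\<bar>t - \<theta>\<bar> < 1 - r" if k: "\<bar>(t - \<theta>) + 2 * pi * of_int k\<bar> < 1 - r" for k :: int
  proof (cases "k = 0")
    case False
    then have "1 \<le> \<bar>of_int k :: real\<bar>" by linarith
    then have "2 * pi \<le> \<bar>2 * pi * of_int k\<bar>" by (simp add: abs_mult)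
    then have "pi < \<bar>(t - \<theta>) + 2 * pi * of_int k\<bar>" using t by linarith
    then show ?thesis using k r pi_gt3 by linarith
  qed (use k in simp)
  show ?thesis
  proof
    assume "of_real r * cis t \<in> Gamma_region (cis \<theta>)"
    then obtain k :: int where "\<bar>Arg (of_real r * cis t) - Arg (cis \<theta>) + 2 * pi * of_int k\<bar> < 1 - r"
      using r by (auto simp: Gamma_region_def norm_mult)
    then show "\<bar>t - \<theta>\<bar> < 1 - r" using small unfolding eq by blast
  next
    assume "\<bar>t - \<theta>\<bar> < 1 - r"
    then have "\<bar>Arg (of_real r * cis t) - Arg (cis \<theta>) + 2 * pi * of_int (n - m)\<bar> < 1 - r" unfolding eq by simp
    then have "\<exists>k::int. \<bar>Arg (of_real r * cis t) - Arg (cis \<theta>) + 2 * pi * of_int k\<bar> < 1 - r" by blast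
    then show "of_real r * cis t \<in> Gamma_region (cis \<theta>)"
      using r by (simp add: Gamma_region_def norm_mult)
  qed
qed

section \<open>Both inner integrals expressed through one radial measure\<close>

lemma radial_integral_eq:
  assumes dt: "doubling_tail (\<lambda>r. w r * ennreal r) K" and w[measurable]: "w \<in> borel_measurable borel"
    and w1: "AE r in lborel. 0 < r \<and> r < 1 \<longrightarrow> ennreal (\<omega> (of_real r)) = w r"
    and f0[measurable]: "f0 \<in> borel_measurable borel" and f: "\<And>z. z \<in> ball 0 1 \<Longrightarrow> f z = f0 z"
  shows "(\<integral>\<^sup>+r \<in> {0..<1}. ennreal (norm (f (of_real r * cis \<theta>)) powr p * \<omega> (of_real r) * r) \<partial>lebesgue)
    = (\<integral>\<^sup>+r. radial_power p f0 r \<theta> \<partial>doubling_tail.\<nu> (\<lambda>r. w r * ennreal r))"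
proof -
  interpret doubling_tail "\<lambda>r. w r * ennreal r" K by fact
  have "(\<lambda>r. radial_power p f0 r \<theta>) \<in> borel_measurable borel" by measurable
  then have "(\<integral>\<^sup>+r. radial_power p f0 r \<theta> \<partial>\<nu>) = (\<integral>\<^sup>+r. w r * ennreal r * indicator {0..<1} r * radial_power p f0 r \<theta> \<partial>lborel)"
    by (rule nn_integral_\<nu>)
  also have "\<dots> = (\<integral>\<^sup>+r\<in>{0..<1}. ennreal (norm (f (of_real r * cis \<theta>)) powr p * \<omega> (of_real r) * r) \<partial>lborel)"
    using w1 AE_lborel_singleton[of "0::real"]
  proof (intro nn_integral_cong_AE, eventually_elim)
    case (elim r)
    show ?case
    proof (cases "0 < r \<and> r < 1")
      case True
      have "f (of_real r * cis \<theta>) = f0 (of_real r * cis \<theta>)" using True by (intro f) (simp add: norm_mult)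
      moreover have "ennreal (a * b * c) = ennreal b * ennreal c * ennreal a" if "0 \<le> a" "0 \<le> c" for a b c
        using that by (simp add: ennreal_mult' ennreal_mult'' mult_ac)
      ultimately show ?thesis using elim True by (simp add: radial_power_def)
    next
      case False
      then show ?thesis using elim by (auto split: split_indicator)
    qed
  qed
  finally show ?thesis by (simp add: nn_integral_completion)
qed

text \<open>Of the factor 2/pi, 1/pi is the normalisation of area; the 2 arises because the kernel
  1/(1 - r) is twice the reciprocal of the arc length 2(1 - r). Angles are taken in an interval
  centred at \<theta>, so the arc, of half-length below 1, never meets its ends.\<close>

lemma lens_integral_eq:
  assumes dt: "doubling_tail (\<lambda>r. w r * ennreal r) K" and w[measurable]: "w \<in> borel_measurable borel"
    and w2: "AE z in lborel. z \<noteq> 0 \<and> norm z < 1 \<longrightarrow> ennreal (\<omega> z) = w (norm z)"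
    and f0[measurable]: "f0 \<in> borel_measurable borel" and f: "\<And>z. z \<in> ball 0 1 \<Longrightarrow> f z = f0 z"
  shows "(\<integral>\<^sup>+z \<in> Gamma_region (cis \<theta>). ennreal (norm (f z) powr p * \<omega> z / (1 - norm z)) \<partial>area_measure)
    = ennreal (2 / pi) * (\<integral>\<^sup>+r. arc_average p f0 r \<theta> \<partial>doubling_tail.\<nu> (\<lambda>r. w r * ennreal r))"
proof -
  interpret doubling_tail "\<lambda>r. w r * ennreal r" K by fact
  define H where "H z = ennreal (norm (f0 z) powr p) * w (norm z) * ennreal (1 / (1 - norm z)) * indicator (Gamma_region (cis \<theta>)) z" for z
  have H[measurable]: "H \<in> borel_measurable borel" unfolding H_def by measurable
  have "AE z in lborel. ennreal (norm (f z) powr p * \<omega> z / (1 - norm z)) * indicator (Gamma_region (cis \<theta>)) z = H z"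
    using w2 AE_lborel_singleton[of "0::complex"]
  proof eventually_elim
    case (elim z)
    show ?case
    proof (cases "z \<in> Gamma_region (cis \<theta>)")
      case True
      then have z: "norm z < 1" by (auto simp: Gamma_region_def)
      have "ennreal (a * b / c) = ennreal a * ennreal b * ennreal (1 / c)" if "0 \<le> a" "0 < c" for a b c
        using that by (simp add: ennreal_mult' ennreal_mult'' divide_inverse)
      then show ?thesis using elim z f[of z] True by (simp add: H_def)
    qed (simp add: H_def)
  qed
  then have "(\<integral>\<^sup>+z \<in> Gamma_region (cis \<theta>). ennreal (norm (f z) powr p * \<omega> z / (1 - norm z)) \<partial>area_measure)
    = ennreal (1 / pi) * (\<integral>\<^sup>+z. H z \<partial>lborel)"
    by (rule nn_integral_area_measure[OF H])
  also have "(\<integral>\<^sup>+z. H z \<partial>lborel) = (\<integral>\<^sup>+t\<in>{\<theta> - pi..\<theta> - pi + 2 * pi}. (\<integral>\<^sup>+r. ennreal r * indicator {0<..} r * H (of_real r * cis t) \<partial>lborel) \<partial>lborel)"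
    by (rule nn_integral_polar) measurable
  also have "\<dots> = (\<integral>\<^sup>+t. (\<integral>\<^sup>+r. w r * ennreal r * indicator {0<..<1} r * ennreal (1 / (1 - r)) * (radial_power p f0 r t * indicator {t. \<bar>t - \<theta>\<bar> < 1 - r} t) \<partial>lborel) \<partial>lborel)"
    using AE_lborel_singleton[of "\<theta> - pi"] AE_lborel_singleton[of "\<theta> + pi"]
  proof (intro nn_integral_cong_AE, eventually_elim)
    case (elim t)
    show ?case
    proof (cases "\<bar>t - \<theta>\<bar> < pi")
      case True
      have "ennreal r * indicator {0<..} r * H (of_real r * cis t)
        = w r * ennreal r * indicator {0<..<1} r * ennreal (1 / (1 - r)) * (radial_power p f0 r t * indicator {t. \<bar>t - \<theta>\<bar> < 1 - r} t)" for r
      proof (cases "0 < r \<and> r < 1")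
        case r: True
        then show ?thesis using Gamma_region_polar[of r t \<theta>] True
          by (simp add: H_def radial_power_def norm_mult mult_ac split: split_indicator)
      next
        case False
        moreover have "H (of_real r * cis t) = 0" if "1 \<le> r" using that by (auto simp: H_def Gamma_region_def norm_mult split: split_indicator)
        ultimately show ?thesis by (cases "0 < r") auto
      qed
      moreover have "t \<in> {\<theta> - pi..\<theta> - pi + 2 * pi}" using True by auto
      ultimately show ?thesis by simp
    next
      case False
      have "indicator {0<..<1} r * (indicator {t. \<bar>t - \<theta>\<bar> < 1 - r} t :: ennreal) = 0" for r
        using False pi_gt3 by (auto split: split_indicator)
      then have "w r * ennreal r * indicator {0<..<1} r * ennreal (1 / (1 - r)) * (radial_power p f0 r t * indicator {t. \<bar>t - \<theta>\<bar> < 1 - r} t) = 0" for r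
        by (auto split: split_indicator_asm)
      moreover have "t \<notin> {\<theta> - pi..\<theta> - pi + 2 * pi}" using False elim by auto
      ultimately show ?thesis by (simp only:) simp
    qed
  qed
  also have "\<dots> = (\<integral>\<^sup>+r. (\<integral>\<^sup>+t. w r * ennreal r * indicator {0<..<1} r * ennreal (1 / (1 - r)) * (radial_power p f0 r t * indicator {t. \<bar>t - \<theta>\<bar> < 1 - r} t) \<partial>lborel) \<partial>lborel)"
    by (rule lborel_pair.Fubini') (unfold indicator_def, measurable)
  also have "\<dots> = (\<integral>\<^sup>+r. 2 * (w r * ennreal r * indicator {0..<1} r * arc_average p f0 r \<theta>) \<partial>lborel)"
  proof (rule nn_integral_cong)
    fix r :: real
    have eq: "(\<integral>\<^sup>+t. w r * ennreal r * indicator {0<..<1} r * ennreal (1 / (1 - r)) * (radial_power p f0 r t * indicator {t. \<bar>t - \<theta>\<bar> < 1 - r} t) \<partial>lborel)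
      = w r * ennreal r * indicator {0<..<1} r * (ennreal (1 / (1 - r)) * (\<integral>\<^sup>+t\<in>{t. \<bar>t - \<theta>\<bar> < 1 - r}. radial_power p f0 r t \<partial>lborel))"
      by (subst nn_integral_cmult) (auto simp: mult.assoc)
    \<comment> \<open>For r >= 1 both sides are 0, since \<open>ennreal\<close> truncates negative
      numbers and division by zero gives 0.\<close>
    have half: "ennreal (1 / (1 - r)) = 2 * ennreal (1 / (2 * (1 - r)))"
    proof (cases "r < 1")
      case True
      have "2 * ennreal (1 / (2 * (1 - r))) = ennreal (2 * (1 / (2 * (1 - r))))" using True by (subst ennreal_mult) auto
      moreover have "2 * (1 / (2 * x)) = 1 / x" for x :: real by simp
      ultimately show ?thesis by (simp only:)
    next
      case False
      then have "1 / (1 - r) \<le> 0" "1 / (2 * (1 - r)) \<le> 0" by (auto simp: divide_le_0_iff)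
      then show ?thesis by (simp add: ennreal_neg)
    qed
    have ind: "w r * ennreal r * indicator {0<..<1} r = w r * ennreal r * indicator {0..<1} r"
      by (cases "r = 0") (auto split: split_indicator)
    show "(\<integral>\<^sup>+t. w r * ennreal r * indicator {0<..<1} r * ennreal (1 / (1 - r)) * (radial_power p f0 r t * indicator {t. \<bar>t - \<theta>\<bar> < 1 - r} t) \<partial>lborel)
      = 2 * (w r * ennreal r * indicator {0..<1} r * arc_average p f0 r \<theta>)"
      unfolding eq unfolding half ind arc_average_def by (simp only: mult_ac)
  qed
  also have "\<dots> = 2 * (\<integral>\<^sup>+r. w r * ennreal r * indicator {0..<1} r * arc_average p f0 r \<theta> \<partial>lborel)"
    by (rule nn_integral_cmult) measurable
  also have "(\<integral>\<^sup>+r. w r * ennreal r * indicator {0..<1} r * arc_average p f0 r \<theta> \<partial>lborel) = (\<integral>\<^sup>+r. arc_average p f0 r \<theta> \<partial>\<nu>)"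
    by (rule nn_integral_\<nu>[symmetric]) measurable
  also have "ennreal (1 / pi) * (2 * (\<integral>\<^sup>+r. arc_average p f0 r \<theta> \<partial>\<nu>)) = ennreal (2 / pi) * (\<integral>\<^sup>+r. arc_average p f0 r \<theta> \<partial>\<nu>)"
  proof -
    have "ennreal (1 / pi) * 2 = ennreal (1 / pi * 2)" by (subst ennreal_mult) auto
    then show ?thesis by (simp add: mult.assoc[symmetric])
  qed
  finally show ?thesis .
qed

theorem theorem1p3:
  fixes p q :: real and \<omega> :: "complex \<Rightarrow> real"
  assumes "0 < p" and "0 < q" and "\<omega> \<in> D_hat"
  shows "AL_space p q \<omega> = AT_space p q \<omega> \<and>
    (\<exists>C::real. C > 0 \<and>
       (\<forall>f\<in>AL_space p q \<omega>.
          T_norm p q \<omega> f \<le> ennreal C * L_norm p q \<omega> f \<and>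
          L_norm p q \<omega> f \<le> ennreal C * T_norm p q \<omega> f))"
proof -
  define a where "a = q / p"
  have a: "0 < a" using assms by (simp add: a_def)
  obtain w K where dt: "doubling_tail (\<lambda>r. w r * ennreal r) K" and w: "w \<in> borel_measurable borel"
    and w1: "AE r in lborel. 0 < r \<and> r < 1 \<longrightarrow> ennreal (\<omega> (of_real r)) = w r"
    and w2: "AE z in lborel. z \<noteq> 0 \<and> norm z < 1 \<longrightarrow> ennreal (\<omega> z) = w (norm z)"
    using D_hat_doubling_tail[OF assms(3)] by blast
  interpret doubling_tail "\<lambda>r. w r * ennreal r" K by fact
  define IL where "IL f = (mixed_integral a \<nu> (radial_power p f) {0..2 * pi})" for f
  define IT where "IT f = (mixed_integral a \<nu> (arc_average p f) {0..2 * pi})" for f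
  obtain C where C: "0 < C"
    and CL: "\<And>f. \<lbrakk>f holomorphic_on ball 0 1; f \<in> borel_measurable borel\<rbrakk> \<Longrightarrow> IL f \<le> ennreal C * IT f"
    and CT: "\<And>f. \<lbrakk>f holomorphic_on ball 0 1; f \<in> borel_measurable borel\<rbrakk> \<Longrightarrow> IT f \<le> ennreal C * IL f"
    using radial_arc_comparison[OF assms(1) a] unfolding IL_def IT_def by blast
  \<comment> \<open>The norms are c1 and c2 times the power 1/q of the mixed integrals: c1 comes
    from the normalised angle, c2 from the factor 2/pi of the lens integral, raised to the power a
    inside. \<open>D\<close> below exceeds both transition constants.\<close>
  define c1 where "c1 = (1 / (2 * pi)) powr (1 / q)"
  define c2 where "c2 = ((2 / pi) powr a) powr (1 / q)"
  define cC where "cC = C powr (1 / q)"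
  have cpos: "0 < c1" "0 < c2" "0 < cC" using C by (auto simp: c1_def c2_def cC_def)
  define D where "D = c1 * cC / c2 + c2 * cC / c1"
  have D: "0 < D" "c1 * cC / c2 \<le> D" "c2 * cC / c1 \<le> D" using cpos by (auto simp: D_def add_pos_pos)
  have main: "T_norm p q \<omega> f \<le> ennreal D * L_norm p q \<omega> f \<and> L_norm p q \<omega> f \<le> ennreal D * T_norm p q \<omega> f"
    if hol: "f holomorphic_on ball 0 1" for f
  proof -
    \<comment> \<open>Values outside the disc are arbitrary, possibly not measurable; cutting off by
      0 gives a Borel function on the plane with the same norms.\<close>
    define f0 where "f0 z = indicator (ball 0 1) z *\<^sub>R f z" for z
    have f0m: "f0 \<in> borel_measurable borel"
      unfolding f0_def using holomorphic_on_imp_continuous_on[OF hol] by (intro borel_measurable_continuous_on_indicator) auto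
    have ff0: "f z = f0 z" if "z \<in> ball 0 1" for z using that by (simp add: f0_def)
    have f0h: "f0 holomorphic_on ball 0 1" using hol by (rule holomorphic_transform) (rule ff0)
    have scale: "ennreal_powr (\<integral>\<^sup>+\<theta>. x * h \<theta> \<partial>lborel) (1 / q) = ennreal_powr x (1 / q) * ennreal_powr (\<integral>\<^sup>+\<theta>. h \<theta> \<partial>lborel) (1 / q)"
      if "h \<in> borel_measurable borel" for x h
      using that assms(2) by (simp add: nn_integral_cmult ennreal_powr_mult)
    have inner: "(\<integral>\<^sup>+r \<in> {0..<1}. ennreal (norm (f (of_real r * cis \<theta>)) powr p * \<omega> (of_real r) * r) \<partial>lebesgue)
      = (\<integral>\<^sup>+r. radial_power p f0 r \<theta> \<partial>\<nu>)" for \<theta>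
      by (rule radial_integral_eq[OF dt w w1 f0m ff0])
    have lens: "(\<integral>\<^sup>+z \<in> Gamma_region (cis \<theta>). ennreal (norm (f z) powr p * \<omega> z / (1 - norm z)) \<partial>area_measure)
      = ennreal (2 / pi) * (\<integral>\<^sup>+r. arc_average p f0 r \<theta> \<partial>\<nu>)" for \<theta>
      by (rule lens_integral_eq[OF dt w w2 f0m ff0])
    have L: "L_norm p q \<omega> f = ennreal c1 * ennreal_powr (IL f0) (1 / q)"
    proof -
      have "L_norm p q \<omega> f = ennreal_powr (ennreal (1 / (2 * pi)) * IL f0) (1 / q)"
        unfolding L_norm_def inner by (simp only: IL_def a_def nn_integral_completion)
      also have "\<dots> = ennreal c1 * ennreal_powr (IL f0) (1 / q)"
        unfolding c1_def using assms(2) by (intro ennreal_powr_cmult) auto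
      finally show ?thesis .
    qed
    have meas: "(\<lambda>\<theta>. \<integral>\<^sup>+r. arc_average p f0 r \<theta> \<partial>\<nu>) \<in> borel_measurable borel"
    proof (intro measurable_nn_integral_swapped sigma_finite_\<nu>)
      show "(\<lambda>(r, t). arc_average p f0 r t) \<in> borel_measurable (\<nu> \<Otimes>\<^sub>M borel)"
        using measurable_arc_average[OF f0m] by (simp cong: measurable_cong_sets sets_pair_measure_cong)
    qed
    have T: "T_norm p q \<omega> f = ennreal c2 * ennreal_powr (IT f0) (1 / q)"
    proof -
      have "T_norm p q \<omega> f = ennreal_powr (\<integral>\<^sup>+\<theta>. ennreal ((2 / pi) powr a) * (ennreal_powr (\<integral>\<^sup>+r. arc_average p f0 r \<theta> \<partial>\<nu>) a * indicator {0..2 * pi} \<theta>) \<partial>lborel) (1 / q)"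
        unfolding T_norm_def lens nn_integral_completion a_def[symmetric]
        using a by (simp add: ennreal_powr_cmult mult.assoc)
      also have "\<dots> = ennreal_powr (ennreal ((2 / pi) powr a)) (1 / q) * ennreal_powr (IT f0) (1 / q)"
        unfolding IT_def
        by (intro scale borel_measurable_times_ennreal measurable_ennreal_powr meas borel_measurable_indicator) auto
      finally show ?thesis by (simp add: c2_def ennreal_powr_ennreal)
    qed
    have powC: "ennreal_powr x (1 / q) \<le> ennreal cC * ennreal_powr y (1 / q)" if "x \<le> ennreal C * y" for x y
      using ennreal_powr_mono[OF that, of "1 / q"] assms(2) C by (simp add: ennreal_powr_cmult cC_def)
    have fin: "ennreal c * x \<le> ennreal D * (ennreal d * y)"
      if "x \<le> ennreal cC * y" "c * cC / d \<le> D" "0 < c" "0 < d" for x y :: ennreal and c d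
    proof -
      have "ennreal c * x \<le> ennreal c * (ennreal cC * y)" using that by (intro mult_left_mono) auto
      also have "\<dots> = ennreal (c * cC) * y" using that cpos by (simp add: ennreal_mult mult.assoc)
      also have "\<dots> \<le> ennreal (D * d) * y"
        using that by (intro mult_right_mono ennreal_leI) (auto simp: field_simps)
      also have "\<dots> = ennreal D * (ennreal d * y)" using that D by (simp add: ennreal_mult mult.assoc)
      finally show ?thesis .
    qed
    show ?thesis unfolding L T using CL[OF f0h f0m] CT[OF f0h f0m] D cpos powC by (intro conjI fin) auto
  qed
  \<comment> \<open>Since \<open>main\<close> is an inequality in \<open>ennreal\<close> for every
    holomorphic f, with infinite norms allowed, finiteness passes in both directions and the spaces
    coincide.\<close>
  have "T_norm p q \<omega> f < \<infinity> \<longleftrightarrow> L_norm p q \<omega> f < \<infinity>" if "f holomorphic_on ball 0 1" for f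
    using main[OF that] by (auto simp: less_top[symmetric] ennreal_mult_eq_top_iff top_unique)
  then have "AL_space p q \<omega> = AT_space p q \<omega>"
    unfolding AL_space_def AT_space_def L_space_def T_space_def by auto
  moreover have "\<forall>f\<in>AL_space p q \<omega>. T_norm p q \<omega> f \<le> ennreal D * L_norm p q \<omega> f \<and> L_norm p q \<omega> f \<le> ennreal D * T_norm p q \<omega> f"
    using main by (auto simp: AL_space_def)
  ultimately show ?thesis using D(1) by blast
qed

end
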